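(* Let $\mathbf{B}$ be a commutative unital ring, let $\mathfrak{Mod}$ be the category of (left, unital) $\mathbf{B}$-modules and $\mathfrak{FMod}$ its full subcategory of finitely generated free modules. Any (not necessarily additive) functor $F\colon\mathfrak{FMod}\to\mathfrak{Mod}$ has an extension to a functor $\hat F\colon\mathfrak{Mod}\to\mathfrak{Mod}$ that is right-exact (in the non-additive sense) and commutes with filtered inductive limits; such an extension is unique (up to natural isomorphism compatible with the identification of the restriction to $\mathfrak{FMod}$ with $F$).
   Context: A (not necessarily additive) functor $F$ between abelian categories is called right-exact if for any exact sequence $A\xrightarrow{\alpha}B\xrightarrow{\beta}C\to 0$ the associated sequence $$F(A\oplus B)\xrightarrow{\;F(\alpha+1_B)-F(1_B)\;}F(B)\xrightarrow{\;F(\beta)\;}F(C)\to 0$$ is exact. Here $\alpha+1_B\colon A\oplus B\to B$ is the map with components $\alpha$ and $1_B$, and the second $1_B$ denotes the map $A\oplus B\to B$ with components $0$ and $1_B$ (the projection). Filtered inductive limits are filtered colimits. An extension of $F$ is a functor $\hat F$ whose restriction to $\mathfrak{FMod}$ is (naturally isomorphic to) $F$. *)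

theory Defs
  imports "HOL-Algebra.AbelCoset" "Jordan_Normal_Form.Missing_VectorSpace"
begin

section \<open>Universes\<close>

text \<open>
  A category of ``all'' modules needs a notion of size. Modules and index categories live on
  subsets of a type \<open>'u\<close> that are small in the following sense. Both the small sets of a
  Grothendieck universe (or of a type of ZF sets) and \<^emph>\<open>all\<close> subsets of an arbitrary infinite
  type are instances; closure under power sets is not required.
\<close>

locale universe =
  fixes small :: "'u set \<Rightarrow> bool"
  assumes small_subset: "small A \<Longrightarrow> B \<subseteq> A \<Longrightarrow> small B"
    and small_image: "small A \<Longrightarrow> small (f ` A)"
    and small_UN: "small I \<Longrightarrow> (\<And>i. i \<in> I \<Longrightarrow> small (S i)) \<Longrightarrow> small (\<Union>i\<in>I. S i)"
    and small_infinite: "\<exists>A. small A \<and> infinite A"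

lemma universe_UNIV: "infinite (UNIV :: 'u set) \<Longrightarrow> universe (\<lambda>_ :: 'u set. True)"
  by unfold_locales auto


section \<open>Categories, functors, filtered colimits\<close>

text \<open>
  Hom-sets need not be disjoint, so composition and the action of a functor on arrows carry
  the objects involved: \<open>cmp C A B D g f\<close> is the composite of \<open>f : A \<rightarrow> B\<close> and \<open>g : B \<rightarrow> D\<close>.
\<close>

record ('o, 'm) category =
  obj :: "'o set"
  arr :: "'o \<Rightarrow> 'o \<Rightarrow> 'm set"
  idt :: "'o \<Rightarrow> 'm"
  cmp :: "'o \<Rightarrow> 'o \<Rightarrow> 'o \<Rightarrow> 'm \<Rightarrow> 'm \<Rightarrow> 'm"

locale category =
  fixes C :: "('o, 'm) category"
  assumes idt_arr: "A \<in> obj C \<Longrightarrow> idt C A \<in> arr C A A"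
    and cmp_arr: "\<lbrakk>A \<in> obj C; B \<in> obj C; D \<in> obj C; f \<in> arr C A B; g \<in> arr C B D\<rbrakk>
      \<Longrightarrow> cmp C A B D g f \<in> arr C A D"
    and cmp_idt_right: "\<lbrakk>A \<in> obj C; B \<in> obj C; f \<in> arr C A B\<rbrakk>
      \<Longrightarrow> cmp C A A B f (idt C A) = f"
    and cmp_idt_left: "\<lbrakk>A \<in> obj C; B \<in> obj C; f \<in> arr C A B\<rbrakk>
      \<Longrightarrow> cmp C A B B (idt C B) f = f"
    and cmp_assoc: "\<lbrakk>A \<in> obj C; B \<in> obj C; D \<in> obj C; E \<in> obj C;
        f \<in> arr C A B; g \<in> arr C B D; h \<in> arr C D E\<rbrakk>
      \<Longrightarrow> cmp C A D E h (cmp C A B D g f) = cmp C A B E (cmp C B D E h g) f"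

definition full_subcategory :: "('o, 'm) category \<Rightarrow> ('o \<Rightarrow> bool) \<Rightarrow> ('o, 'm) category" where
  "full_subcategory C P = C\<lparr>obj := {A \<in> obj C. P A}\<rparr>"

record ('o1, 'm1, 'o2, 'm2) func =
  fobj :: "'o1 \<Rightarrow> 'o2"
  farr :: "'o1 \<Rightarrow> 'o1 \<Rightarrow> 'm1 \<Rightarrow> 'm2"

definition is_functor ::
  "('o1, 'm1) category \<Rightarrow> ('o2, 'm2) category \<Rightarrow> ('o1, 'm1, 'o2, 'm2) func \<Rightarrow> bool" where
  "is_functor C D F \<longleftrightarrow>
    (\<forall>A \<in> obj C. fobj F A \<in> obj D) \<and>
    (\<forall>A \<in> obj C. \<forall>B \<in> obj C. \<forall>f \<in> arr C A B. farr F A B f \<in> arr D (fobj F A) (fobj F B)) \<and>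
    (\<forall>A \<in> obj C. farr F A A (idt C A) = idt D (fobj F A)) \<and>
    (\<forall>A \<in> obj C. \<forall>B \<in> obj C. \<forall>E \<in> obj C. \<forall>f \<in> arr C A B. \<forall>g \<in> arr C B E.
      farr F A E (cmp C A B E g f)
        = cmp D (fobj F A) (fobj F B) (fobj F E) (farr F B E g) (farr F A B f))"

definition func_comp ::
  "('o2, 'm2, 'o3, 'm3) func \<Rightarrow> ('o1, 'm1, 'o2, 'm2) func \<Rightarrow> ('o1, 'm1, 'o3, 'm3) func" where
  "func_comp G F = \<lparr>fobj = (\<lambda>A. fobj G (fobj F A)),
                    farr = (\<lambda>A B f. farr G (fobj F A) (fobj F B) (farr F A B f))\<rparr>"

definition nat_trans ::
  "('o1, 'm1) category \<Rightarrow> ('o2, 'm2) category \<Rightarrow> ('o1, 'm1, 'o2, 'm2) func \<Rightarrow>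
   ('o1, 'm1, 'o2, 'm2) func \<Rightarrow> ('o1 \<Rightarrow> 'm2) \<Rightarrow> bool" where
  "nat_trans C D F G \<eta> \<longleftrightarrow>
    (\<forall>A \<in> obj C. \<eta> A \<in> arr D (fobj F A) (fobj G A)) \<and>
    (\<forall>A \<in> obj C. \<forall>B \<in> obj C. \<forall>f \<in> arr C A B.
      cmp D (fobj F A) (fobj F B) (fobj G B) (\<eta> B) (farr F A B f)
        = cmp D (fobj F A) (fobj G A) (fobj G B) (farr G A B f) (\<eta> A))"

definition is_iso :: "('o, 'm) category \<Rightarrow> 'o \<Rightarrow> 'o \<Rightarrow> 'm \<Rightarrow> bool" where
  "is_iso C A B f \<longleftrightarrow> f \<in> arr C A B \<and>
    (\<exists>g \<in> arr C B A. cmp C A B A g f = idt C A \<and> cmp C B A B f g = idt C B)"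

definition nat_iso ::
  "('o1, 'm1) category \<Rightarrow> ('o2, 'm2) category \<Rightarrow> ('o1, 'm1, 'o2, 'm2) func \<Rightarrow>
   ('o1, 'm1, 'o2, 'm2) func \<Rightarrow> ('o1 \<Rightarrow> 'm2) \<Rightarrow> bool" where
  "nat_iso C D F G \<eta> \<longleftrightarrow> nat_trans C D F G \<eta> \<and>
    (\<forall>A \<in> obj C. is_iso D (fobj F A) (fobj G A) (\<eta> A))"

definition is_cocone ::
  "('j, 'n) category \<Rightarrow> ('o, 'm) category \<Rightarrow> ('j, 'n, 'o, 'm) func \<Rightarrow> 'o \<Rightarrow> ('j \<Rightarrow> 'm) \<Rightarrow> bool" where
  "is_cocone J C D L l \<longleftrightarrow> L \<in> obj C \<and>
    (\<forall>i \<in> obj J. l i \<in> arr C (fobj D i) L) \<and>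
    (\<forall>i \<in> obj J. \<forall>j \<in> obj J. \<forall>f \<in> arr J i j.
      cmp C (fobj D i) (fobj D j) L (l j) (farr D i j f) = l i)"

definition is_colimit ::
  "('j, 'n) category \<Rightarrow> ('o, 'm) category \<Rightarrow> ('j, 'n, 'o, 'm) func \<Rightarrow> 'o \<Rightarrow> ('j \<Rightarrow> 'm) \<Rightarrow> bool" where
  "is_colimit J C D L l \<longleftrightarrow> is_cocone J C D L l \<and>
    (\<forall>L' l'. is_cocone J C D L' l' \<longrightarrow>
      (\<exists>!h. h \<in> arr C L L' \<and> (\<forall>i \<in> obj J. cmp C (fobj D i) L L' h (l i) = l' i)))"

definition filtered :: "('j, 'n) category \<Rightarrow> bool" where
  "filtered J \<longleftrightarrow> obj J \<noteq> {} \<and>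
    (\<forall>i \<in> obj J. \<forall>j \<in> obj J. \<exists>k \<in> obj J. arr J i k \<noteq> {} \<and> arr J j k \<noteq> {}) \<and>
    (\<forall>i \<in> obj J. \<forall>j \<in> obj J. \<forall>f \<in> arr J i j. \<forall>g \<in> arr J i j.
      \<exists>k \<in> obj J. \<exists>h \<in> arr J j k. cmp J i j k h f = cmp J i j k h g)"

definition small_category :: "('u set \<Rightarrow> bool) \<Rightarrow> ('u, 'u) category \<Rightarrow> bool" where
  "small_category small J \<longleftrightarrow> category J \<and> small (obj J) \<and>
    (\<forall>i \<in> obj J. \<forall>j \<in> obj J. small (arr J i j))"

definition preserves_filtered_colimits ::
  "('u set \<Rightarrow> bool) \<Rightarrow> ('o1, 'm1) category \<Rightarrow> ('o2, 'm2) category \<Rightarrow>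
   ('o1, 'm1, 'o2, 'm2) func \<Rightarrow> bool" where
  "preserves_filtered_colimits small C E F \<longleftrightarrow>
    (\<forall>(J :: ('u, 'u) category) D L l.
      small_category small J \<and> filtered J \<and> is_functor J C D \<and> is_colimit J C D L l \<longrightarrow>
      is_colimit J E (func_comp F D) (fobj F L) (\<lambda>i. farr F (fobj D i) L (l i)))"


section \<open>Module categories\<close>

text \<open>
  Homomorphisms are extensional (undefined outside the carrier of the source), so that equality
  of arrows is equality on that carrier.
\<close>

definition MOD ::
  "('u set \<Rightarrow> bool) \<Rightarrow> 'a ring \<Rightarrow> (('a, 'u) module, 'u \<Rightarrow> 'u) category" where
  "MOD small R =
    \<lparr>obj = {M. module R M \<and> small (carrier M)},
     arr = (\<lambda>M N. module_hom R M N \<inter> extensional (carrier M)),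
     idt = (\<lambda>M. restrict (\<lambda>x. x) (carrier M)),
     cmp = (\<lambda>M N P g f. compose (carrier M) g f)\<rparr>"

definition finitely_generated :: "'a ring \<Rightarrow> ('a, 'u) module \<Rightarrow> bool" where
  "finitely_generated R M \<longleftrightarrow>
    (\<exists>S. finite S \<and> S \<subseteq> carrier M \<and> module.span R M S = carrier M)"

definition free_module :: "'a ring \<Rightarrow> ('a, 'u) module \<Rightarrow> bool" where
  "free_module R M \<longleftrightarrow>
    (\<exists>S. S \<subseteq> carrier M \<and> \<not> module.lin_dep R M S \<and> module.span R M S = carrier M)"

definition FMOD ::
  "('u set \<Rightarrow> bool) \<Rightarrow> 'a ring \<Rightarrow> (('a, 'u) module, 'u \<Rightarrow> 'u) category" where
  "FMOD small R =
    full_subcategory (MOD small R) (\<lambda>M. finitely_generated R M \<and> free_module R M)"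

lemma category_MOD:
  fixes R :: "'a ring" and small :: "'b set \<Rightarrow> bool"
  shows "category (MOD small R)"
proof
  fix A B :: "('a, 'b) module" and f
  assume f: "f \<in> arr (MOD small R) A B"
  show "cmp (MOD small R) A A B f (idt (MOD small R) A) = f"
    using f by (auto simp: MOD_def compose_def extensional_def restrict_def fun_eq_iff)
  show "cmp (MOD small R) A B B (idt (MOD small R) B) f = f"
    using f by (auto simp: MOD_def module_hom_def compose_def extensional_def restrict_def
        fun_eq_iff Pi_iff)
next
  fix A :: "('a, 'b) module"
  assume "A \<in> obj (MOD small R)"
  then interpret module R A by (simp add: MOD_def)
  show "idt (MOD small R) A \<in> arr (MOD small R) A A"
    by (auto simp: MOD_def module_hom_def)
next
  fix A B D :: "('a, 'b) module" and f g
  assume "A \<in> obj (MOD small R)"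
    and fg: "f \<in> arr (MOD small R) A B" "g \<in> arr (MOD small R) B D"
  then interpret module R A by (simp add: MOD_def)
  show "cmp (MOD small R) A B D g f \<in> arr (MOD small R) A D"
    using fg by (auto simp: MOD_def module_hom_def compose_def Pi_iff)
next
  fix A B D E :: "('a, 'b) module" and f g h
  assume "f \<in> arr (MOD small R) A B"
  then show "cmp (MOD small R) A D E h (cmp (MOD small R) A B D g f)
      = cmp (MOD small R) A B E (cmp (MOD small R) B D E h g) f"
    by (auto simp: MOD_def module_hom_def compose_def Pi_iff restrict_def fun_eq_iff)
qed


section \<open>Right-exactness for functors that need not be additive\<close>

text \<open>
  The direct sum is not a canonical object on the type \<open>'u\<close>; \<open>P\<close> with projections \<open>p\<close> and \<open>q\<close>
  is any model of \<open>A \<oplus> B\<close>.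
\<close>

definition is_direct_sum ::
  "'a ring \<Rightarrow> ('a, 'u) module \<Rightarrow> ('a, 'u) module \<Rightarrow> ('a, 'u) module \<Rightarrow>
   ('u \<Rightarrow> 'u) \<Rightarrow> ('u \<Rightarrow> 'u) \<Rightarrow> bool" where
  "is_direct_sum R A B P p q \<longleftrightarrow>
    p \<in> module_hom R P A \<inter> extensional (carrier P) \<and>
    q \<in> module_hom R P B \<inter> extensional (carrier P) \<and>
    bij_betw (\<lambda>x. (p x, q x)) (carrier P) (carrier A \<times> carrier B)"

text \<open>Exactness of \<open>A \<rightarrow> B \<rightarrow> C \<rightarrow> 0\<close>:\<close>

definition right_exact_seq ::
  "('a, 'u) module \<Rightarrow> ('a, 'u) module \<Rightarrow> ('a, 'u) module \<Rightarrow> ('u \<Rightarrow> 'u) \<Rightarrow> ('u \<Rightarrow> 'u) \<Rightarrow> bool" where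
  "right_exact_seq A B C \<alpha> \<beta> \<longleftrightarrow>
    \<alpha> ` carrier A = a_kernel B C \<beta> \<and> \<beta> ` carrier B = carrier C"

definition right_exact ::
  "('u set \<Rightarrow> bool) \<Rightarrow> 'a ring \<Rightarrow>
   (('a, 'u) module, 'u \<Rightarrow> 'u, ('a, 'u) module, 'u \<Rightarrow> 'u) func \<Rightarrow> bool" where
  "right_exact small R F \<longleftrightarrow>
    (\<forall>A \<in> obj (MOD small R). \<forall>B \<in> obj (MOD small R). \<forall>C \<in> obj (MOD small R).
     \<forall>\<alpha> \<in> arr (MOD small R) A B. \<forall>\<beta> \<in> arr (MOD small R) B C.
     \<forall>P \<in> obj (MOD small R). \<forall>p q.
      right_exact_seq A B C \<alpha> \<beta> \<and> is_direct_sum R A B P p q \<longrightarrow>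
      (let s = restrict (\<lambda>x. \<alpha> (p x) \<oplus>\<^bsub>B\<^esub> q x) (carrier P);
           d = restrict (\<lambda>y. farr F P B s y \<ominus>\<^bsub>fobj F B\<^esub> farr F P B q y) (carrier (fobj F P))
       in right_exact_seq (fobj F P) (fobj F B) (fobj F C) d (farr F B C \<beta>)))"


section \<open>Extensions\<close>

text \<open>
  Since \<open>FMOD\<close> is a full subcategory of \<open>MOD\<close>, the restriction of \<open>G\<close> to it is \<open>G\<close> itself,
  regarded as a functor on the smaller category.
\<close>

definition is_extension ::
  "('u set \<Rightarrow> bool) \<Rightarrow> 'a ring \<Rightarrow>
   (('a, 'u) module, 'u \<Rightarrow> 'u, ('a, 'u) module, 'u \<Rightarrow> 'u) func \<Rightarrow>
   (('a, 'u) module, 'u \<Rightarrow> 'u, ('a, 'u) module, 'u \<Rightarrow> 'u) func \<Rightarrow>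
   (('a, 'u) module \<Rightarrow> 'u \<Rightarrow> 'u) \<Rightarrow> bool" where
  "is_extension small R F G \<iota> \<longleftrightarrow>
    is_functor (MOD small R) (MOD small R) G \<and> nat_iso (FMOD small R) (MOD small R) G F \<iota>"

end

theory Submission
  imports Defs
begin

text \<open>
  The extension is the left Kan extension of \<open>F\<close> along the inclusion of the finite free modules:
  its value at \<open>M\<close> is the colimit of the modules \<open>F(R^n)\<close> over all homomorphisms \<open>v : R^n \<rightarrow> M\<close>.
  The category of these homomorphisms has binary coproducts (the coproduct of \<open>v\<close> and \<open>w\<close> is the map
  \<open>R^(n+m) \<rightarrow> M\<close> with components \<open>v\<close> and \<open>w\<close>), so the colimit is sifted, and a sifted colimit of
  modules is the colimit of the underlying sets. Its elements are classes of pairs \<open>(v, x)\<close> with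
  \<open>x\<close> in \<open>F(R^n)\<close>, and equality is generated by the single move \<open>(v \<circ> \<phi>, x) \<sim> (v, F(\<phi>)(x))\<close>.
  Two classes are added by moving both to \<open>R^(n+m)\<close> and adding there; no additive relation has to
  be imposed. Hence maps out of the colimit can be defined, and equalities in it analysed, one move
  at a time, and this is how each required property is obtained.

  On a finite free module \<open>L\<close> the value is \<open>F(L)\<close>, since \<open>(v, x)\<close> can be moved to \<open>(1, F(v)(x))\<close>
  (\<open>kan_restr_bij\<close>). For right-exactness let \<open>\<alpha> : A \<rightarrow> B\<close> and \<open>\<beta> : B \<rightarrow> C\<close> be exact. Maps \<open>R^n \<rightarrow> C\<close>
  lift to \<open>B\<close>, and two lifts \<open>v, v'\<close> of the same map differ by a map that factors through \<open>\<alpha>\<close>; thus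
  \<open>v\<close> and \<open>v'\<close> are the images of one map \<open>R^n \<rightarrow> A \<oplus> B\<close> under \<open>\<alpha> + 1\<close> and the projection. A chain of
  moves over \<open>C\<close> therefore lifts to \<open>B\<close> up to the image of the difference map
  (\<open>glued_lifts_differ\<close>). For filtered colimits, a map from \<open>R^n\<close> into the colimit factors through a
  stage, and two factorizations agree at a later stage (\<open>kan_preserves_filtered_colimits\<close>). That
  uses an elementwise description of filtered colimits (\<open>colimit_elements\<close>), which comes from
  comparing the given colimit with one that is built by the same gluing as the Kan extension.

  For uniqueness, an extension \<open>G\<close> with \<open>\<iota> : G \<cong> F\<close> on finite free modules receives a natural map from
  the Kan extension, \<open>(v, x) \<mapsto> G(v)(\<iota>\<^sup>-\<^sup>1 x)\<close>, which is bijective on finite free modules. A natural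
  transformation between two right-exact functors that commute with filtered colimits is bijective
  everywhere if it is bijective there (\<open>bij_everywhere\<close>): a free module is the filtered colimit of
  finite free direct summands, and for a presentation \<open>A \<rightarrow> B \<rightarrow> M \<rightarrow> 0\<close> with \<open>B\<close> free the exact
  sequences of values at \<open>A \<oplus> B\<close>, \<open>B\<close> and \<open>M\<close> allow the usual diagram chase. So any two extensions are
  isomorphic through the Kan extension, compatibly with their identifications with \<open>F\<close>.

  All modules have to live on small subsets of one type. Closure under images and unions together
  with \<open>\<kappa> \<cdot> \<kappa> = \<kappa>\<close> for infinite cardinals makes pairs and finite lists of elements of small sets small
  again, and the constructions above consist of such data.
\<close>

section \<open>Smallness up to bijection\<close>

context universe
begin

text \<open>
  Essential smallness is phrased by a surjection because this form is visibly inherited by images;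
  the choice of preimages turns it into an injection (\<open>ess_small_encode\<close>).
\<close>

definition ess_small :: "'t set \<Rightarrow> bool" where
  "ess_small X \<longleftrightarrow> (\<exists>(f :: 'u \<Rightarrow> 't) A. small A \<and> X \<subseteq> f ` A)"

lemma ess_smallI: "small A \<Longrightarrow> X \<subseteq> f ` A \<Longrightarrow> ess_small X"
  unfolding ess_small_def by blast

lemma ess_small_iff_small: "ess_small X \<longleftrightarrow> small X" for X :: "'u set"
proof
  assume "ess_small X"
  then obtain f A where "small A" "X \<subseteq> f ` A" unfolding ess_small_def by blast
  then show "small X" using small_subset[OF small_image] by blast
next
  assume "small X"
  then show "ess_small X" by (rule ess_smallI[where f = id]) simp
qed

lemma ess_small_subset: "ess_small X \<Longrightarrow> Y \<subseteq> X \<Longrightarrow> ess_small Y"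
  unfolding ess_small_def by blast

lemma ess_small_image:
  assumes "ess_small X" shows "ess_small (f ` X)"
proof -
  obtain g A where "small A" "X \<subseteq> g ` A" using assms unfolding ess_small_def by blast
  then show ?thesis by (intro ess_smallI[of A _ "f \<circ> g"]) auto
qed

lemma small_Un:
  assumes "small A" "small B" shows "small (A \<union> B)"
proof -
  obtain W where W: "small W" "infinite W" using small_infinite by blast
  obtain a where a: "a \<in> W" using W by fastforce
  obtain b where b: "b \<in> W" "b \<noteq> a" using W
    by (metis finite.emptyI finite_insert insertI1 rev_finite_subset singletonD subsetI)
  have "{a, b} \<subseteq> W" using a b by simp
  then have "small {a, b}" by (rule small_subset[OF W(1)])
  then have "small (\<Union>i\<in>{a, b}. if i = a then A else B)" by (rule small_UN) (simp add: assms)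
  then show ?thesis using b by (simp add: Un_commute)
qed

text \<open>
  The axioms of a universe do not mention products: both factors are covered by images of one
  infinite small set \<open>C\<close>, and \<open>C \<times> C\<close> is equipotent to \<open>C\<close>.
\<close>

lemma ess_small_Times:
  assumes "ess_small X" "ess_small Y" shows "ess_small (X \<times> Y)"
proof -
  obtain f A where A: "small A" "X \<subseteq> f ` A" using assms(1) unfolding ess_small_def by blast
  obtain g B where B: "small B" "Y \<subseteq> g ` B" using assms(2) unfolding ess_small_def by blast
  obtain W where W: "small W" "infinite W" using small_infinite by blast
  define C where "C = A \<union> B \<union> W"
  have C: "small C" "infinite C" using A(1) B(1) W by (simp_all add: C_def small_Un)
  obtain h where h: "bij_betw h C (C \<times> C)"
    using card_of_ordIso[THEN iffD2, OF ordIso_symmetric[OF card_of_Times_same_infinite[OF C(2)]]]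
    by blast
  have "X \<times> Y \<subseteq> (\<lambda>c. (f (fst (h c)), g (snd (h c)))) ` C"
  proof
    fix z assume "z \<in> X \<times> Y"
    then obtain a b where ab: "a \<in> A" "b \<in> B" "z = (f a, g b)" using A B by blast
    then have "(a, b) \<in> h ` C" using h by (auto simp: bij_betw_def C_def)
    then obtain c where "c \<in> C" "h c = (a, b)" by auto
    then show "z \<in> (\<lambda>c. (f (fst (h c)), g (snd (h c)))) ` C" using ab by force
  qed
  with C(1) show ?thesis unfolding ess_small_def by blast
qed

lemma ess_small_UN:
  assumes I: "ess_small I" and X: "\<And>i. i \<in> I \<Longrightarrow> ess_small (X i)"
  shows "ess_small (\<Union>i\<in>I. X i)"
proof -
  obtain h J where J: "small J" "I \<subseteq> h ` J" using I unfolding ess_small_def by auto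
  have "\<forall>i\<in>I. \<exists>p. small (snd p) \<and> X i \<subseteq> fst p ` snd p"
    using X unfolding ess_small_def by simp
  from bchoice[OF this] obtain p
    where p: "\<And>i. i \<in> I \<Longrightarrow> small (snd (p i)) \<and> X i \<subseteq> fst (p i) ` snd (p i)" by blast
  define f A where "f i = fst (p i)" and "A i = snd (p i)" for i
  have A: "small (A i)" "X i \<subseteq> f i ` A i" if "i \<in> I" for i
    using p[OF that] by (simp_all add: f_def A_def)
  define J' where "J' = {j \<in> J. h j \<in> I}"
  have "J' \<subseteq> J" by (auto simp: J'_def)
  then have "small J'" by (rule small_subset[OF J(1)])
  have hJ': "h ` J' = I" using J(2) by (auto simp: J'_def)
  have "small (\<Union>j\<in>J'. A (h j))" 
    using \<open>small J'\<close>
  proof (rule small_UN)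
    show "small (A (h j))" if "j \<in> J'" for j using that by (intro A) (simp add: J'_def)
  qed
  then have "ess_small (J' \<times> (\<Union>j\<in>J'. A (h j)))"
    using \<open>small J'\<close> by (intro ess_small_Times) (simp_all add: ess_small_iff_small)
  from ess_small_image[OF this, of "\<lambda>(j, a). f (h j) a"]
  show ?thesis
  proof (rule ess_small_subset, intro subsetI)
    fix y assume "y \<in> (\<Union>i\<in>I. X i)"
    then obtain j where j: "j \<in> J'" "y \<in> X (h j)" using hJ' by blast
    then obtain a where "a \<in> A (h j)" "y = f (h j) a" using A(2)[of "h j"] hJ' by blast
    with j show "y \<in> (\<lambda>(j, a). f (h j) a) ` (J' \<times> (\<Union>j\<in>J'. A (h j)))" by force
  qed
qed

lemma ess_small_nat: "ess_small (X :: nat set)"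
proof -
  obtain W where W: "small W" "infinite W" using small_infinite by blast
  obtain u :: "nat \<Rightarrow> 'u" where u: "inj u" "range u \<subseteq> W"
    using infinite_countable_subset[OF W(2)] by blast
  have "X \<subseteq> inv_into UNIV u ` W"
  proof
    fix n assume "n \<in> X"
    have "n = inv_into UNIV u (u n)" "u n \<in> W" using u by auto
    then show "n \<in> inv_into UNIV u ` W" by blast
  qed
  then show ?thesis by (rule ess_smallI[OF W(1)])
qed

lemma ess_small_lists:
  assumes "ess_small X" shows "ess_small (lists X)"
proof -
  have len: "ess_small {xs. length xs = n \<and> set xs \<subseteq> X}" for n
  proof (induction n)
    case 0
    show ?case using ess_small_image[OF ess_small_nat[of UNIV], of "\<lambda>_. [] :: 't list"]
      by (rule ess_small_subset) auto
  next
    case (Suc n)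
    from ess_small_image[OF ess_small_Times[OF assms Suc.IH], of "\<lambda>(x, xs). x # xs"]
    show ?case
    proof (rule ess_small_subset, intro subsetI)
      fix ys assume "ys \<in> {xs. length xs = Suc n \<and> set xs \<subseteq> X}"
      then obtain x xs where "ys = x # xs" "x \<in> X" "length xs = n" "set xs \<subseteq> X"
        by (auto simp: length_Suc_conv)
      then show "ys \<in> (\<lambda>(x, xs). x # xs) ` (X \<times> {xs. length xs = n \<and> set xs \<subseteq> X})" by force
    qed
  qed
  have "ess_small (\<Union>n\<in>UNIV. {xs. length xs = n \<and> set xs \<subseteq> X})"
    using ess_small_nat[of UNIV] len by (rule ess_small_UN)
  then show ?thesis by (rule ess_small_subset) (simp add: lists_eq_set subset_iff)
qed

lemma ess_small_Sigma:
  assumes "ess_small I" "\<And>i. i \<in> I \<Longrightarrow> ess_small (X i)"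
  shows "ess_small (Sigma I X)"
  using ess_small_Times[OF assms(1) ess_small_UN[OF assms]] by (rule ess_small_subset) auto

lemma ess_small_finite_subsets:
  assumes "ess_small X" shows "ess_small {S. finite S \<and> S \<subseteq> X}"
  using ess_small_image[OF ess_small_lists[OF assms], of set]
proof (rule ess_small_subset, intro subsetI)
  fix S assume S: "S \<in> {S. finite S \<and> S \<subseteq> X}"
  then obtain xs where "set xs = S" using finite_list by blast
  with S show "S \<in> set ` lists X" by auto
qed

lemma ess_small_encode:
  assumes "ess_small X"
  obtains e :: "'t \<Rightarrow> 'u" where "inj_on e X" "small (e ` X)"
proof -
  obtain f A where A: "small A" "X \<subseteq> f ` A" using assms unfolding ess_small_def by blast
  show ?thesis
  proof (rule that[of "inv_into A f"])
    show "inj_on (inv_into A f) X" using A by (meson inj_on_inv_into)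
    show "small (inv_into A f ` X)"
      by (rule small_subset[OF A(1)]) (use A in \<open>auto intro: inv_into_into\<close>)
  qed
qed

end


section \<open>Arrows of modules\<close>

lemma mem_obj_MOD: "M \<in> obj (MOD small R) \<longleftrightarrow> module R M \<and> small (carrier M)"
  by (simp add: MOD_def)

lemma mem_arr_MOD: "f \<in> arr (MOD small R) M N \<longleftrightarrow>
    f \<in> module_hom R M N \<and> f \<in> extensional (carrier M)"
  by (simp add: MOD_def)

lemma cmp_MOD: "cmp (MOD small R) A B C g f = compose (carrier A) g f"
  by (simp add: MOD_def)

lemma idt_MOD: "idt (MOD small R) A = restrict (\<lambda>x. x) (carrier A)"
  by (simp add: MOD_def)

lemma obj_FMOD: "M \<in> obj (FMOD small R) \<longleftrightarrow>
    M \<in> obj (MOD small R) \<and> finitely_generated R M \<and> free_module R M"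
  by (auto simp: FMOD_def full_subcategory_def)

lemma arr_FMOD: "arr (FMOD small R) = arr (MOD small R)"
  by (simp add: FMOD_def full_subcategory_def)

lemma idt_FMOD: "idt (FMOD small R) = idt (MOD small R)"
  by (simp add: FMOD_def full_subcategory_def)

lemma cmp_FMOD: "cmp (FMOD small R) = cmp (MOD small R)"
  by (simp add: FMOD_def full_subcategory_def)

lemma module_homI:
  assumes "\<And>x. x \<in> carrier M \<Longrightarrow> f x \<in> carrier N"
    and "\<And>x y. \<lbrakk>x \<in> carrier M; y \<in> carrier M\<rbrakk> \<Longrightarrow> f (x \<oplus>\<^bsub>M\<^esub> y) = f x \<oplus>\<^bsub>N\<^esub> f y"
    and "\<And>a x. \<lbrakk>a \<in> carrier R; x \<in> carrier M\<rbrakk> \<Longrightarrow> f (a \<odot>\<^bsub>M\<^esub> x) = a \<odot>\<^bsub>N\<^esub> f x"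
  shows "f \<in> module_hom R M N"
  using assms by (auto simp: module_hom_def)

lemma module_homD: "f \<in> module_hom R M N \<Longrightarrow> x \<in> carrier M \<Longrightarrow> f x \<in> carrier N"
  by (auto simp: module_hom_def)

lemma module_hom_compose:
  "f \<in> module_hom R M N \<Longrightarrow> g \<in> module_hom R N P \<Longrightarrow> (\<lambda>x. g (f x)) \<in> module_hom R M P"
  by (auto simp: module_hom_def Pi_iff)

lemma module_hom_zero:
  assumes "module R M" "module R N" "f \<in> module_hom R M N"
  shows "f \<zero>\<^bsub>M\<^esub> = \<zero>\<^bsub>N\<^esub>"
proof -
  interpret mod_hom R M N f using assms by (simp add: mod_hom_def mod_hom_axioms_def)
  show ?thesis by simp
qed

lemma module_hom_minus:
  assumes "module R M" "module R N" "f \<in> module_hom R M N" "x \<in> carrier M" "y \<in> carrier M"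
  shows "f (x \<ominus>\<^bsub>M\<^esub> y) = f x \<ominus>\<^bsub>N\<^esub> f y"
proof -
  interpret mod_hom R M N f using assms by (simp add: mod_hom_def mod_hom_axioms_def)
  show ?thesis using assms by simp
qed

lemma module_hom_finsum:
  assumes "module R M" "module R N" "f \<in> module_hom R M N" "g \<in> T \<rightarrow> carrier M"
  shows "f (finsum M g T) = finsum N (\<lambda>t. f (g t)) T"
proof -
  interpret mod_hom R M N f using assms by (simp add: mod_hom_def mod_hom_axioms_def)
  show ?thesis using assms(4)
  proof (induction T rule: infinite_finite_induct)
    case (insert t T)
    then show ?case by (auto simp: Pi_iff)
  qed (auto simp: finsum_infinite)
qed

lemma (in abelian_group) minus_eq_zeroD:
  assumes "x \<in> carrier G" "y \<in> carrier G" "x \<ominus> y = \<zero>" shows "x = y"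
proof -
  have "x = (x \<ominus> y) \<oplus> y" using assms(1,2) by (simp add: a_minus_def a_assoc l_neg)
  then show ?thesis using assms by simp
qed

lemma (in abelian_group) minus_zero_right:
  assumes "x \<in> carrier G" shows "x \<ominus> \<zero> = x"
proof -
  have "\<ominus> \<zero> = \<zero>" using r_neg[OF zero_closed] by simp
  then show ?thesis using assms by (simp add: a_minus_def)
qed

lemma module_hom_inj_on_iff:
  assumes "module R M" "module R N" "f \<in> module_hom R M N"
  shows "inj_on f (carrier M) \<longleftrightarrow> (\<forall>x\<in>carrier M. f x = \<zero>\<^bsub>N\<^esub> \<longrightarrow> x = \<zero>\<^bsub>M\<^esub>)"
proof -
  interpret mod_hom R M N f using assms by (simp add: mod_hom_def mod_hom_axioms_def)
  have "x = y" if "\<forall>x\<in>carrier M. f x = \<zero>\<^bsub>N\<^esub> \<longrightarrow> x = \<zero>\<^bsub>M\<^esub>" "x \<in> carrier M" "y \<in> carrier M" "f x = f y" for x y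
  proof -
    have "f (x \<ominus>\<^bsub>M\<^esub> y) = \<zero>\<^bsub>N\<^esub>" using that by simp
    then have "x \<ominus>\<^bsub>M\<^esub> y = \<zero>\<^bsub>M\<^esub>" using that by blast
    then show "x = y" 
      by (rule M.M.minus_eq_zeroD[OF that(2,3)])
  qed
  then show ?thesis by (metis M.M.zero_closed f0_is_0 inj_on_def)
qed

lemma restrict_arr:
  assumes "module R M" "f \<in> module_hom R M N"
  shows "restrict f (carrier M) \<in> arr (MOD small R) M N"
proof -
  interpret module R M by fact
  show ?thesis using assms(2) by (auto simp: mem_arr_MOD module_hom_def)
qed

lemma module_hom_inv:
  assumes "module R M" "module R N" "f \<in> module_hom R M N" "bij_betw f (carrier M) (carrier N)"
  shows "inv_into (carrier M) f \<in> module_hom R N M"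
proof -
  interpret M: module R M by fact
  interpret N: module R N by fact
  let ?g = "inv_into (carrier M) f"
  have g: "?g y \<in> carrier M" "f (?g y) = y" if "y \<in> carrier N" for y
    using that assms(4) by (auto simp: bij_betw_def intro: inv_into_into f_inv_into_f)
  have gf: "?g (f x) = x" if "x \<in> carrier M" for x
    using that assms(4) by (simp add: bij_betw_def)
  show ?thesis
  proof (rule module_homI)
    fix x y assume "x \<in> carrier N" "y \<in> carrier N"
    then show "?g (x \<oplus>\<^bsub>N\<^esub> y) = ?g x \<oplus>\<^bsub>M\<^esub> ?g y"
      using gf[of "?g x \<oplus>\<^bsub>M\<^esub> ?g y"] g module_hom_add[OF assms(3)] by auto
  next
    fix a x assume "a \<in> carrier R" "x \<in> carrier N"
    then show "?g (a \<odot>\<^bsub>N\<^esub> x) = a \<odot>\<^bsub>M\<^esub> ?g x"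
      using gf[of "a \<odot>\<^bsub>M\<^esub> ?g x"] g module_hom_smult[OF assms(3)] by auto
  qed (use g in auto)
qed

lemma is_iso_MOD_iff:
  assumes "M \<in> obj (MOD small R)" "N \<in> obj (MOD small R)"
  shows "is_iso (MOD small R) M N f \<longleftrightarrow>
    f \<in> arr (MOD small R) M N \<and> bij_betw f (carrier M) (carrier N)"
proof
  assume *: "is_iso (MOD small R) M N f"
  then obtain g where g: "f \<in> arr (MOD small R) M N" "g \<in> arr (MOD small R) N M"
    "compose (carrier M) g f = restrict (\<lambda>x. x) (carrier M)"
    "compose (carrier N) f g = restrict (\<lambda>x. x) (carrier N)"
    unfolding is_iso_def cmp_MOD idt_MOD by blast
  then have "g (f x) = x" if "x \<in> carrier M" for x
    using that by (metis compose_eq restrict_apply')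
  moreover have "f (g x) = x" if "x \<in> carrier N" for x
    using that g by (metis compose_eq restrict_apply')
  ultimately have "bij_betw f (carrier M) (carrier N)"
    using g module_homD by (intro bij_betwI[where g = g]) (auto simp: mem_arr_MOD)
  with g show "f \<in> arr (MOD small R) M N \<and> bij_betw f (carrier M) (carrier N)" by simp
next
  assume f: "f \<in> arr (MOD small R) M N \<and> bij_betw f (carrier M) (carrier N)"
  let ?g = "restrict (inv_into (carrier M) f) (carrier N)"
  have "?g \<in> arr (MOD small R) N M"
    using assms f by (intro restrict_arr module_hom_inv) (auto simp: mem_obj_MOD mem_arr_MOD)
  moreover have "compose (carrier M) ?g f = restrict (\<lambda>x. x) (carrier M)"
    using f module_homD by (fastforce simp: compose_def fun_eq_iff bij_betw_def mem_arr_MOD)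
  moreover have "compose (carrier N) f ?g = restrict (\<lambda>x. x) (carrier N)"
    using f by (fastforce simp: compose_def fun_eq_iff bij_betw_def f_inv_into_f)
  ultimately show "is_iso (MOD small R) M N f" using f unfolding is_iso_def cmp_MOD idt_MOD by blast
qed

section \<open>Modules inside the universe\<close>

locale module_universe = universe small + R: cring R
  for small :: "'u set \<Rightarrow> bool" and R :: "'a ring" +
  assumes small_scalars: "\<exists>e :: 'a \<Rightarrow> 'u. inj_on e (carrier R) \<and> small (e ` carrier R)"
begin

abbreviation Mods :: "(('a, 'u) module, 'u \<Rightarrow> 'u) category" where "Mods \<equiv> MOD small R"

abbreviation Fmods :: "(('a, 'u) module, 'u \<Rightarrow> 'u) category" where "Fmods \<equiv> FMOD small R"

lemma ess_small_scalars: "ess_small (carrier R)"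
proof -
  obtain e :: "'a \<Rightarrow> 'u" where e: "inj_on e (carrier R)" "small (e ` carrier R)"
    using small_scalars by blast
  then have "carrier R \<subseteq> inv_into (carrier R) e ` e ` carrier R" by (simp add: inv_into_image_cancel)
  with e(2) show ?thesis by (rule ess_smallI)
qed

text \<open>
  Constructions such as products and modules of functions live on other types; renaming their
  elements yields objects of the category.
\<close>

lemma transport_module:
  fixes N :: "('a, 't) module"
  assumes N: "module R N" and small: "ess_small (carrier N)"
  obtains M e where "M \<in> obj Mods" "e \<in> module_hom R N M" "bij_betw e (carrier N) (carrier M)"
proof -
  interpret N: module R N by fact
  obtain e :: "'t \<Rightarrow> 'u" where e: "inj_on e (carrier N)" "small (e ` carrier N)"
    using small by (rule ess_small_encode)
  define d where "d = inv_into (carrier N) e"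
  have d: "d (e x) = x" if "x \<in> carrier N" for x using e that by (simp add: d_def)
  define M :: "('a, 'u) module" where
    "M = \<lparr>carrier = e ` carrier N, mult = (\<lambda>_ _. undefined), one = undefined,
          zero = e \<zero>\<^bsub>N\<^esub>, add = (\<lambda>x y. e (d x \<oplus>\<^bsub>N\<^esub> d y)), smult = (\<lambda>a x. e (a \<odot>\<^bsub>N\<^esub> d x))\<rparr>"
  have "module R M"
  proof (rule module_criteria)
    show "\<forall>v\<in>carrier M. \<exists>w\<in>carrier M. v \<oplus>\<^bsub>M\<^esub> w = \<zero>\<^bsub>M\<^esub>"
    proof
      fix v assume "v \<in> carrier M"
      then obtain x where "x \<in> carrier N" "v = e x" by (auto simp: M_def)
      then show "\<exists>w\<in>carrier M. v \<oplus>\<^bsub>M\<^esub> w = \<zero>\<^bsub>M\<^esub>"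
        by (intro bexI[of _ "e (\<ominus>\<^bsub>N\<^esub> x)"]) (auto simp: M_def d N.r_neg)
    qed
  qed (auto simp: M_def d R.is_cring N.a_ac N.smult_assoc1 N.smult_l_distr N.smult_r_distr)
  then have "M \<in> obj Mods" using e by (simp add: mem_obj_MOD M_def)
  moreover have "e \<in> module_hom R N M" by (rule module_homI) (auto simp: M_def d)
  moreover have "bij_betw e (carrier N) (carrier M)" using e by (simp add: bij_betw_def M_def)
  ultimately show ?thesis by (rule that)
qed

lemma direct_sum_exists:
  assumes A: "A \<in> obj Mods" and B: "B \<in> obj Mods"
  obtains P p q where "P \<in> obj Mods" "is_direct_sum R A B P p q"
proof -
  let ?N = "direct_sum A B"
  have mods: "module R A" "module R B" using A B by (auto simp: mem_obj_MOD)
  have N: "module R ?N" using mods by (rule direct_sum_is_module)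
  have "ess_small (carrier ?N)"
    using A B by (auto simp: direct_sum_def mem_obj_MOD ess_small_iff_small intro!: ess_small_Times)
  with N obtain P e where P: "P \<in> obj Mods" "e \<in> module_hom R ?N P"
    and e: "bij_betw e (carrier ?N) (carrier P)" by (rule transport_module)
  have P': "module R P" using P by (simp add: mem_obj_MOD)
  let ?d = "inv_into (carrier ?N) e"
  have d: "?d \<in> module_hom R P ?N" using N P' P(2) e by (rule module_hom_inv)
  have "(\<lambda>z. fst (?d z)) \<in> module_hom R P A"
    by (rule module_hom_compose[OF d], rule module_homI) (auto simp: direct_sum_def)
  moreover have "(\<lambda>z. snd (?d z)) \<in> module_hom R P B"
    by (rule module_hom_compose[OF d], rule module_homI) (auto simp: direct_sum_def)
  ultimately have pq: "restrict (\<lambda>z. fst (?d z)) (carrier P) \<in> arr Mods P A"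
      "restrict (\<lambda>z. snd (?d z)) (carrier P) \<in> arr Mods P B"
    using P' by (auto intro: restrict_arr)
  have "bij_betw (\<lambda>x. (restrict (\<lambda>z. fst (?d z)) (carrier P) x, restrict (\<lambda>z. snd (?d z)) (carrier P) x))
      (carrier P) (carrier A \<times> carrier B)"
    using bij_betw_inv_into[OF e]
    by (subst bij_betw_cong[where g = ?d]) (auto simp: direct_sum_def)
  with pq have "is_direct_sum R A B P (restrict (\<lambda>z. fst (?d z)) (carrier P)) (restrict (\<lambda>z. snd (?d z)) (carrier P))"
    unfolding is_direct_sum_def by (simp add: mem_arr_MOD)
  with P(1) show ?thesis by (rule that)
qed

end

section \<open>Free modules\<close>

context module_universe
begin

text \<open>
  Freeness is expressed by the universal property, which is the only form in which it is used later.
  The family \<open>e\<close> need not be injective: over the zero ring it cannot be on a set with two elements.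
\<close>

definition free_on :: "'x set \<Rightarrow> ('a, 'u) module \<Rightarrow> ('x \<Rightarrow> 'u) \<Rightarrow> bool" where
  "free_on X B e \<longleftrightarrow> B \<in> obj Mods \<and> e \<in> X \<rightarrow> carrier B \<and>
    (\<forall>M \<in> obj Mods. \<forall>g \<in> X \<rightarrow> carrier M. \<exists>!h. h \<in> arr Mods B M \<and> (\<forall>x\<in>X. h (e x) = g x))"

definition free_ext ::
  "'x set \<Rightarrow> ('a, 'u) module \<Rightarrow> ('x \<Rightarrow> 'u) \<Rightarrow> ('a, 'u) module \<Rightarrow> ('x \<Rightarrow> 'u) \<Rightarrow> 'u \<Rightarrow> 'u" where
  "free_ext X B e M g = (THE h. h \<in> arr Mods B M \<and> (\<forall>x\<in>X. h (e x) = g x))"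

lemma free_on_obj: "free_on X B e \<Longrightarrow> B \<in> obj Mods"
  by (simp add: free_on_def)

lemma free_on_mem: "free_on X B e \<Longrightarrow> x \<in> X \<Longrightarrow> e x \<in> carrier B"
  by (auto simp: free_on_def)

lemma free_ext:
  assumes "free_on X B e" "M \<in> obj Mods" "\<And>x. x \<in> X \<Longrightarrow> g x \<in> carrier M"
  shows free_ext_arr: "free_ext X B e M g \<in> arr Mods B M"
    and free_ext_eq: "x \<in> X \<Longrightarrow> free_ext X B e M g (e x) = g x"
proof -
  have "\<exists>!h. h \<in> arr Mods B M \<and> (\<forall>x\<in>X. h (e x) = g x)" using assms by (auto simp: free_on_def)
  from theI'[OF this] show "free_ext X B e M g \<in> arr Mods B M"
    "x \<in> X \<Longrightarrow> free_ext X B e M g (e x) = g x"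
    by (auto simp: free_ext_def)
qed

lemma free_on_arr_eqI:
  assumes "free_on X B e" "M \<in> obj Mods" "f \<in> arr Mods B M" "g \<in> arr Mods B M"
    and "\<And>x. x \<in> X \<Longrightarrow> f (e x) = g (e x)"
  shows "f = g"
proof -
  have "(\<lambda>x. g (e x)) \<in> X \<rightarrow> carrier M"
    using assms by (auto simp: mem_arr_MOD intro: module_homD free_on_mem)
  then have "\<exists>!h. h \<in> arr Mods B M \<and> (\<forall>x\<in>X. h (e x) = g (e x))"
    using assms(1,2) by (auto simp: free_on_def)
  then show ?thesis using assms by blast
qed

text \<open>
  Finitely supported functions and modules with a finite basis are both recognized as free by their
  coordinate functions \<open>c\<close>: the extension of \<open>g\<close> has to be \<open>y \<mapsto> \<Sum>x. c y x \<odot> g x\<close>, and additivity is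
  checked by summing over a finite set that contains all supports involved.
\<close>

lemma free_onI_coordinates:
  assumes M: "M \<in> obj Mods" and e: "e \<in> X \<rightarrow> carrier M"
    and c_mem: "\<And>y x. y \<in> carrier M \<Longrightarrow> x \<in> X \<Longrightarrow> c y x \<in> carrier R"
    and fin: "\<And>y. y \<in> carrier M \<Longrightarrow> finite {x \<in> X. c y x \<noteq> \<zero>\<^bsub>R\<^esub>}"
    and c_add: "\<And>y z x. \<lbrakk>y \<in> carrier M; z \<in> carrier M; x \<in> X\<rbrakk> \<Longrightarrow> c (y \<oplus>\<^bsub>M\<^esub> z) x = c y x \<oplus>\<^bsub>R\<^esub> c z x"
    and c_smult: "\<And>a y x. \<lbrakk>a \<in> carrier R; y \<in> carrier M; x \<in> X\<rbrakk> \<Longrightarrow> c (a \<odot>\<^bsub>M\<^esub> y) x = a \<otimes>\<^bsub>R\<^esub> c y x"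
    and c_basis: "\<And>z x. \<lbrakk>z \<in> X; x \<in> X\<rbrakk> \<Longrightarrow> c (e z) x = (if x = z then \<one>\<^bsub>R\<^esub> else \<zero>\<^bsub>R\<^esub>)"
    and expand: "\<And>y. y \<in> carrier M \<Longrightarrow>
        y = finsum M (\<lambda>x. c y x \<odot>\<^bsub>M\<^esub> e x) {x \<in> X. c y x \<noteq> \<zero>\<^bsub>R\<^esub>}"
  shows "free_on X M e"
proof -
  have modM: "module R M" using M by (simp add: mem_obj_MOD)
  interpret M: module R M by (fact modM)
  define supp where "supp y = {x \<in> X. c y x \<noteq> \<zero>\<^bsub>R\<^esub>}" for y
  have "\<exists>!h. h \<in> arr Mods M N \<and> (\<forall>x\<in>X. h (e x) = g x)"
    if N: "N \<in> obj Mods" and g: "g \<in> X \<rightarrow> carrier N" for N :: "('a, 'u) module" and g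
  proof -
    have modN: "module R N" using N by (simp add: mem_obj_MOD)
    interpret N: module R N by (fact modN)
    define h where "h y = finsum N (\<lambda>x. c y x \<odot>\<^bsub>N\<^esub> g x) (supp y)" for y
    have h: "h y = finsum N (\<lambda>x. c y x \<odot>\<^bsub>N\<^esub> g x) T"
      if "y \<in> carrier M" "finite T" "supp y \<subseteq> T" "T \<subseteq> X" for y T
      unfolding h_def using that g c_mem
      by (intro N.add.finprod_mono_neutral_cong_left) (auto simp: supp_def Pi_iff subset_iff)
    have "h \<in> module_hom R M N"
    proof (rule module_homI)
      fix y assume "y \<in> carrier M"
      then show "h y \<in> carrier N" unfolding h_def using c_mem g
        by (intro N.finsum_closed) (auto simp: supp_def Pi_iff)
    next
      fix y z assume y: "y \<in> carrier M" and z: "z \<in> carrier M"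
      let ?T = "supp y \<union> supp z \<union> supp (y \<oplus>\<^bsub>M\<^esub> z)"
      have T: "finite ?T" "?T \<subseteq> X" using fin y z by (auto simp: supp_def)
      have "h (y \<oplus>\<^bsub>M\<^esub> z) = finsum N (\<lambda>x. c (y \<oplus>\<^bsub>M\<^esub> z) x \<odot>\<^bsub>N\<^esub> g x) ?T"
        using T y z by (intro h) auto
      also have "\<dots> = finsum N (\<lambda>x. c y x \<odot>\<^bsub>N\<^esub> g x \<oplus>\<^bsub>N\<^esub> c z x \<odot>\<^bsub>N\<^esub> g x) ?T"
        using T y z c_mem g
        by (intro N.finsum_cong') (auto simp: c_add N.smult_l_distr Pi_iff subset_iff)
      also have "\<dots> = finsum N (\<lambda>x. c y x \<odot>\<^bsub>N\<^esub> g x) ?T \<oplus>\<^bsub>N\<^esub> finsum N (\<lambda>x. c z x \<odot>\<^bsub>N\<^esub> g x) ?T"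
        using T y z c_mem g by (intro N.finsum_addf) (auto simp: Pi_iff subset_iff)
      also have "finsum N (\<lambda>x. c y x \<odot>\<^bsub>N\<^esub> g x) ?T = h y"
        by (rule h[OF y T(1) _ T(2), symmetric]) blast
      also have "finsum N (\<lambda>x. c z x \<odot>\<^bsub>N\<^esub> g x) ?T = h z"
        by (rule h[OF z T(1) _ T(2), symmetric]) blast
      finally show "h (y \<oplus>\<^bsub>M\<^esub> z) = h y \<oplus>\<^bsub>N\<^esub> h z" .
    next
      fix a y assume a: "a \<in> carrier R" and y: "y \<in> carrier M"
      let ?T = "supp y \<union> supp (a \<odot>\<^bsub>M\<^esub> y)"
      have T: "finite ?T" "?T \<subseteq> X" using fin y a by (auto simp: supp_def)
      have "h (a \<odot>\<^bsub>M\<^esub> y) = finsum N (\<lambda>x. c (a \<odot>\<^bsub>M\<^esub> y) x \<odot>\<^bsub>N\<^esub> g x) ?T"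
        using T y a by (intro h) auto
      also have "\<dots> = finsum N (\<lambda>x. a \<odot>\<^bsub>N\<^esub> (c y x \<odot>\<^bsub>N\<^esub> g x)) ?T"
        using T y a c_mem g
        by (intro N.finsum_cong') (auto simp: c_smult N.smult_assoc1 Pi_iff subset_iff)
      also have "\<dots> = a \<odot>\<^bsub>N\<^esub> finsum N (\<lambda>x. c y x \<odot>\<^bsub>N\<^esub> g x) ?T"
        using T y a c_mem g by (intro N.finsum_smult[symmetric]) (auto simp: Pi_iff subset_iff)
      also have "finsum N (\<lambda>x. c y x \<odot>\<^bsub>N\<^esub> g x) ?T = h y"
        by (rule h[OF y T(1) _ T(2), symmetric]) blast
      finally show "h (a \<odot>\<^bsub>M\<^esub> y) = a \<odot>\<^bsub>N\<^esub> h y" .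
    qed
    moreover have "h (e z) = g z" if z: "z \<in> X" for z
    proof -
      have "h (e z) = finsum N (\<lambda>x. c (e z) x \<odot>\<^bsub>N\<^esub> g x) {z}"
        using z e c_basis by (intro h) (auto simp: supp_def split: if_splits)
      then show ?thesis using z g c_basis[OF z z] by (auto simp: Pi_iff)
    qed
    ultimately have "restrict h (carrier M) \<in> arr Mods M N"
        "\<forall>x\<in>X. restrict h (carrier M) (e x) = g x"
      using e by (auto intro: restrict_arr modM)
    moreover have "f = f'"
      if f: "f \<in> arr Mods M N" "\<forall>x\<in>X. f (e x) = g x"
        and f': "f' \<in> arr Mods M N" "\<forall>x\<in>X. f' (e x) = g x" for f f'
    proof (rule extensionalityI[where A = "carrier M"])
      have formula: "k y = finsum N (\<lambda>x. c y x \<odot>\<^bsub>N\<^esub> g x) (supp y)"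
        if k: "k \<in> arr Mods M N" "\<forall>x\<in>X. k (e x) = g x" and y: "y \<in> carrier M" for k y
      proof -
        have k': "k \<in> module_hom R M N" using k by (simp add: mem_arr_MOD)
        have "k y = k (finsum M (\<lambda>x. c y x \<odot>\<^bsub>M\<^esub> e x) (supp y))"
          using expand[OF y] by (simp add: supp_def)
        also have "\<dots> = finsum N (\<lambda>x. k (c y x \<odot>\<^bsub>M\<^esub> e x)) (supp y)"
          using e c_mem y by (intro module_hom_finsum[OF modM modN k']) (auto simp: supp_def Pi_iff)
        also have "\<dots> = finsum N (\<lambda>x. c y x \<odot>\<^bsub>N\<^esub> g x) (supp y)"
          using k' k(2) e c_mem y g
          by (intro N.finsum_cong') (auto simp: supp_def Pi_iff module_hom_smult)
        finally show ?thesis .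
      qed
      show "f y = f' y" if "y \<in> carrier M" for y
        using formula[OF f that] formula[OF f' that] by simp
    qed (use f f' in \<open>simp_all add: mem_arr_MOD\<close>)
    ultimately show ?thesis by blast
  qed
  then show ?thesis using M e by (auto simp: free_on_def)
qed

text \<open>
  The model is the module of finitely supported functions. It is essentially small because such a
  function is given by the finite list of its nonzero values.
\<close>

lemma free_on_exists:
  fixes X :: "'x set"
  assumes "ess_small X"
  obtains B e where "free_on X B e"
proof -
  define supp where "supp f = {x. f x \<noteq> \<zero>\<^bsub>R\<^esub>}" for f :: "'x \<Rightarrow> 'a"
  define N :: "('a, 'x \<Rightarrow> 'a) module" where
    "N = \<lparr>carrier = {f. f \<in> UNIV \<rightarrow> carrier R \<and> supp f \<subseteq> X \<and> finite (supp f)},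
          mult = (\<lambda>_ _. undefined), one = undefined,
          zero = (\<lambda>_. \<zero>\<^bsub>R\<^esub>), add = (\<lambda>f g x. f x \<oplus>\<^bsub>R\<^esub> g x), smult = (\<lambda>a f x. a \<otimes>\<^bsub>R\<^esub> f x)\<rparr>"
  have supp_add: "supp (\<lambda>x. f x \<oplus>\<^bsub>R\<^esub> g x) \<subseteq> supp f \<union> supp g" for f g by (auto simp: supp_def)
  have supp_neg: "supp (\<lambda>x. \<ominus>\<^bsub>R\<^esub> f x) \<subseteq> supp f" for f by (auto simp: supp_def)
  have supp_smult: "supp (\<lambda>x. a \<otimes>\<^bsub>R\<^esub> f x) \<subseteq> supp f" if "a \<in> carrier R" for f a
    using that by (auto simp: supp_def)
  have module_N: "module R N"
  proof (rule module_criteria)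
    show "\<zero>\<^bsub>N\<^esub> \<in> carrier N" by (auto simp: N_def supp_def)
    show "\<forall>v w. v \<in> carrier N \<and> w \<in> carrier N \<longrightarrow> v \<oplus>\<^bsub>N\<^esub> w \<in> carrier N"
      using supp_add by (auto simp: N_def Pi_iff intro: finite_subset) blast
    show "\<forall>v\<in>carrier N. \<exists>w\<in>carrier N. v \<oplus>\<^bsub>N\<^esub> w = \<zero>\<^bsub>N\<^esub>"
    proof
      fix v assume "v \<in> carrier N"
      then show "\<exists>w\<in>carrier N. v \<oplus>\<^bsub>N\<^esub> w = \<zero>\<^bsub>N\<^esub>"
        using supp_neg[of v]
        by (intro bexI[of _ "\<lambda>x. \<ominus>\<^bsub>R\<^esub> v x"]) (auto simp: N_def R.r_neg Pi_iff intro: finite_subset)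
    qed
    show "\<forall>c v. c \<in> carrier R \<and> v \<in> carrier N \<longrightarrow> c \<odot>\<^bsub>N\<^esub> v \<in> carrier N"
      using supp_smult by (auto simp: N_def Pi_iff intro: finite_subset) blast
  qed (auto simp: N_def Pi_iff fun_eq_iff R.is_cring R.a_ac R.m_assoc R.l_distr R.r_distr)
  have "ess_small (carrier N)"
  proof -
    let ?L = "lists (X \<times> carrier R)"
    define F where "F l x = (case map_of l x of None \<Rightarrow> \<zero>\<^bsub>R\<^esub> | Some a \<Rightarrow> a)" for l and x :: 'x
    have "carrier N \<subseteq> F ` ?L"
    proof
      fix f assume f: "f \<in> carrier N"
      then have "finite (supp f)" by (simp add: N_def)
      then obtain l where l: "set l = supp f" using finite_list by blast
      have "f = F (map (\<lambda>x. (x, f x)) l)"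
      proof
        fix x show "f x = F (map (\<lambda>x. (x, f x)) l) x"
          using l map_of_map_restrict[of f l] by (auto simp: F_def restrict_map_def supp_def)
      qed
      moreover have "map (\<lambda>x. (x, f x)) l \<in> ?L" using f l by (auto simp: N_def Pi_iff)
      ultimately show "f \<in> F ` ?L" by blast
    qed
    moreover have "ess_small ?L"
      using assms ess_small_scalars by (intro ess_small_lists ess_small_Times)
    ultimately show ?thesis using ess_small_image ess_small_subset by blast
  qed
  with module_N obtain M \<phi> where M: "M \<in> obj Mods" and \<phi>: "\<phi> \<in> module_hom R N M"
    and bij: "bij_betw \<phi> (carrier N) (carrier M)" by (rule transport_module)
  interpret N: module R N by fact
  have modM: "module R M" using M by (simp add: mem_obj_MOD)
  interpret M: module R M by (fact modM)
  define \<delta> where "\<delta> z x = (if x = z then \<one>\<^bsub>R\<^esub> else \<zero>\<^bsub>R\<^esub>)" for z x :: 'x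
  have \<delta>: "\<delta> z \<in> carrier N" if "z \<in> X" for z
    using that by (auto simp: N_def \<delta>_def supp_def intro: finite_subset[of _ "{z}"] split: if_splits)
  define c where "c = inv_into (carrier N) \<phi>"
  have c_hom: "c \<in> module_hom R M N"
    unfolding c_def using module_N modM \<phi> bij by (rule module_hom_inv)
  have c: "c y \<in> carrier N" if "y \<in> carrier M" for y using c_hom that by (rule module_homD)
  have \<phi>c: "\<phi> (c y) = y" if "y \<in> carrier M" for y
    using that bij by (auto simp: c_def bij_betw_def f_inv_into_f)
  have c\<phi>: "c (\<phi> f) = f" if "f \<in> carrier N" for f
    using that bij by (simp add: c_def bij_betw_def)
  have supp_c: "{x \<in> X. c y x \<noteq> \<zero>\<^bsub>R\<^esub>} = supp (c y)" if "y \<in> carrier M" for y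
    using c[OF that] by (auto simp: N_def supp_def)
  have sum_eval: "finsum N (\<lambda>x. f x \<odot>\<^bsub>N\<^esub> \<delta> x) T = (\<lambda>z. if z \<in> T then f z else \<zero>\<^bsub>R\<^esub>)"
    if "finite T" "T \<subseteq> X" "f \<in> carrier N" for f T
    using that
  proof (induction T rule: finite_induct)
    case empty
    have "\<zero>\<^bsub>N\<^esub> = (\<lambda>_. \<zero>\<^bsub>R\<^esub>)" by (simp add: N_def)
    then show ?case by simp
  next
    case (insert t T)
    have fR: "f x \<in> carrier R" for x using insert.prems by (auto simp: N_def)
    have "(\<lambda>x. f x \<odot>\<^bsub>N\<^esub> \<delta> x) \<in> T \<rightarrow> carrier N" "f t \<odot>\<^bsub>N\<^esub> \<delta> t \<in> carrier N"
      using insert.prems fR \<delta> by auto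
    then have "finsum N (\<lambda>x. f x \<odot>\<^bsub>N\<^esub> \<delta> x) (insert t T)
        = f t \<odot>\<^bsub>N\<^esub> \<delta> t \<oplus>\<^bsub>N\<^esub> (\<lambda>z. if z \<in> T then f z else \<zero>\<^bsub>R\<^esub>)"
      using insert by simp
    then show ?case using insert by (auto simp: N_def \<delta>_def fun_eq_iff Pi_iff)
  qed
  have "free_on X M (\<lambda>x. \<phi> (\<delta> x))"
  proof (rule free_onI_coordinates[where c = c])
    show "(\<lambda>x. \<phi> (\<delta> x)) \<in> X \<rightarrow> carrier M" using \<delta> by (auto intro: module_homD[OF \<phi>])
    show "c y x \<in> carrier R" if "y \<in> carrier M" "x \<in> X" for y x
      using c[OF that(1)] by (auto simp: N_def)
    show "finite {x \<in> X. c y x \<noteq> \<zero>\<^bsub>R\<^esub>}" if "y \<in> carrier M" for y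
      using c[OF that] supp_c[OF that] by (simp add: N_def)
    show "c (y \<oplus>\<^bsub>M\<^esub> z) x = c y x \<oplus>\<^bsub>R\<^esub> c z x" if "y \<in> carrier M" "z \<in> carrier M" for y z x
      using module_hom_add[OF c_hom that] by (simp add: N_def)
    show "c (a \<odot>\<^bsub>M\<^esub> y) x = a \<otimes>\<^bsub>R\<^esub> c y x" if "a \<in> carrier R" "y \<in> carrier M" for a y x
      using module_hom_smult[OF c_hom that] by (simp add: N_def)
    show "c (\<phi> (\<delta> z)) x = (if x = z then \<one>\<^bsub>R\<^esub> else \<zero>\<^bsub>R\<^esub>)" if "z \<in> X" for z x
      using c\<phi>[OF \<delta>[OF that]] by (simp add: \<delta>_def)
    show "y = finsum M (\<lambda>x. c y x \<odot>\<^bsub>M\<^esub> \<phi> (\<delta> x)) {x \<in> X. c y x \<noteq> \<zero>\<^bsub>R\<^esub>}" if y: "y \<in> carrier M" for y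
    proof -
      let ?T = "supp (c y)"
      have T: "finite ?T" "?T \<subseteq> X" and cR: "\<And>x. c y x \<in> carrier R"
        using c[OF y] by (auto simp: N_def)
      have "c y = finsum N (\<lambda>x. c y x \<odot>\<^bsub>N\<^esub> \<delta> x) ?T"
        using sum_eval[OF T c[OF y]] by (auto simp: supp_def fun_eq_iff)
      then have "y = \<phi> (finsum N (\<lambda>x. c y x \<odot>\<^bsub>N\<^esub> \<delta> x) ?T)" using \<phi>c[OF y] by simp
      also have "\<dots> = finsum M (\<lambda>x. \<phi> (c y x \<odot>\<^bsub>N\<^esub> \<delta> x)) ?T"
        using module_N modM \<phi> by (rule module_hom_finsum) (use T cR \<delta> in auto)
      also have "\<dots> = finsum M (\<lambda>x. c y x \<odot>\<^bsub>M\<^esub> \<phi> (\<delta> x)) ?T"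
        using T cR \<delta> module_homD[OF \<phi>]
        by (intro M.finsum_cong') (auto simp: module_hom_smult[OF \<phi>] subset_iff)
      finally show ?thesis by (simp add: supp_c[OF y])
    qed
  qed (fact M)
  then show ?thesis by (rule that)
qed

definition free_pair :: "'x set \<Rightarrow> ('a, 'u) module \<times> ('x \<Rightarrow> 'u)" where
  "free_pair X = (SOME p. free_on X (fst p) (snd p))"

definition free_obj :: "'x set \<Rightarrow> ('a, 'u) module" where "free_obj X = fst (free_pair X)"

definition free_gen :: "'x set \<Rightarrow> 'x \<Rightarrow> 'u" where "free_gen X = snd (free_pair X)"

lemma free_on_free_obj:
  assumes "ess_small X" shows "free_on X (free_obj X) (free_gen X)"
proof -
  obtain B e where "free_on X B e" using assms by (rule free_on_exists)
  then have "free_on X (fst (B, e)) (snd (B, e))" by simp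
  then show ?thesis unfolding free_obj_def free_gen_def free_pair_def by (rule someI)
qed

text \<open>
  By the universal property \<open>e\<close> extends to a homomorphism into its span. Followed by the inclusion
  this is an endomorphism that fixes the generators, hence the identity.
\<close>

lemma free_on_span:
  assumes B: "free_on X B e"
  shows "module.span R B (e ` X) = carrier B"
proof -
  have modB: "module R B" using free_on_obj[OF B] by (simp add: mem_obj_MOD)
  interpret B: module R B by (fact modB)
  let ?S = "B.span (e ` X)"
  have eX: "e ` X \<subseteq> carrier B" using free_on_mem[OF B] by auto
  have sub: "?S \<subseteq> carrier B" using eX by (rule B.span_is_subset2)
  let ?B' = "B\<lparr>carrier := ?S\<rparr>"
  have B': "?B' \<in> obj Mods"
    using B.submodule_is_module[OF B.span_is_submodule[OF eX]] small_subset[OF _ sub]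
      free_on_obj[OF B] by (simp add: mem_obj_MOD)
  have e: "e x \<in> carrier ?B'" if "x \<in> X" for x using that B.in_own_span[OF eX] by auto
  let ?h = "free_ext X B e ?B' e"
  have h: "?h \<in> arr Mods B ?B'" using B B' e by (rule free_ext_arr)
  then have "?h \<in> arr Mods B B" using sub by (auto simp: mem_arr_MOD module_hom_def)
  moreover have "idt Mods B \<in> arr Mods B B"
    using category.idt_arr[OF category_MOD] free_on_obj[OF B] .
  ultimately have "?h = idt Mods B"
    using B B' e by (intro free_on_arr_eqI[OF B])
      (auto simp: free_on_obj free_ext_eq idt_MOD free_on_mem)
  then have "y \<in> ?S" if "y \<in> carrier B" for y
    using h that module_homD[of ?h R B ?B' y] by (simp add: mem_arr_MOD idt_MOD)
  with sub show ?thesis by blast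
qed

text \<open>
  Linear independence follows by applying to a relation the functional that is \<open>1\<close> on a given basis
  element \<open>v\<close> and \<open>0\<close> on the others. It is defined by testing \<open>e x = v\<close> and so makes sense for a
  family \<open>e\<close> with repetitions.
\<close>

lemma free_on_Fmod:
  assumes B: "free_on X B e" and X: "finite X"
  shows "B \<in> obj Fmods"
proof -
  have modB: "module R B" using free_on_obj[OF B] by (simp add: mem_obj_MOD)
  interpret B: module R B by (fact modB)
  have eX: "e ` X \<subseteq> carrier B" using free_on_mem[OF B] by auto
  let ?N = "\<lparr>carrier = carrier R, mult = (\<lambda>_ _. undefined), one = undefined,
          zero = \<zero>\<^bsub>R\<^esub>, add = (\<oplus>\<^bsub>R\<^esub>), smult = (\<otimes>\<^bsub>R\<^esub>)\<rparr> :: ('a, 'a) module"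
  have neg: "\<exists>b\<in>carrier R. a \<oplus>\<^bsub>R\<^esub> b = \<zero>\<^bsub>R\<^esub>" if "a \<in> carrier R" for a
    using R.r_neg[OF that] R.a_inv_closed[OF that] by blast
  have N: "module R ?N"
    by (rule module_criteria)
      (auto simp: R.is_cring R.a_ac R.m_assoc R.l_distr R.r_distr neg)
  moreover have "ess_small (carrier ?N)" using ess_small_scalars by simp
  ultimately obtain M \<phi> where M: "M \<in> obj Mods" and \<phi>: "\<phi> \<in> module_hom R ?N M"
    and bij: "bij_betw \<phi> (carrier ?N) (carrier M)" by (rule transport_module)
  have M': "module R M" using M by (simp add: mem_obj_MOD)
  have "\<not> B.lin_dep (e ` X)"
  proof
    assume "B.lin_dep (e ` X)"
    then obtain A a v where A: "finite A" "A \<subseteq> e ` X" "a \<in> A \<rightarrow> carrier R" "v \<in> A"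
      and lc: "B.lincomb a A = \<zero>\<^bsub>B\<^esub>" and av: "a v \<noteq> \<zero>\<^bsub>R\<^esub>" unfolding B.lin_dep_def by blast
    let ?g = "\<lambda>x. \<phi> (if e x = v then \<one>\<^bsub>R\<^esub> else \<zero>\<^bsub>R\<^esub>)"
    let ?h = "free_ext X B e M ?g"
    let ?k = "\<lambda>y. inv_into (carrier R) \<phi> (?h y)"
    have g: "?g x \<in> carrier M" for x using module_homD[OF \<phi>] by auto
    have h: "?h \<in> module_hom R B M" "\<And>x. x \<in> X \<Longrightarrow> ?h (e x) = ?g x"
      using free_ext[OF B M, of ?g] g by (auto simp: mem_arr_MOD)
    have k: "?k \<in> module_hom R B ?N"
      using module_hom_compose[OF h(1) module_hom_inv[OF N M' \<phi> bij]] by simp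
    have kA: "?k w = (if w = v then \<one>\<^bsub>R\<^esub> else \<zero>\<^bsub>R\<^esub>)" if "w \<in> A" for w
      using that A h(2) bij by (auto simp: bij_betw_def)
    interpret N: module R ?N by (fact N)
    have "\<zero>\<^bsub>R\<^esub> = ?k (B.lincomb a A)" using module_hom_zero[OF modB N k] lc by simp
    also have "\<dots> = finsum ?N (\<lambda>w. ?k (a w \<odot>\<^bsub>B\<^esub> w)) A"
      unfolding B.lincomb_def using modB N k
      by (rule module_hom_finsum) (use A eX in \<open>fastforce intro: B.smult_closed simp: Pi_iff\<close>)
    also have "\<dots> = finsum ?N (\<lambda>w. if w = v then a v else \<zero>\<^bsub>?N\<^esub>) A"
    proof (rule N.finsum_cong')
      fix w assume w: "w \<in> A"
      then have aw: "a w \<in> carrier R" "w \<in> carrier B" using A eX by auto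
      show "?k (a w \<odot>\<^bsub>B\<^esub> w) = (if w = v then a v else \<zero>\<^bsub>?N\<^esub>)"
        using module_hom_smult[OF k aw] kA[OF w] aw by auto
    qed (use A in auto)
    also have "\<dots> = a v"
      using N.add.finprod_singleton[of v A "\<lambda>_. a v"] A
      by (simp add: eq_commute[of v] Pi_iff)
    finally show False using av by simp
  qed
  then have "free_module R B" using eX free_on_span[OF B] unfolding free_module_def by blast
  moreover have "finitely_generated R B"
    using eX free_on_span[OF B] X unfolding finitely_generated_def by blast
  ultimately show ?thesis using free_on_obj[OF B] by (simp add: obj_FMOD)
qed

text \<open>
  A basis and a finite generating set are given independently of each other; the finitely many
  basis elements that occur in the generators already span.
\<close>

lemma Fmod_finite_basis:
  assumes L: "L \<in> obj Fmods"
  obtains S where "finite S" "S \<subseteq> carrier L" "\<not> module.lin_dep R L S" "module.span R L S = carrier L"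
proof -
  have modL: "module R L" using L by (simp add: obj_FMOD mem_obj_MOD)
  interpret L: module R L by (fact modL)
  obtain T where T: "finite T" "T \<subseteq> carrier L" "L.span T = carrier L"
    using L by (auto simp: obj_FMOD finitely_generated_def)
  obtain S where S: "S \<subseteq> carrier L" "\<not> L.lin_dep S" "L.span S = carrier L"
    using L by (auto simp: obj_FMOD free_module_def)
  have "\<exists>A. finite A \<and> A \<subseteq> S \<and> t \<in> L.span A" if "t \<in> T" for t
  proof -
    have "t \<in> L.span S" using that T S by auto
    then obtain a A where "finite A" "A \<subseteq> S" "a \<in> A \<rightarrow> carrier R" "t = L.lincomb a A"
      unfolding L.span_def by blast
    then show ?thesis unfolding L.span_def by blast
  qed
  then obtain A where A: "\<And>t. t \<in> T \<Longrightarrow> finite (A t) \<and> A t \<subseteq> S \<and> t \<in> L.span (A t)" by metis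
  define S' where "S' = (\<Union>t\<in>T. A t)"
  have S': "finite S'" "S' \<subseteq> S" using A T by (auto simp: S'_def)
  have S'L: "S' \<subseteq> carrier L" using S' S by auto
  have "T \<subseteq> L.span S'"
  proof
    fix t assume t: "t \<in> T"
    then have "A t \<subseteq> S'" by (auto simp: S'_def)
    then have "L.span (A t) \<subseteq> L.span S'" by (rule L.span_is_monotone)
    then show "t \<in> L.span S'" using A[OF t] by blast
  qed
  then have "L.span T \<subseteq> L.span S'"
    using L.span_is_submodule[OF S'L] by (rule L.span_is_subset)
  then have "L.span S' = carrier L" using T L.span_is_subset2[OF S'L] by auto
  with S' S S'L L.subset_li_is_li[OF S(2) S'(2)] show ?thesis by (intro that[of S']) auto
qed

lemma free_on_finite_basis:
  assumes L: "L \<in> obj Mods"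
    and S: "finite S" "S \<subseteq> carrier L" "\<not> module.lin_dep R L S" "module.span R L S = carrier L"
  shows "free_on S L (\<lambda>x. x)"
proof -
  have modL: "module R L" using L by (simp add: mem_obj_MOD)
  interpret L: module R L by (fact modL)
  have "\<exists>a. a \<in> S \<rightarrow> carrier R \<and> y = L.lincomb a S" if "y \<in> carrier L" for y
  proof -
    have "y \<in> {L.lincomb a S |a. a \<in> S \<rightarrow> carrier R}"
      using that S(4) unfolding L.finite_span[OF S(1,2)] by simp
    then show ?thesis by blast
  qed
  then obtain c where c: "\<And>y. y \<in> carrier L \<Longrightarrow> c y \<in> S \<rightarrow> carrier R"
      "\<And>y. y \<in> carrier L \<Longrightarrow> y = L.lincomb (c y) S" by metis
  have uniq: "a x = b x"
    if a: "a \<in> S \<rightarrow> carrier R" and b: "b \<in> S \<rightarrow> carrier R"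
      and eq: "L.lincomb a S = L.lincomb b S" and x: "x \<in> S" for a b x
  proof (rule ccontr)
    assume "a x \<noteq> b x"
    have ab: "a x \<in> carrier R" "b x \<in> carrier R" using a b x by auto
    have ne: "a x \<ominus>\<^bsub>R\<^esub> b x \<noteq> \<zero>\<^bsub>R\<^esub>" using \<open>a x \<noteq> b x\<close> R.minus_eq_zeroD[OF ab] by blast
    have "L.lincomb (\<lambda>v. a v \<ominus>\<^bsub>R\<^esub> b v) S = \<zero>\<^bsub>L\<^esub>"
      using L.lincomb_diff[OF S(1,2) a b] eq L.lincomb_closed[OF S(2) b] by simp
    moreover have "(\<lambda>v. a v \<ominus>\<^bsub>R\<^esub> b v) \<in> S \<rightarrow> carrier R" using a b by auto
    ultimately have "L.lin_dep S" 
      using L.lin_dep_crit[where S = S and a = "\<lambda>v. a v \<ominus>\<^bsub>R\<^esub> b v" and v = x, OF S(1) subset_refl _ x ne]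
      by simp
    with S show False by blast
  qed
  show ?thesis
  proof (rule free_onI_coordinates[where c = c])
    show "c (y \<oplus>\<^bsub>L\<^esub> z) x = c y x \<oplus>\<^bsub>R\<^esub> c z x"
      if y: "y \<in> carrier L" and z: "z \<in> carrier L" and x: "x \<in> S" for y z x
      using L.lincomb_sum[OF S(1,2) c(1)[OF y] c(1)[OF z]] c(2)[OF y] c(2)[OF z]
        c[of "y \<oplus>\<^bsub>L\<^esub> z"] c(1)[OF y] c(1)[OF z] y z x
      by (intro uniq) (auto simp: Pi_iff)
    show "c (a \<odot>\<^bsub>L\<^esub> y) x = a \<otimes>\<^bsub>R\<^esub> c y x"
      if a: "a \<in> carrier R" and y: "y \<in> carrier L" and x: "x \<in> S" for a y x
      using L.lincomb_smult[OF S(2) c(1)[OF y] a] c(2)[OF y] c[of "a \<odot>\<^bsub>L\<^esub> y"] c(1)[OF y] a y x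
      by (intro uniq) (auto simp: Pi_iff)
    show "c z x = (if x = z then \<one>\<^bsub>R\<^esub> else \<zero>\<^bsub>R\<^esub>)" if z: "z \<in> S" and x: "x \<in> S" for z x
    proof -
      have zL: "z \<in> carrier L" using z S by auto
      let ?\<delta> = "\<lambda>w. if w = z then \<one>\<^bsub>R\<^esub> else \<zero>\<^bsub>R\<^esub>"
      have "L.lincomb ?\<delta> S = finsum L (\<lambda>w. if w = z then z else \<zero>\<^bsub>L\<^esub>) S"
        unfolding L.lincomb_def using S by (intro L.finsum_cong') auto
      also have "\<dots> = z"
        using L.add.finprod_singleton[of z S "\<lambda>_. z"] z zL S by (auto simp: eq_commute[of z] Pi_iff)
      finally show ?thesis using c[OF zL] x by (intro uniq[of _ ?\<delta>]) auto
    qed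
    show "y = finsum L (\<lambda>x. c y x \<odot>\<^bsub>L\<^esub> x) {x \<in> S. c y x \<noteq> \<zero>\<^bsub>R\<^esub>}" if y: "y \<in> carrier L" for y
    proof -
      have "finsum L (\<lambda>x. c y x \<odot>\<^bsub>L\<^esub> x) {x \<in> S. c y x \<noteq> \<zero>\<^bsub>R\<^esub>} = finsum L (\<lambda>x. c y x \<odot>\<^bsub>L\<^esub> x) S"
        using S c(1)[OF y]
        by (intro L.add.finprod_mono_neutral_cong_left) (auto simp: Pi_iff subset_iff)
      then show ?thesis using c(2)[OF y] by (simp add: L.lincomb_def)
    qed
  qed (use L S c in \<open>auto simp: Pi_iff\<close>)
qed

lemma free_on_reindex:
  assumes B: "free_on X B e" and f: "bij_betw f Y X"
  shows "free_on Y B (\<lambda>y. e (f y))"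
  unfolding free_on_def
proof (intro conjI ballI)
  show "B \<in> obj Mods" using free_on_obj[OF B] .
  show "(\<lambda>y. e (f y)) \<in> Y \<rightarrow> carrier B" using free_on_mem[OF B] f by (auto simp: bij_betw_def)
next
  fix M :: "('a, 'u) module" and g assume M: "M \<in> obj Mods" and g: "g \<in> Y \<rightarrow> carrier M"
  have "(\<lambda>x. g (inv_into Y f x)) \<in> X \<rightarrow> carrier M"
    using g f by (auto simp: bij_betw_def Pi_iff intro: inv_into_into)
  then have *: "\<exists>!h. h \<in> arr Mods B M \<and> (\<forall>x\<in>X. h (e x) = g (inv_into Y f x))"
    using B M by (auto simp: free_on_def)
  have "(\<forall>x\<in>X. h (e x) = g (inv_into Y f x)) \<longleftrightarrow> (\<forall>y\<in>Y. h (e (f y)) = g y)" for h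
    using f by (auto simp: bij_betw_def)
  with * show "\<exists>!h. h \<in> arr Mods B M \<and> (\<forall>y\<in>Y. h (e (f y)) = g y)" by simp
qed

lemma Fmod_free_on:
  assumes L: "L \<in> obj Fmods"
  obtains n :: nat and e where "free_on {..<n} L e"
proof -
  obtain S where S: "finite S" "S \<subseteq> carrier L" "\<not> module.lin_dep R L S" "module.span R L S = carrier L"
    using L by (rule Fmod_finite_basis)
  have "free_on S L (\<lambda>x. x)" using L S by (intro free_on_finite_basis) (auto simp: obj_FMOD)
  moreover obtain f where "bij_betw f {..<card S} S"
    using ex_bij_betw_nat_finite[OF S(1)] by (auto simp: atLeast0LessThan)
  ultimately show ?thesis by (intro that) (rule free_on_reindex)
qed

end

section \<open>Sifted colimits of modules\<close>

text \<open>
  Indexed pairs \<open>(i, x)\<close> with \<open>x\<close> in \<open>N i\<close> are glued along the transition maps; \<open>tr i j\<close> is the set of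
  all transition maps, so that a diagram need not be given by a category.
\<close>

definition glue_step ::
  "'i set \<Rightarrow> ('i \<Rightarrow> ('a, 'n) module) \<Rightarrow> ('i \<Rightarrow> 'i \<Rightarrow> ('n \<Rightarrow> 'n) set) \<Rightarrow> 'i \<times> 'n \<Rightarrow> 'i \<times> 'n \<Rightarrow> bool" where
  "glue_step I N tr p q \<longleftrightarrow> fst p \<in> I \<and> fst q \<in> I \<and> snd p \<in> carrier (N (fst p)) \<and>
    (\<exists>t \<in> tr (fst p) (fst q). snd q = t (snd p))"

abbreviation glued ::
  "'i set \<Rightarrow> ('i \<Rightarrow> ('a, 'n) module) \<Rightarrow> ('i \<Rightarrow> 'i \<Rightarrow> ('n \<Rightarrow> 'n) set) \<Rightarrow> 'i \<times> 'n \<Rightarrow> 'i \<times> 'n \<Rightarrow> bool" where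
  "glued I N tr \<equiv> equivclp (glue_step I N tr)"

text \<open>
  If the cospans under any two indices form a connected category, then the sum of two elements may
  be computed in any cospan; \<open>cospan_indep\<close> keeps of connectedness only this consequence. Filtered
  diagrams and diagrams over categories with binary coproducts are the two instances below.
\<close>

locale sifted_diagram = module_universe small R
  for small :: "'u set \<Rightarrow> bool" and R :: "'a ring" +
  fixes I :: "'i set" and N :: "'i \<Rightarrow> ('a, 'n) module" and tr :: "'i \<Rightarrow> 'i \<Rightarrow> ('n \<Rightarrow> 'n) set"
  assumes modN: "i \<in> I \<Longrightarrow> module R (N i)"
    and nonempty: "I \<noteq> {}"
    and tr_hom: "\<lbrakk>i \<in> I; j \<in> I; t \<in> tr i j\<rbrakk> \<Longrightarrow> t \<in> module_hom R (N i) (N j)"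
    and tr_id: "i \<in> I \<Longrightarrow> \<exists>t \<in> tr i i. \<forall>x \<in> carrier (N i). t x = x"
    and tr_comp: "\<lbrakk>i \<in> I; j \<in> I; k \<in> I; s \<in> tr i j; t \<in> tr j k\<rbrakk>
      \<Longrightarrow> \<exists>r \<in> tr i k. \<forall>x \<in> carrier (N i). r x = t (s x)"
    and cospan: "\<lbrakk>i \<in> I; j \<in> I\<rbrakk> \<Longrightarrow> \<exists>k \<in> I. tr i k \<noteq> {} \<and> tr j k \<noteq> {}"
    and cospan_indep: "\<lbrakk>i \<in> I; j \<in> I; k \<in> I; k' \<in> I; s \<in> tr i k; t \<in> tr j k; s' \<in> tr i k'; t' \<in> tr j k';
        x \<in> carrier (N i); y \<in> carrier (N j)\<rbrakk>
      \<Longrightarrow> glued I N tr (k, s x \<oplus>\<^bsub>N k\<^esub> t y) (k', s' x \<oplus>\<^bsub>N k'\<^esub> t' y)"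
    and small_points: "ess_small (SIGMA i:I. carrier (N i))"

context module_universe
begin

text \<open>
  This says that the underlying set of \<open>C\<close> is the colimit of the underlying sets.
\<close>

definition glues_to ::
  "'i set \<Rightarrow> ('i \<Rightarrow> ('a, 'n) module) \<Rightarrow> ('i \<Rightarrow> 'i \<Rightarrow> ('n \<Rightarrow> 'n) set) \<Rightarrow>
   ('a, 'u) module \<Rightarrow> ('i \<Rightarrow> 'n \<Rightarrow> 'u) \<Rightarrow> bool" where
  "glues_to I N tr C \<kappa> \<longleftrightarrow> C \<in> obj Mods \<and>
    (\<forall>i\<in>I. \<kappa> i \<in> module_hom R (N i) C) \<and>
    (\<forall>z\<in>carrier C. \<exists>i\<in>I. \<exists>x\<in>carrier (N i). z = \<kappa> i x) \<and>
    (\<forall>i\<in>I. \<forall>j\<in>I. \<forall>x\<in>carrier (N i). \<forall>y\<in>carrier (N j).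
      \<kappa> i x = \<kappa> j y \<longleftrightarrow> glued I N tr (i, x) (j, y))"

lemma glues_toD:
  assumes "glues_to I N tr C \<kappa>"
  shows glues_to_obj: "C \<in> obj Mods"
    and glues_to_hom: "i \<in> I \<Longrightarrow> \<kappa> i \<in> module_hom R (N i) C"
    and glues_to_cases: "z \<in> carrier C \<Longrightarrow>
      (\<And>i x. i \<in> I \<Longrightarrow> x \<in> carrier (N i) \<Longrightarrow> z = \<kappa> i x \<Longrightarrow> thesis) \<Longrightarrow> thesis"
    and glues_to_eq_iff: "\<lbrakk>i \<in> I; j \<in> I; x \<in> carrier (N i); y \<in> carrier (N j)\<rbrakk>
      \<Longrightarrow> \<kappa> i x = \<kappa> j y \<longleftrightarrow> glued I N tr (i, x) (j, y)"
  using assms unfolding glues_to_def by blast+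

end

context sifted_diagram
begin

abbreviation points :: "('i \<times> 'n) set" where "points \<equiv> SIGMA i:I. carrier (N i)"

abbreviation same_class :: "'i \<times> 'n \<Rightarrow> 'i \<times> 'n \<Rightarrow> bool" (infix \<open>\<approx>\<close> 50)
  where "p \<approx> q \<equiv> glued I N tr p q"

lemma glued_sym: "p \<approx> q \<Longrightarrow> q \<approx> p" by (rule equivclp_sym)

lemma glued_trans: "p \<approx> q \<Longrightarrow> q \<approx> r \<Longrightarrow> p \<approx> r" by (rule equivclp_trans)

lemma glue_tr: "\<lbrakk>i \<in> I; j \<in> I; x \<in> carrier (N i); t \<in> tr i j\<rbrakk> \<Longrightarrow> (i, x) \<approx> (j, t x)"
  by (rule r_into_equivclp) (auto simp: glue_step_def)

lemma tr_mem: "\<lbrakk>i \<in> I; j \<in> I; t \<in> tr i j; x \<in> carrier (N i)\<rbrakk> \<Longrightarrow> t x \<in> carrier (N j)"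
  using module_homD[OF tr_hom] .

lemma glue_step_points: "glue_step I N tr p q \<Longrightarrow> p \<in> points \<and> q \<in> points"
  by (cases p; cases q) (auto simp: glue_step_def intro: tr_mem)

lemma common_index:
  assumes "p \<in> points" "q \<in> points"
  obtains k x y where "k \<in> I" "x \<in> carrier (N k)" "y \<in> carrier (N k)" "p \<approx> (k, x)" "q \<approx> (k, y)"
proof -
  obtain i x j y where p: "p = (i, x)" "i \<in> I" "x \<in> carrier (N i)"
    and q: "q = (j, y)" "j \<in> I" "y \<in> carrier (N j)" using assms by blast
  obtain k s t where k: "k \<in> I" "s \<in> tr i k" "t \<in> tr j k" using cospan[OF p(2) q(2)] by blast
  show ?thesis
    by (rule that[of k "s x" "t y"]) (use p q k in \<open>auto intro: tr_mem glue_tr\<close>)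
qed

text \<open>
  A relation rather than an operation, since the sum depends on the cospan in which it is computed.
\<close>

definition is_sum :: "'i \<times> 'n \<Rightarrow> 'i \<times> 'n \<Rightarrow> 'i \<times> 'n \<Rightarrow> bool" where
  "is_sum p q r \<longleftrightarrow> (\<exists>s \<in> tr (fst p) (fst r). \<exists>t \<in> tr (fst q) (fst r).
    fst r \<in> I \<and> snd r = s (snd p) \<oplus>\<^bsub>N (fst r)\<^esub> t (snd q))"

lemma is_sum_unique:
  assumes "p \<in> points" "q \<in> points" "is_sum p q r" "is_sum p q r'" shows "r \<approx> r'"
proof -
  obtain s t where s: "s \<in> tr (fst p) (fst r)" "t \<in> tr (fst q) (fst r)" "fst r \<in> I"
      "snd r = s (snd p) \<oplus>\<^bsub>N (fst r)\<^esub> t (snd q)" using assms(3) unfolding is_sum_def by blast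
  obtain s' t' where s': "s' \<in> tr (fst p) (fst r')" "t' \<in> tr (fst q) (fst r')" "fst r' \<in> I"
      "snd r' = s' (snd p) \<oplus>\<^bsub>N (fst r')\<^esub> t' (snd q)" using assms(4) unfolding is_sum_def by blast
  have pq: "fst p \<in> I" "snd p \<in> carrier (N (fst p))" "fst q \<in> I" "snd q \<in> carrier (N (fst q))"
    using assms(1,2) by auto
  have "(fst r, snd r) \<approx> (fst r', snd r')"
    unfolding s(4) s'(4) using pq s s' by (intro cospan_indep) auto
  then show ?thesis by simp
qed

lemma is_sum_exists:
  assumes "p \<in> points" "q \<in> points" obtains r where "is_sum p q r"
proof -
  obtain k s t where "k \<in> I" "s \<in> tr (fst p) k" "t \<in> tr (fst q) k"
    using cospan[of "fst p" "fst q"] assms by auto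
  then show ?thesis by (intro that[of "(k, s (snd p) \<oplus>\<^bsub>N k\<^esub> t (snd q))"]) (auto simp: is_sum_def)
qed

lemma is_sum_points:
  assumes "p \<in> points" "q \<in> points" "is_sum p q r" shows "r \<in> points"
proof -
  obtain s t where s: "s \<in> tr (fst p) (fst r)" "t \<in> tr (fst q) (fst r)" "fst r \<in> I"
      "snd r = s (snd p) \<oplus>\<^bsub>N (fst r)\<^esub> t (snd q)" using assms(3) unfolding is_sum_def by blast
  interpret N: module R "N (fst r)" using s modN by simp
  have pq: "fst p \<in> I" "snd p \<in> carrier (N (fst p))" "fst q \<in> I" "snd q \<in> carrier (N (fst q))"
    using assms(1,2) by auto
  have "snd r \<in> carrier (N (fst r))"
    unfolding s(4) using tr_mem[OF pq(1) s(3,1) pq(2)] tr_mem[OF pq(3) s(3,2) pq(4)] by simp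
  then show ?thesis using s(3) by (cases r) auto
qed

lemma is_sum_commute:
  assumes "p \<in> points" "q \<in> points" "is_sum p q r" shows "is_sum q p r"
proof -
  obtain s t where s: "s \<in> tr (fst p) (fst r)" "t \<in> tr (fst q) (fst r)" "fst r \<in> I"
      "snd r = s (snd p) \<oplus>\<^bsub>N (fst r)\<^esub> t (snd q)" using assms(3) unfolding is_sum_def by blast
  interpret N: module R "N (fst r)" using s modN by simp
  have pq: "fst p \<in> I" "snd p \<in> carrier (N (fst p))" "fst q \<in> I" "snd q \<in> carrier (N (fst q))"
    using assms(1,2) by auto
  have "snd r = t (snd q) \<oplus>\<^bsub>N (fst r)\<^esub> s (snd p)"
    unfolding s(4) using tr_mem[OF pq(1) s(3,1) pq(2)] tr_mem[OF pq(3) s(3,2) pq(4)]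
    by (rule N.a_comm)
  with s show ?thesis unfolding is_sum_def by blast
qed

text \<open>
  A cospan under the target of a move becomes a cospan under its source by composition, and the
  sum computed in it stays the same.
\<close>

lemma is_sum_step:
  assumes step: "glue_step I N tr p p'" and q: "q \<in> points" and r: "is_sum p' q r"
  shows "is_sum p q r"
proof -
  obtain u where p: "fst p \<in> I" "fst p' \<in> I" "snd p \<in> carrier (N (fst p))" "u \<in> tr (fst p) (fst p')"
      "snd p' = u (snd p)" using step unfolding glue_step_def by blast
  obtain s t where s: "s \<in> tr (fst p') (fst r)" "t \<in> tr (fst q) (fst r)" "fst r \<in> I"
      "snd r = s (snd p') \<oplus>\<^bsub>N (fst r)\<^esub> t (snd q)" using r unfolding is_sum_def by blast
  obtain v where v: "v \<in> tr (fst p) (fst r)" "\<forall>x \<in> carrier (N (fst p)). v x = s (u x)"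
    using tr_comp[OF p(1,2) s(3) p(4) s(1)] by blast
  have "snd r = v (snd p) \<oplus>\<^bsub>N (fst r)\<^esub> t (snd q)" using s(4) v(2) p(3,5) by simp
  with v(1) s(2,3) show ?thesis unfolding is_sum_def by blast
qed

text \<open>
  Induction along the zigzag: every step preserves the class of the sum by \<open>is_sum_step\<close>, and the
  choice of the cospan is irrelevant by \<open>is_sum_unique\<close>.
\<close>

lemma is_sum_glued_left:
  assumes pp': "p \<approx> p'" and p: "p \<in> points" and q: "q \<in> points"
    and r: "is_sum p q r" and r': "is_sum p' q r'"
  shows "r \<approx> r'"
proof -
  have "p' \<in> points \<and> (\<forall>r'. is_sum p' q r' \<longrightarrow> r \<approx> r')" using pp'
  proof (induction rule: equivclp_induct)
    case base
    show ?case using p q r is_sum_unique by blast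
  next
    case (step y z)
    have z: "z \<in> points" using step.hyps(2) glue_step_points by blast
    have "r \<approx> w" if w: "is_sum z q w" for w
      using step.hyps(2)
    proof
      assume yz: "glue_step I N tr y z"
      then have "is_sum y q w" using is_sum_step q w by blast
      with step.IH show ?thesis by blast
    next
      assume zy: "glue_step I N tr z y"
      obtain w' where w': "is_sum y q w'" using is_sum_exists step.IH q by blast
      then have "is_sum z q w'" using is_sum_step zy q by blast
      then have "w' \<approx> w" using is_sum_unique z q w by blast
      moreover have "r \<approx> w'" using step.IH w' by blast
      ultimately show ?thesis using glued_trans by blast
    qed
    with z show ?case by blast
  qed
  with r' show ?thesis by blast
qed

lemma is_sum_glued:
  assumes "p \<approx> p'" "q \<approx> q'" "p \<in> points" "q \<in> points" "p' \<in> points" "q' \<in> points"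
    and r: "is_sum p q r" and r': "is_sum p' q' r'"
  shows "r \<approx> r'"
proof -
  obtain w where w: "is_sum p' q w" using is_sum_exists assms by blast
  have "r \<approx> w" using is_sum_glued_left assms w by blast
  moreover have "w \<approx> r'"
    using is_sum_glued_left[of q q' p' w r'] is_sum_commute assms w by blast
  ultimately show ?thesis by (rule glued_trans)
qed

lemma is_sum_same_index:
  assumes k: "k \<in> I" "x \<in> carrier (N k)" "y \<in> carrier (N k)"
  shows "is_sum (k, x) (k, y) (k, x \<oplus>\<^bsub>N k\<^esub> y)"
proof -
  obtain t where "t \<in> tr k k" "\<forall>x \<in> carrier (N k). t x = x" using tr_id k by blast
  then show ?thesis using k unfolding is_sum_def by (auto intro!: bexI[of _ t])
qed

lemma glued_smult:
  assumes a: "a \<in> carrier R" and pq: "p \<approx> q"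
  shows "(fst p, a \<odot>\<^bsub>N (fst p)\<^esub> snd p) \<approx> (fst q, a \<odot>\<^bsub>N (fst q)\<^esub> snd q)"
  using pq
proof (induction rule: equivclp_induct)
  case base
  show ?case by simp
next
  case (step y z)
  have *: "(fst y, a \<odot>\<^bsub>N (fst y)\<^esub> snd y) \<approx> (fst z, a \<odot>\<^bsub>N (fst z)\<^esub> snd z)"
    if yz: "glue_step I N tr y z" for y z
  proof -
    obtain t where t: "fst y \<in> I" "fst z \<in> I" "snd y \<in> carrier (N (fst y))"
        "t \<in> tr (fst y) (fst z)" "snd z = t (snd y)"
      using yz unfolding glue_step_def by blast
    interpret N: module R "N (fst y)" using t modN by simp
    show ?thesis
      using glue_tr[of "fst y" "fst z" "a \<odot>\<^bsub>N (fst y)\<^esub> snd y" t] t a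
        module_hom_smult[OF tr_hom[OF t(1,2,4)] a t(3)] by simp
  qed
  from step.hyps(2) have "(fst y, a \<odot>\<^bsub>N (fst y)\<^esub> snd y) \<approx> (fst z, a \<odot>\<^bsub>N (fst z)\<^esub> snd z)"
    using * glued_sym by blast
  with step.IH show ?case by (rule glued_trans)
qed

lemma glued_zero:
  assumes "i \<in> I" "j \<in> I" shows "(i, \<zero>\<^bsub>N i\<^esub>) \<approx> (j, \<zero>\<^bsub>N j\<^esub>)"
proof -
  have zero: "\<zero>\<^bsub>N l\<^esub> \<in> carrier (N l)" if "l \<in> I" for l
  proof -
    interpret N: module R "N l" using that by (rule modN)
    show ?thesis by simp
  qed
  obtain k s t where k: "k \<in> I" "s \<in> tr i k" "t \<in> tr j k" using cospan[OF assms] by blast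
  have "(i, \<zero>\<^bsub>N i\<^esub>) \<approx> (k, \<zero>\<^bsub>N k\<^esub>)"
    using glue_tr[OF assms(1) k(1) zero k(2)] assms k tr_hom modN
      module_hom_zero[of R "N i" "N k" s] by simp
  moreover have "(j, \<zero>\<^bsub>N j\<^esub>) \<approx> (k, \<zero>\<^bsub>N k\<^esub>)"
    using glue_tr[OF assms(2) k(1) zero k(3)] assms k tr_hom modN
      module_hom_zero[of R "N j" "N k" t] by simp
  ultimately show ?thesis using glued_sym glued_trans by blast
qed

text \<open>
  The colimit of the underlying sets carries a unique module structure for which all \<open>\<kappa> i\<close> are
  homomorphisms. Any three elements have representatives at a common index, so the module laws
  reduce to those of a single \<open>N k\<close>.
\<close>

lemma colimit_exists: obtains C \<kappa> where "glues_to I N tr C \<kappa>"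
proof -
  obtain enc :: "'i \<times> 'n \<Rightarrow> 'u" where enc: "inj_on enc points" "small (enc ` points)"
    using small_points by (rule ess_small_encode)
  \<comment> \<open>A canonical representative of each class; its code will be an element of the colimit.\<close>
  define rep where "rep p = (SOME q. q \<in> points \<and> p \<approx> q)" for p
  have rep: "rep p \<in> points" "p \<approx> rep p" if "p \<in> points" for p
    using someI[of "\<lambda>q. q \<in> points \<and> p \<approx> q" p] that by (auto simp: rep_def)
  have rep_eq: "rep p = rep q \<longleftrightarrow> p \<approx> q" if p: "p \<in> points" and q: "q \<in> points" for p q
  proof
    assume "rep p = rep q"
    then show "p \<approx> q" using rep[OF p] rep[OF q] glued_sym glued_trans by metis
  next
    assume "p \<approx> q"
    then have "(\<lambda>r. r \<in> points \<and> p \<approx> r) = (\<lambda>r. r \<in> points \<and> q \<approx> r)"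
      using glued_sym glued_trans by blast
    then show "rep p = rep q" by (simp add: rep_def)
  qed
  define \<pi> where "\<pi> p = enc (rep p)" for p
  have \<pi>_eq: "\<pi> p = \<pi> q \<longleftrightarrow> p \<approx> q" if "p \<in> points" "q \<in> points" for p q
    using rep_eq[OF that] rep(1) that inj_on_eq_iff[OF enc(1)] by (simp add: \<pi>_def)
  \<comment> \<open>A section of \<open>\<pi>\<close>: the operations are computed on chosen representatives.\<close>
  define pt where "pt c = (SOME p. p \<in> points \<and> \<pi> p = c)" for c
  have pt: "pt (\<pi> p) \<in> points" "pt (\<pi> p) \<approx> p" if p: "p \<in> points" for p
  proof -
    have "pt (\<pi> p) \<in> points \<and> \<pi> (pt (\<pi> p)) = \<pi> p"
      unfolding pt_def by (rule someI[of _ p]) (simp add: p)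
    then show "pt (\<pi> p) \<in> points" "pt (\<pi> p) \<approx> p" using \<pi>_eq p by auto
  qed
  define sm where "sm p q = (SOME r. is_sum p q r)" for p q
  have sm: "is_sum p q (sm p q)" if "p \<in> points" "q \<in> points" for p q
    unfolding sm_def using is_sum_exists[OF that] by (metis someI_ex)
  obtain i0 where i0: "i0 \<in> I" using nonempty by blast
  define C :: "('a, 'u) module" where
    "C = \<lparr>carrier = \<pi> ` points, mult = (\<lambda>_ _. undefined), one = undefined,
          zero = \<pi> (i0, \<zero>\<^bsub>N i0\<^esub>), add = (\<lambda>c d. \<pi> (sm (pt c) (pt d))),
          smult = (\<lambda>a c. \<pi> (fst (pt c), a \<odot>\<^bsub>N (fst (pt c))\<^esub> snd (pt c)))\<rparr>"
  have N_add: "x \<oplus>\<^bsub>N k\<^esub> y \<in> carrier (N k)" if "k \<in> I" "x \<in> carrier (N k)" "y \<in> carrier (N k)" for k x y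
  proof -
    interpret N: module R "N k" using that(1) by (rule modN)
    show ?thesis using that by simp
  qed
  have N_smult: "a \<odot>\<^bsub>N k\<^esub> x \<in> carrier (N k)" if "k \<in> I" "x \<in> carrier (N k)" "a \<in> carrier R" for k x a
  proof -
    interpret N: module R "N k" using that(1) by (rule modN)
    show ?thesis using that by simp
  qed
  have N_zero: "\<zero>\<^bsub>N k\<^esub> \<in> carrier (N k)" if "k \<in> I" for k
  proof -
    interpret N: module R "N k" using that(1) by (rule modN)
    show ?thesis by simp
  qed
  have add: "\<pi> (k, x) \<oplus>\<^bsub>C\<^esub> \<pi> (k, y) = \<pi> (k, x \<oplus>\<^bsub>N k\<^esub> y)"
    if k: "k \<in> I" "x \<in> carrier (N k)" "y \<in> carrier (N k)" for k x y
  proof -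
    have p: "(k, x) \<in> points" "(k, y) \<in> points" "(k, x \<oplus>\<^bsub>N k\<^esub> y) \<in> points"
      using k N_add by auto
    note p' = pt[OF p(1)] pt[OF p(2)]
    note sum' = sm[OF p'(1,3)]
    have "sm (pt (\<pi> (k, x))) (pt (\<pi> (k, y))) \<approx> (k, x \<oplus>\<^bsub>N k\<^esub> y)"
      by (rule is_sum_glued[OF p'(2,4,1,3) p(1,2) sum' is_sum_same_index[OF k]])
    then show ?thesis using \<pi>_eq[OF is_sum_points[OF p'(1,3) sum'] p(3)] by (simp add: C_def)
  qed
  have smult: "a \<odot>\<^bsub>C\<^esub> \<pi> (k, x) = \<pi> (k, a \<odot>\<^bsub>N k\<^esub> x)"
    if k: "k \<in> I" "x \<in> carrier (N k)" and a: "a \<in> carrier R" for a k x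
  proof -
    have p: "(k, x) \<in> points" "(k, a \<odot>\<^bsub>N k\<^esub> x) \<in> points" using k a N_smult by auto
    let ?q = "pt (\<pi> (k, x))"
    have "fst ?q \<in> I" "snd ?q \<in> carrier (N (fst ?q))" using pt(1)[OF p(1)] by auto
    then have q: "(fst ?q, a \<odot>\<^bsub>N (fst ?q)\<^esub> snd ?q) \<in> points" using a N_smult by auto
    show ?thesis using glued_smult[OF a pt(2)[OF p(1)]] \<pi>_eq[OF q p(2)] by (simp add: C_def)
  qed
  have zero: "\<zero>\<^bsub>C\<^esub> = \<pi> (k, \<zero>\<^bsub>N k\<^esub>)" if "k \<in> I" for k
    using \<pi>_eq[of "(i0, \<zero>\<^bsub>N i0\<^esub>)" "(k, \<zero>\<^bsub>N k\<^esub>)"] glued_zero[OF i0 that] N_zero i0 that by (simp add: C_def)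
  have mem: "\<pi> (k, x) \<in> carrier C" if "k \<in> I" "x \<in> carrier (N k)" for k x
    using that by (auto simp: C_def)
  have one: "\<exists>k x. k \<in> I \<and> x \<in> carrier (N k) \<and> c = \<pi> (k, x)" if "c \<in> carrier C" for c
    using that by (auto simp: C_def)
  have two: "\<exists>k x y. k \<in> I \<and> x \<in> carrier (N k) \<and> y \<in> carrier (N k) \<and> c = \<pi> (k, x) \<and> d = \<pi> (k, y)"
    if c: "c \<in> carrier C" and d: "d \<in> carrier C" for c d
  proof -
    obtain p q where p: "p \<in> points" "c = \<pi> p" and q: "q \<in> points" "d = \<pi> q"
      using c d by (auto simp: C_def)
    obtain k x y where k: "k \<in> I" "x \<in> carrier (N k)" "y \<in> carrier (N k)" "p \<approx> (k, x)" "q \<approx> (k, y)"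
      using p(1) q(1) by (rule common_index)
    have "c = \<pi> (k, x)" "d = \<pi> (k, y)" using \<pi>_eq[OF p(1)] \<pi>_eq[OF q(1)] k p q by auto
    with k show ?thesis by blast
  qed
  have three: "\<exists>k x y z. k \<in> I \<and> x \<in> carrier (N k) \<and> y \<in> carrier (N k) \<and> z \<in> carrier (N k) \<and>
      c = \<pi> (k, x) \<and> d = \<pi> (k, y) \<and> e = \<pi> (k, z)"
    if c: "c \<in> carrier C" and d: "d \<in> carrier C" and e: "e \<in> carrier C" for c d e
  proof -
    obtain j x y where j: "j \<in> I" "x \<in> carrier (N j)" "y \<in> carrier (N j)" "c = \<pi> (j, x)" "d = \<pi> (j, y)"
      using two[OF c d] by blast
    obtain l z where l: "l \<in> I" "z \<in> carrier (N l)" "e = \<pi> (l, z)" using one[OF e] by blast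
    obtain k s t where k: "k \<in> I" "s \<in> tr j k" "t \<in> tr l k" using cospan[OF j(1) l(1)] by blast
    note m = tr_mem[OF j(1) k(1,2)] tr_mem[OF l(1) k(1,3)]
    have "\<pi> (j, w) = \<pi> (k, s w)" if "w \<in> carrier (N j)" for w
      using \<pi>_eq[of "(j, w)" "(k, s w)"] glue_tr[OF j(1) k(1) that k(2)] j k m(1)[OF that] that by simp
    moreover have "\<pi> (l, z) = \<pi> (k, t z)"
      using \<pi>_eq[of "(l, z)" "(k, t z)"] glue_tr[OF l(1) k(1) l(2) k(3)] l k m(2)[OF l(2)] by simp
    ultimately show ?thesis using j l k(1) m by metis
  qed
  have laws: "c \<oplus>\<^bsub>C\<^esub> d \<in> carrier C" "a \<odot>\<^bsub>C\<^esub> c \<in> carrier C" "\<zero>\<^bsub>C\<^esub> \<in> carrier C"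
      "\<exists>c'\<in>carrier C. c \<oplus>\<^bsub>C\<^esub> c' = \<zero>\<^bsub>C\<^esub>" "c \<oplus>\<^bsub>C\<^esub> d = d \<oplus>\<^bsub>C\<^esub> c" "c \<oplus>\<^bsub>C\<^esub> d \<oplus>\<^bsub>C\<^esub> e = c \<oplus>\<^bsub>C\<^esub> (d \<oplus>\<^bsub>C\<^esub> e)"
      "c \<oplus>\<^bsub>C\<^esub> \<zero>\<^bsub>C\<^esub> = c" "(a \<otimes>\<^bsub>R\<^esub> b) \<odot>\<^bsub>C\<^esub> c = a \<odot>\<^bsub>C\<^esub> (b \<odot>\<^bsub>C\<^esub> c)" "\<one>\<^bsub>R\<^esub> \<odot>\<^bsub>C\<^esub> c = c"
      "(a \<oplus>\<^bsub>R\<^esub> b) \<odot>\<^bsub>C\<^esub> c = a \<odot>\<^bsub>C\<^esub> c \<oplus>\<^bsub>C\<^esub> b \<odot>\<^bsub>C\<^esub> c" "a \<odot>\<^bsub>C\<^esub> (c \<oplus>\<^bsub>C\<^esub> d) = a \<odot>\<^bsub>C\<^esub> c \<oplus>\<^bsub>C\<^esub> a \<odot>\<^bsub>C\<^esub> d"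
    if ab: "a \<in> carrier R" "b \<in> carrier R" and cde: "c \<in> carrier C" "d \<in> carrier C" "e \<in> carrier C"
    for a b c d e
  proof -
    obtain k x y z where k: "k \<in> I" "x \<in> carrier (N k)" "y \<in> carrier (N k)" "z \<in> carrier (N k)"
        and c: "c = \<pi> (k, x)" "d = \<pi> (k, y)" "e = \<pi> (k, z)"
      using three[OF cde] by blast
    interpret N: module R "N k" using k(1) by (rule modN)
    note ops = k c ab add smult zero[OF k(1)] mem
    show "\<exists>c'\<in>carrier C. c \<oplus>\<^bsub>C\<^esub> c' = \<zero>\<^bsub>C\<^esub>"
      by (rule bexI[of _ "\<pi> (k, \<ominus>\<^bsub>N k\<^esub> x)"]) (simp_all add: ops N.r_neg)
    show "c \<oplus>\<^bsub>C\<^esub> d \<in> carrier C" "a \<odot>\<^bsub>C\<^esub> c \<in> carrier C" "\<zero>\<^bsub>C\<^esub> \<in> carrier C"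
      "c \<oplus>\<^bsub>C\<^esub> d = d \<oplus>\<^bsub>C\<^esub> c" "c \<oplus>\<^bsub>C\<^esub> d \<oplus>\<^bsub>C\<^esub> e = c \<oplus>\<^bsub>C\<^esub> (d \<oplus>\<^bsub>C\<^esub> e)"
      "c \<oplus>\<^bsub>C\<^esub> \<zero>\<^bsub>C\<^esub> = c" "(a \<otimes>\<^bsub>R\<^esub> b) \<odot>\<^bsub>C\<^esub> c = a \<odot>\<^bsub>C\<^esub> (b \<odot>\<^bsub>C\<^esub> c)" "\<one>\<^bsub>R\<^esub> \<odot>\<^bsub>C\<^esub> c = c"
      "(a \<oplus>\<^bsub>R\<^esub> b) \<odot>\<^bsub>C\<^esub> c = a \<odot>\<^bsub>C\<^esub> c \<oplus>\<^bsub>C\<^esub> b \<odot>\<^bsub>C\<^esub> c" "a \<odot>\<^bsub>C\<^esub> (c \<oplus>\<^bsub>C\<^esub> d) = a \<odot>\<^bsub>C\<^esub> c \<oplus>\<^bsub>C\<^esub> a \<odot>\<^bsub>C\<^esub> d"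
      by (simp_all add: ops N.a_ac N.smult_assoc1 N.smult_l_distr N.smult_r_distr)
  qed
  note laws1 = laws[OF R.one_closed R.one_closed]
  have "module R C"
  proof (rule module_criteria)
    show "cring R" by (rule R.is_cring)
    show "\<zero>\<^bsub>C\<^esub> \<in> carrier C" using zero[OF i0] mem[OF i0 N_zero[OF i0]] by simp
  qed (use laws1(1) in blast, use laws1(4) in blast, use laws(2) in blast, use laws1(5) in blast, use laws1(6) in blast,
      use laws1(7) in blast, use laws(8) in blast, use laws1(9) in blast, use laws(10) in blast, use laws(11) in blast)
  moreover have "small (carrier C)"
  proof (rule small_subset[OF enc(2)])
    show "carrier C \<subseteq> enc ` points" using rep(1) by (auto simp: C_def \<pi>_def)
  qed
  ultimately have "C \<in> obj Mods" by (simp add: mem_obj_MOD)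
  moreover have "(\<lambda>x. \<pi> (i, x)) \<in> module_hom R (N i) C" if "i \<in> I" for i
    by (rule module_homI) (use that mem add smult in auto)
  ultimately have "glues_to I N tr C (\<lambda>i x. \<pi> (i, x))"
    using one \<pi>_eq unfolding glues_to_def by (auto simp: Bex_def)
  then show ?thesis by (rule that)
qed

end

context module_universe
begin

definition glue_induced ::
  "'i set \<Rightarrow> ('i \<Rightarrow> ('a, 'n) module) \<Rightarrow> ('a, 'u) module \<Rightarrow> ('i \<Rightarrow> 'n \<Rightarrow> 'u) \<Rightarrow>
   ('a, 'u) module \<Rightarrow> ('i \<Rightarrow> 'n \<Rightarrow> 'u) \<Rightarrow> 'u \<Rightarrow> 'u" where
  "glue_induced I N C \<kappa> M g = (THE h. h \<in> arr Mods C M \<and> (\<forall>i\<in>I. \<forall>x\<in>carrier (N i). h (\<kappa> i x) = g i x))"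

lemma arr_eqI:
  assumes "f \<in> arr Mods A B" "g \<in> arr Mods A B'" "\<And>x. x \<in> carrier A \<Longrightarrow> f x = g x"
  shows "f = g"
  using assms by (auto simp: mem_arr_MOD intro: extensionalityI)

lemma glues_to_arr_eqI:
  assumes "glues_to I N tr C \<kappa>" "f \<in> arr Mods C M" "g \<in> arr Mods C M"
    and "\<And>i x. i \<in> I \<Longrightarrow> x \<in> carrier (N i) \<Longrightarrow> f (\<kappa> i x) = g (\<kappa> i x)"
  shows "f = g"
proof (rule arr_eqI[OF assms(2,3)])
  fix z assume "z \<in> carrier C"
  then obtain i x where "i \<in> I" "x \<in> carrier (N i)" "z = \<kappa> i x" by (rule glues_to_cases[OF assms(1)])
  then show "f z = g z" using assms(4) by simp
qed

end

lemma glued_tr: "\<lbrakk>i \<in> I; j \<in> I; x \<in> carrier (N i); t \<in> tr i j\<rbrakk> \<Longrightarrow> glued I N tr (i, x) (j, t x)"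
  by (rule r_into_equivclp) (auto simp: glue_step_def)

text \<open>
  The universal property. Values are well defined because one move preserves them; additivity
  follows since two elements have representatives at a common index.
\<close>

lemma (in sifted_diagram) glue_induced:
  assumes C: "glues_to I N tr C \<kappa>" and M: "M \<in> obj Mods"
    and g: "\<And>i. i \<in> I \<Longrightarrow> g i \<in> module_hom R (N i) M"
    and compat: "\<And>i j t x. \<lbrakk>i \<in> I; j \<in> I; t \<in> tr i j; x \<in> carrier (N i)\<rbrakk> \<Longrightarrow> g j (t x) = g i x"
  shows glue_induced_arr: "glue_induced I N C \<kappa> M g \<in> arr Mods C M"
    and glue_induced_eq: "\<lbrakk>i \<in> I; x \<in> carrier (N i)\<rbrakk> \<Longrightarrow> glue_induced I N C \<kappa> M g (\<kappa> i x) = g i x"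
proof -
  have glued_g: "g (fst p) (snd p) = g (fst q) (snd q)" if "p \<approx> q" for p q
    using that
  proof (induction rule: equivclp_induct)
    case (step y z)
    have "g (fst y) (snd y) = g (fst z) (snd z)" if "glue_step I N tr y z" for y z
      using that compat unfolding glue_step_def by auto
    with step show ?case by metis
  qed simp
  define h where "h z = (let p = (SOME p. p \<in> points \<and> z = \<kappa> (fst p) (snd p)) in g (fst p) (snd p))" for z
  have h: "h (\<kappa> i x) = g i x" if i: "i \<in> I" "x \<in> carrier (N i)" for i x
  proof -
    define p where "p = (SOME p. p \<in> points \<and> \<kappa> i x = \<kappa> (fst p) (snd p))"
    have p: "p \<in> points \<and> \<kappa> i x = \<kappa> (fst p) (snd p)"
      unfolding p_def by (rule someI[of _ "(i, x)"]) (simp add: i)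
    then have "(i, x) \<approx> p" using glues_to_eq_iff[OF C i(1) _ i(2), of "fst p" "snd p"] by auto
    from glued_g[OF this] show ?thesis by (simp add: h_def p_def[symmetric])
  qed
  have C': "module R C" using glues_to_obj[OF C] by (simp add: mem_obj_MOD)
  have two: "\<exists>k x y. k \<in> I \<and> x \<in> carrier (N k) \<and> y \<in> carrier (N k) \<and> c = \<kappa> k x \<and> d = \<kappa> k y"
    if c: "c \<in> carrier C" and d: "d \<in> carrier C" for c d
  proof -
    obtain i x where i: "i \<in> I" "x \<in> carrier (N i)" "c = \<kappa> i x" using C c by (rule glues_to_cases)
    obtain j y where j: "j \<in> I" "y \<in> carrier (N j)" "d = \<kappa> j y" using C d by (rule glues_to_cases)
    have p: "(i, x) \<in> points" "(j, y) \<in> points" using i j by auto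
    obtain k x' y' where k: "k \<in> I" "x' \<in> carrier (N k)" "y' \<in> carrier (N k)" "(i, x) \<approx> (k, x')" "(j, y) \<approx> (k, y')"
      using p by (rule common_index)
    have "c = \<kappa> k x'" "d = \<kappa> k y'"
      using glues_to_eq_iff[OF C i(1) k(1) i(2) k(2)] glues_to_eq_iff[OF C j(1) k(1) j(2) k(3)] i j k by auto
    with k show ?thesis by blast
  qed
  have "h \<in> module_hom R C M"
  proof (rule module_homI)
    fix c assume "c \<in> carrier C"
    then obtain i x where i: "i \<in> I" "x \<in> carrier (N i)" "c = \<kappa> i x" by (rule glues_to_cases[OF C])
    then show "h c \<in> carrier M" using h module_homD[OF g] by simp
  next
    fix c d assume "c \<in> carrier C" "d \<in> carrier C"
    then obtain k x y where k: "k \<in> I" "x \<in> carrier (N k)" "y \<in> carrier (N k)" "c = \<kappa> k x" "d = \<kappa> k y"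
      using two by blast
    interpret N: module R "N k" using k(1) by (rule modN)
    have "c \<oplus>\<^bsub>C\<^esub> d = \<kappa> k (x \<oplus>\<^bsub>N k\<^esub> y)"
      using k module_hom_add[OF glues_to_hom[OF C k(1)]] by simp
    then show "h (c \<oplus>\<^bsub>C\<^esub> d) = h c \<oplus>\<^bsub>M\<^esub> h d" using k h module_hom_add[OF g] by simp
  next
    fix a c assume a: "a \<in> carrier R" and c: "c \<in> carrier C"
    obtain i x where i: "i \<in> I" "x \<in> carrier (N i)" "c = \<kappa> i x" using C c by (rule glues_to_cases)
    interpret N: module R "N i" using i(1) by (rule modN)
    have "a \<odot>\<^bsub>C\<^esub> c = \<kappa> i (a \<odot>\<^bsub>N i\<^esub> x)"
      using a i module_hom_smult[OF glues_to_hom[OF C i(1)]] by simp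
    then show "h (a \<odot>\<^bsub>C\<^esub> c) = a \<odot>\<^bsub>M\<^esub> h c" using a i h module_hom_smult[OF g] by simp
  qed
  with C' have "restrict h (carrier C) \<in> arr Mods C M" by (rule restrict_arr)
  moreover have "\<forall>i\<in>I. \<forall>x\<in>carrier (N i). restrict h (carrier C) (\<kappa> i x) = g i x"
    using h module_homD[OF glues_to_hom[OF C]] by simp
  ultimately have "\<exists>!h. h \<in> arr Mods C M \<and> (\<forall>i\<in>I. \<forall>x\<in>carrier (N i). h (\<kappa> i x) = g i x)"
    using glues_to_arr_eqI[OF C] by (intro ex1I[of _ "restrict h (carrier C)"]) auto
  from theI'[OF this] show "glue_induced I N C \<kappa> M g \<in> arr Mods C M"
    "\<lbrakk>i \<in> I; x \<in> carrier (N i)\<rbrakk> \<Longrightarrow> glue_induced I N C \<kappa> M g (\<kappa> i x) = g i x"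
    unfolding glue_induced_def by blast+
qed


section \<open>Elements of filtered colimits\<close>

lemma functor_obj: "is_functor J (MOD small R) D \<Longrightarrow> i \<in> obj J \<Longrightarrow> fobj D i \<in> obj (MOD small R)"
  by (simp add: is_functor_def)

lemma functor_arr: "\<lbrakk>is_functor J (MOD small R) D; i \<in> obj J; j \<in> obj J; f \<in> arr J i j\<rbrakk>
    \<Longrightarrow> farr D i j f \<in> arr (MOD small R) (fobj D i) (fobj D j)"
  unfolding is_functor_def by blast

lemma functor_hom: "\<lbrakk>is_functor J (MOD small R) D; i \<in> obj J; j \<in> obj J; f \<in> arr J i j\<rbrakk>
    \<Longrightarrow> farr D i j f \<in> module_hom R (fobj D i) (fobj D j)"
  using functor_arr[of J small R D i j f] by (simp add: mem_arr_MOD)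

lemma functor_mem: "\<lbrakk>is_functor J (MOD small R) D; i \<in> obj J; j \<in> obj J; f \<in> arr J i j;
    x \<in> carrier (fobj D i)\<rbrakk> \<Longrightarrow> farr D i j f x \<in> carrier (fobj D j)"
  using module_homD[OF functor_hom] .

lemma functor_idt: "\<lbrakk>is_functor J (MOD small R) D; i \<in> obj J; x \<in> carrier (fobj D i)\<rbrakk>
    \<Longrightarrow> farr D i i (idt J i) x = x"
  by (simp add: is_functor_def idt_MOD)

lemma functor_cmp: "\<lbrakk>is_functor J (MOD small R) D; i \<in> obj J; j \<in> obj J; k \<in> obj J;
    f \<in> arr J i j; g \<in> arr J j k; x \<in> carrier (fobj D i)\<rbrakk>
    \<Longrightarrow> farr D i k (cmp J i j k g f) x = farr D j k g (farr D i j f x)"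
  by (simp add: is_functor_def cmp_MOD compose_eq)

lemma colimit_cocone: "is_colimit J C D L l \<Longrightarrow> is_cocone J C D L l"
  by (simp add: is_colimit_def)

lemma cocone_obj: "is_cocone J C D L l \<Longrightarrow> L \<in> obj C"
  by (simp add: is_cocone_def)

lemma cocone_arr: "is_cocone J C D L l \<Longrightarrow> i \<in> obj J \<Longrightarrow> l i \<in> arr C (fobj D i) L"
  by (simp add: is_cocone_def)

lemma cocone_comp: "\<lbrakk>is_cocone J (MOD small R) D L l; i \<in> obj J; j \<in> obj J; f \<in> arr J i j\<rbrakk>
    \<Longrightarrow> compose (carrier (fobj D i)) (l j) (farr D i j f) = l i"
  by (simp add: is_cocone_def cmp_MOD)

lemma cocone_apply: "\<lbrakk>is_cocone J (MOD small R) D L l; i \<in> obj J; j \<in> obj J; f \<in> arr J i j;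
    x \<in> carrier (fobj D i)\<rbrakk> \<Longrightarrow> l j (farr D i j f x) = l i x"
  using cocone_comp[of J small R D L l i j f] by (metis compose_eq)

locale filtered_diagram = module_universe small R
  for small :: "'u set \<Rightarrow> bool" and R :: "'a ring" +
  fixes J :: "('u, 'u) category" and D :: "('u, 'u, ('a, 'u) module, 'u \<Rightarrow> 'u) func"
  assumes small_J: "small_category small J" and filtered_J: "filtered J" and D: "is_functor J Mods D"
begin

abbreviation tran :: "'u \<Rightarrow> 'u \<Rightarrow> ('u \<Rightarrow> 'u) set" where "tran i j \<equiv> farr D i j ` arr J i j"

lemma category_J: "category J" using small_J by (simp add: small_category_def)

lemma cospan_J:
  assumes "i \<in> obj J" "j \<in> obj J"
  obtains k f g where "k \<in> obj J" "f \<in> arr J i k" "g \<in> arr J j k"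
  using filtered_J assms unfolding filtered_def by blast

lemma coequalize_J:
  assumes "i \<in> obj J" "j \<in> obj J" "f \<in> arr J i j" "g \<in> arr J i j"
  obtains k h where "k \<in> obj J" "h \<in> arr J j k"
    "\<And>x. x \<in> carrier (fobj D i) \<Longrightarrow> farr D j k h (farr D i j f x) = farr D j k h (farr D i j g x)"
proof -
  obtain k h where k: "k \<in> obj J" "h \<in> arr J j k" "cmp J i j k h f = cmp J i j k h g"
    using filtered_J assms unfolding filtered_def by blast
  have "farr D j k h (farr D i j f x) = farr D j k h (farr D i j g x)" if "x \<in> carrier (fobj D i)" for x
    using functor_cmp[OF D assms(1,2) k(1) assms(3) k(2) that]
      functor_cmp[OF D assms(1,2) k(1) assms(4) k(2) that] k(3) by simp
  with k(1,2) show ?thesis by (rule that)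
qed

text \<open>
  Two cospans \<open>i \<rightarrow> k \<leftarrow> j\<close> and \<open>i \<rightarrow> k' \<leftarrow> j\<close> can be compared after joining \<open>k\<close> and \<open>k'\<close> and
  coequalizing twice, once for the legs starting at \<open>i\<close> and once for those starting at \<open>j\<close>.
\<close>

lemma sifted: "sifted_diagram small R (obj J) (fobj D) tran"
proof (intro sifted_diagram.intro sifted_diagram_axioms.intro)
  show "module_universe small R" by (rule module_universe_axioms)
next
  fix i assume i: "i \<in> obj J"
  then show "module R (fobj D i)" using functor_obj[OF D] by (simp add: mem_obj_MOD)
  show "\<exists>t\<in>tran i i. \<forall>x\<in>carrier (fobj D i). t x = x"
    using category.idt_arr[OF category_J i] functor_idt[OF D i] by blast
next
  show "obj J \<noteq> {}" using filtered_J by (simp add: filtered_def)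
next
  fix i j t assume "i \<in> obj J" "j \<in> obj J" "t \<in> tran i j"
  then show "t \<in> module_hom R (fobj D i) (fobj D j)" using functor_hom[OF D] by blast
next
  fix i j k s t assume ijk: "i \<in> obj J" "j \<in> obj J" "k \<in> obj J" and "s \<in> tran i j" "t \<in> tran j k"
  then obtain f g where fg: "f \<in> arr J i j" "g \<in> arr J j k" "s = farr D i j f" "t = farr D j k g" by blast
  then show "\<exists>r\<in>tran i k. \<forall>x\<in>carrier (fobj D i). r x = t (s x)"
    using category.cmp_arr[OF category_J ijk fg(1,2)] functor_cmp[OF D ijk fg(1,2)] by blast
next
  fix i j assume "i \<in> obj J" "j \<in> obj J"
  then show "\<exists>k\<in>obj J. tran i k \<noteq> {} \<and> tran j k \<noteq> {}" by (metis cospan_J image_is_empty empty_iff)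
next
  fix i j k k' s t s' t' x y
  assume i: "i \<in> obj J" and j: "j \<in> obj J" and k: "k \<in> obj J" and k': "k' \<in> obj J"
    and "s \<in> tran i k" "t \<in> tran j k" "s' \<in> tran i k'" "t' \<in> tran j k'"
    and x: "x \<in> carrier (fobj D i)" and y: "y \<in> carrier (fobj D j)"
  then obtain f g f' g' where fg: "f \<in> arr J i k" "g \<in> arr J j k" "f' \<in> arr J i k'" "g' \<in> arr J j k'"
    and st: "s = farr D i k f" "t = farr D j k g" "s' = farr D i k' f'" "t' = farr D j k' g'" by blast
  obtain m a b where m: "m \<in> obj J" "a \<in> arr J k m" "b \<in> arr J k' m" using k k' by (rule cospan_J)
  note cmp = category.cmp_arr[OF category_J]
  note Dc = functor_cmp[OF D] and mem = functor_mem[OF D]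
  obtain n c where n: "n \<in> obj J" "c \<in> arr J m n"
    and c: "\<And>x. x \<in> carrier (fobj D i) \<Longrightarrow>
      farr D m n c (farr D i m (cmp J i k m a f) x) = farr D m n c (farr D i m (cmp J i k' m b f') x)"
    using i m(1) cmp[OF i k m(1) fg(1) m(2)] cmp[OF i k' m(1) fg(3) m(3)] by (rule coequalize_J) blast
  have cag: "cmp J j m n c (cmp J j k m a g) \<in> arr J j n" "cmp J j m n c (cmp J j k' m b g') \<in> arr J j n"
    using cmp[OF j m(1) n(1) cmp[OF j k m(1) fg(2) m(2)] n(2)]
      cmp[OF j m(1) n(1) cmp[OF j k' m(1) fg(4) m(3)] n(2)] .
  obtain r d where r: "r \<in> obj J" "d \<in> arr J n r"
    and d: "\<And>y. y \<in> carrier (fobj D j) \<Longrightarrow>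
      farr D n r d (farr D j n (cmp J j m n c (cmp J j k m a g)) y)
      = farr D n r d (farr D j n (cmp J j m n c (cmp J j k' m b g')) y)"
    using j n(1) cag by (rule coequalize_J) blast
  let ?A = "\<lambda>z. farr D n r d (farr D m n c (farr D k m a z))"
  let ?B = "\<lambda>z. farr D n r d (farr D m n c (farr D k' m b z))"
  have push: "glued (obj J) (fobj D) tran (l, z) (r, farr D n r d (farr D m n c (farr D l m e z)))"
    if l: "l \<in> obj J" "e \<in> arr J l m" "z \<in> carrier (fobj D l)" for l e z
  proof -
    note z1 = mem[OF l(1) m(1) l(2,3)] and z2 = mem[OF m(1) n(1,2) mem[OF l(1) m(1) l(2,3)]]
    have "glued (obj J) (fobj D) tran (l, z) (m, farr D l m e z)"
      using l m(1) by (intro glued_tr) auto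
    also have "glued (obj J) (fobj D) tran \<dots> (n, farr D m n c (farr D l m e z))"
      using m(1) n z1 by (intro glued_tr) auto
    also have "glued (obj J) (fobj D) tran \<dots> (r, farr D n r d (farr D m n c (farr D l m e z)))"
      using n r z2 by (intro glued_tr) auto
    finally (equivclp_trans) show ?thesis .
  qed
  have hom: "(\<lambda>z. farr D n r d (farr D m n c (farr D l m e z))) \<in> module_hom R (fobj D l) (fobj D r)"
    if "l \<in> obj J" "e \<in> arr J l m" for l e
    using module_hom_compose[OF module_hom_compose[OF functor_hom[OF D that(1) m(1) that(2)] functor_hom[OF D m(1) n]]
        functor_hom[OF D n(1) r]] .
  interpret Dk: module R "fobj D k" using functor_obj[OF D k] by (simp add: mem_obj_MOD)
  interpret Dk': module R "fobj D k'" using functor_obj[OF D k'] by (simp add: mem_obj_MOD)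
  have sx: "s x \<in> carrier (fobj D k)" "t y \<in> carrier (fobj D k)" "s' x \<in> carrier (fobj D k')" "t' y \<in> carrier (fobj D k')"
    unfolding st using mem i j k k' fg x y by auto
  have "?A (s x) = ?B (s' x)"
    using c[OF x] Dc[OF i k m(1) fg(1) m(2) x] Dc[OF i k' m(1) fg(3) m(3) x] st by simp
  moreover have "?A (t y) = ?B (t' y)"
    using d[OF y] Dc[OF j k m(1) fg(2) m(2) y] Dc[OF j k' m(1) fg(4) m(3) y] st
      Dc[OF j m(1) n(1) cmp[OF j k m(1) fg(2) m(2)] n(2) y]
      Dc[OF j m(1) n(1) cmp[OF j k' m(1) fg(4) m(3)] n(2) y] by simp
  ultimately have eq: "?A (s x \<oplus>\<^bsub>fobj D k\<^esub> t y) = ?B (s' x \<oplus>\<^bsub>fobj D k'\<^esub> t' y)"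
    using module_hom_add[OF hom[OF k m(2)] sx(1,2)] module_hom_add[OF hom[OF k' m(3)] sx(3,4)] by simp
  have "glued (obj J) (fobj D) tran (k, s x \<oplus>\<^bsub>fobj D k\<^esub> t y) (r, ?A (s x \<oplus>\<^bsub>fobj D k\<^esub> t y))"
    using k m(2) Dk.a_closed[OF sx(1,2)] by (rule push)
  also have "glued (obj J) (fobj D) tran \<dots> (k', s' x \<oplus>\<^bsub>fobj D k'\<^esub> t' y)"
    unfolding eq using k' m(3) Dk'.a_closed[OF sx(3,4)] by (intro equivclp_sym[OF push])
  finally (equivclp_trans) show "glued (obj J) (fobj D) tran (k, s x \<oplus>\<^bsub>fobj D k\<^esub> t y) (k', s' x \<oplus>\<^bsub>fobj D k'\<^esub> t' y)" .
next
  show "ess_small (SIGMA i:obj J. carrier (fobj D i))"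
    using small_J functor_obj[OF D]
    by (intro ess_small_Sigma) (auto simp: ess_small_iff_small small_category_def mem_obj_MOD)
qed

text \<open>
  Zigzags collapse to cospans: a move against the direction of the zigzag is absorbed by composition,
  and for a move along it the resulting span is completed to a square by joining and coequalizing.
\<close>

lemma glued_eventually_eq:
  assumes "glued (obj J) (fobj D) tran p q" and p: "fst p \<in> obj J" "snd p \<in> carrier (fobj D (fst p))"
  shows "fst q \<in> obj J \<and> snd q \<in> carrier (fobj D (fst q)) \<and>
    (\<exists>k \<in> obj J. \<exists>f \<in> arr J (fst p) k. \<exists>g \<in> arr J (fst q) k.
      farr D (fst p) k f (snd p) = farr D (fst q) k g (snd q))"
  using assms(1)
proof (induction rule: equivclp_induct)
  case base
  show ?case using p category.idt_arr[OF category_J p(1)] by blast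
next
  case (step y z)
  note cmp = category.cmp_arr[OF category_J] and Dc = functor_cmp[OF D] and mem = functor_mem[OF D]
  obtain k f g where y: "fst y \<in> obj J" "snd y \<in> carrier (fobj D (fst y))"
    and k: "k \<in> obj J" "f \<in> arr J (fst p) k" "g \<in> arr J (fst y) k"
    and eq: "farr D (fst p) k f (snd p) = farr D (fst y) k g (snd y)" using step.IH by blast
  from step.hyps(2) show ?case
  proof
    assume "glue_step (obj J) (fobj D) tran y z"
    then obtain u where z: "fst z \<in> obj J" and u: "u \<in> arr J (fst y) (fst z)"
      and zu: "snd z = farr D (fst y) (fst z) u (snd y)" unfolding glue_step_def by blast
    have z': "snd z \<in> carrier (fobj D (fst z))" unfolding zu using mem[OF y(1) z u y(2)] .
    obtain m a b where m: "m \<in> obj J" "a \<in> arr J k m" "b \<in> arr J (fst z) m" using k(1) z by (rule cospan_J)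
    obtain n c where n: "n \<in> obj J" "c \<in> arr J m n"
      and c: "\<And>x. x \<in> carrier (fobj D (fst y)) \<Longrightarrow>
        farr D m n c (farr D (fst y) m (cmp J (fst y) k m a g) x)
        = farr D m n c (farr D (fst y) m (cmp J (fst y) (fst z) m b u) x)"
      using y(1) m(1) cmp[OF y(1) k(1) m(1) k(3) m(2)] cmp[OF y(1) z m(1) u m(3)] by (rule coequalize_J) blast
    let ?f = "cmp J (fst p) m n c (cmp J (fst p) k m a f)" and ?g = "cmp J (fst z) m n c b"
    note af = cmp[OF p(1) k(1) m(1) k(2) m(2)]
    have "?f \<in> arr J (fst p) n" "?g \<in> arr J (fst z) n"
      using cmp[OF p(1) m(1) n(1) af n(2)] cmp[OF z m(1) n(1) m(3) n(2)] .
    moreover have "farr D (fst p) n ?f (snd p) = farr D (fst z) n ?g (snd z)"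
      using Dc[OF p(1) m(1) n(1) af n(2) p(2)] Dc[OF p(1) k(1) m(1) k(2) m(2) p(2)] eq c[OF y(2)]
        Dc[OF y(1) k(1) m(1) k(3) m(2) y(2)] Dc[OF y(1) z m(1) u m(3) y(2)] zu
        Dc[OF z m(1) n(1) m(3) n(2) z'] by simp
    ultimately show ?thesis using z z' n(1) by blast
  next
    assume "glue_step (obj J) (fobj D) tran z y"
    then obtain u where z: "fst z \<in> obj J" "snd z \<in> carrier (fobj D (fst z))"
      and u: "u \<in> arr J (fst z) (fst y)" and yu: "snd y = farr D (fst z) (fst y) u (snd z)"
      unfolding glue_step_def by blast
    have "cmp J (fst z) (fst y) k g u \<in> arr J (fst z) k" using cmp[OF z(1) y(1) k(1) u k(3)] .
    moreover have "farr D (fst p) k f (snd p) = farr D (fst z) k (cmp J (fst z) (fst y) k g u) (snd z)"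
      using eq yu Dc[OF z(1) y(1) k(1) u k(3) z(2)] by simp
    ultimately show ?thesis using z k by blast
  qed
qed

text \<open>
  Only the universal property of \<open>L\<close> is given. The glued module \<open>C\<close> is a cocone too, which yields
  \<open>h : L \<rightarrow> C\<close> with \<open>h \<circ> l i = \<kappa> i\<close>, so elements that become equal in \<open>L\<close> are glued. The induced map
  \<open>g : C \<rightarrow> L\<close> satisfies \<open>g \<circ> h = 1\<close> by uniqueness, so every element of \<open>L\<close> comes from a stage.
\<close>

lemma colimit_elements:
  assumes L: "is_colimit J Mods D L l"
  shows colimit_cases: "y \<in> carrier L \<Longrightarrow> \<exists>i \<in> obj J. \<exists>x \<in> carrier (fobj D i). y = l i x"
    and colimit_eqD: "\<lbrakk>i \<in> obj J; j \<in> obj J; x \<in> carrier (fobj D i); y \<in> carrier (fobj D j); l i x = l j y\<rbrakk>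
      \<Longrightarrow> \<exists>k \<in> obj J. \<exists>f \<in> arr J i k. \<exists>g \<in> arr J j k. farr D i k f x = farr D j k g y"
proof -
  interpret S: sifted_diagram small R "obj J" "fobj D" tran by (rule sifted)
  obtain C \<kappa> where C: "glues_to (obj J) (fobj D) tran C \<kappa>" by (rule S.colimit_exists)
  note coc = colimit_cocone[OF L]
  note Lobj = cocone_obj[OF coc] and l = cocone_arr[OF coc] and l_tr = cocone_apply[OF coc]
  let ?k = "\<lambda>i. restrict (\<kappa> i) (carrier (fobj D i))"
  have "is_cocone J Mods D C ?k"
    unfolding is_cocone_def cmp_MOD
  proof (intro conjI ballI)
    show "C \<in> obj Mods" by (rule glues_to_obj[OF C])
    show "?k i \<in> arr Mods (fobj D i) C" if "i \<in> obj J" for i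
      using S.modN[OF that] glues_to_hom[OF C that] by (rule restrict_arr)
    fix i j f assume i: "i \<in> obj J" and j: "j \<in> obj J" and f: "f \<in> arr J i j"
    have "\<kappa> j (farr D i j f x) = \<kappa> i x" if x: "x \<in> carrier (fobj D i)" for x
      using glues_to_eq_iff[OF C i j x functor_mem[OF D i j f x]]
        glued_tr[where N = "fobj D" and tr = tran and t = "farr D i j f", OF i j x] f
      by (simp add: equivclp_sym)
    then show "compose (carrier (fobj D i)) (?k j) (farr D i j f) = ?k i"
      using functor_mem[OF D i j f] by (auto simp: compose_def fun_eq_iff)
  qed
  then obtain h where h: "h \<in> arr Mods L C" "\<forall>i\<in>obj J. compose (carrier (fobj D i)) h (l i) = ?k i"
    using L unfolding is_colimit_def cmp_MOD by blast
  have hl: "h (l i x) = \<kappa> i x" if "i \<in> obj J" "x \<in> carrier (fobj D i)" for i x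
    using fun_cong[OF h(2)[rule_format, OF that(1)], of x] that(2) by (simp add: compose_eq)
  let ?g = "glue_induced (obj J) (fobj D) C \<kappa> L l"
  have l_hom: "l i \<in> module_hom R (fobj D i) L" if "i \<in> obj J" for i
    using l[OF that] by (simp add: mem_arr_MOD)
  have l_tr': "l j (t x) = l i x"
    if "i \<in> obj J" "j \<in> obj J" "t \<in> tran i j" "x \<in> carrier (fobj D i)" for i j t x
    using that l_tr by auto
  have g1: "?g \<in> arr Mods C L"
    by (rule S.glue_induced_arr[OF C Lobj]) (simp_all add: l_hom l_tr')
  have g2: "?g (\<kappa> i x) = l i x" if "i \<in> obj J" "x \<in> carrier (fobj D i)" for i x
    by (rule S.glue_induced_eq[OF C Lobj]) (simp_all add: l_hom l_tr' that)
  note catM = category_MOD[of small R]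
  have gh: "cmp Mods L C L ?g h \<in> arr Mods L L"
    using category.cmp_arr[OF catM Lobj glues_to_obj[OF C] Lobj h(1) g1] .
  have id: "idt Mods L \<in> arr Mods L L" using category.idt_arr[OF catM Lobj] .
  have l_mem: "l i x \<in> carrier L" if "i \<in> obj J" "x \<in> carrier (fobj D i)" for i x
    using module_homD[OF l_hom[OF that(1)] that(2)] .
  have l_comp: "compose (carrier (fobj D i)) k (l i) = l i"
    if i: "i \<in> obj J" and k: "\<And>x. x \<in> carrier (fobj D i) \<Longrightarrow> k (l i x) = l i x" for k i
    using k l[OF i] by (auto simp: compose_def fun_eq_iff mem_arr_MOD extensional_def)
  have gh_l: "\<forall>i\<in>obj J. compose (carrier (fobj D i)) (cmp Mods L C L ?g h) (l i) = l i"
    by (intro ballI l_comp) (auto simp: cmp_MOD compose_eq l_mem hl g2)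
  have id_l: "\<forall>i\<in>obj J. compose (carrier (fobj D i)) (idt Mods L) (l i) = l i"
    by (intro ballI l_comp) (auto simp: idt_MOD l_mem)
  have "\<exists>!k. k \<in> arr Mods L L \<and> (\<forall>i\<in>obj J. compose (carrier (fobj D i)) k (l i) = l i)"
    using L coc unfolding is_colimit_def cmp_MOD by blast
  then have gh_id: "cmp Mods L C L ?g h = idt Mods L" using gh gh_l id id_l by blast
  show "\<exists>i \<in> obj J. \<exists>x \<in> carrier (fobj D i). y = l i x" if y: "y \<in> carrier L"
  proof -
    have hy: "h y \<in> carrier C" using h(1) y module_homD[of h R L C] by (simp add: mem_arr_MOD)
    obtain i x where i: "i \<in> obj J" "x \<in> carrier (fobj D i)" "h y = \<kappa> i x"
      using C hy by (rule glues_to_cases)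
    have "y = ?g (h y)" using fun_cong[OF gh_id, of y] y by (simp add: cmp_MOD idt_MOD compose_eq)
    then show ?thesis using i g2 by auto
  qed
  show "\<exists>k \<in> obj J. \<exists>f \<in> arr J i k. \<exists>g \<in> arr J j k. farr D i k f x = farr D j k g y"
    if i: "i \<in> obj J" "j \<in> obj J" "x \<in> carrier (fobj D i)" "y \<in> carrier (fobj D j)" and eq: "l i x = l j y"
  proof -
    have "\<kappa> i x = \<kappa> j y" using hl i eq by metis
    then have "glued (obj J) (fobj D) tran (i, x) (j, y)" using glues_to_eq_iff[OF C i] by simp
    from glued_eventually_eq[OF this] i show ?thesis by simp
  qed
qed

end

section \<open>Standard free modules of finite rank\<close>

context module_universe
begin

lemma arr_mem: "f \<in> arr Mods A B \<Longrightarrow> x \<in> carrier A \<Longrightarrow> f x \<in> carrier B"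
  using module_homD by (auto simp: mem_arr_MOD)

lemma arr_hom: "f \<in> arr Mods A B \<Longrightarrow> f \<in> module_hom R A B"
  by (simp add: mem_arr_MOD)

lemma obj_module: "A \<in> obj Mods \<Longrightarrow> module R A"
  by (simp add: mem_obj_MOD)

lemma comp_arr:
  assumes "A \<in> obj Mods" "f \<in> arr Mods A B" "g \<in> arr Mods B C"
  shows "compose (carrier A) g f \<in> arr Mods A C"
  using restrict_arr[OF obj_module[OF assms(1)] module_hom_compose[OF arr_hom[OF assms(2)] arr_hom[OF assms(3)]]]
  by (simp add: compose_def)

lemma comp_assoc:
  assumes "f \<in> arr Mods A B"
  shows "compose (carrier A) h (compose (carrier A) g f) = compose (carrier A) (compose (carrier B) h g) f"
  using arr_mem[OF assms] by (intro compose_assoc) auto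

definition std :: "nat \<Rightarrow> ('a, 'u) module" where "std n = free_obj {..<n}"

definition gen :: "nat \<Rightarrow> nat \<Rightarrow> 'u" where "gen n = free_gen {..<n}"

lemma std_free: "free_on {..<n} (std n) (gen n)"
  unfolding std_def gen_def using ess_small_nat by (rule free_on_free_obj)

lemma std_Fmods: "std n \<in> obj Fmods"
  using std_free by (rule free_on_Fmod) simp

lemma std_obj: "std n \<in> obj Mods"
  using std_free by (rule free_on_obj)

lemma gen_mem: "i < n \<Longrightarrow> gen n i \<in> carrier (std n)"
  using free_on_mem[OF std_free] by simp

definition std_ext :: "nat \<Rightarrow> ('a, 'u) module \<Rightarrow> (nat \<Rightarrow> 'u) \<Rightarrow> 'u \<Rightarrow> 'u" where
  "std_ext n M g = free_ext {..<n} (std n) (gen n) M g"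

lemma std_ext:
  assumes "M \<in> obj Mods" "\<And>i. i < n \<Longrightarrow> g i \<in> carrier M"
  shows std_ext_arr: "std_ext n M g \<in> arr Mods (std n) M"
    and std_ext_gen: "i < n \<Longrightarrow> std_ext n M g (gen n i) = g i"
  using free_ext_arr[OF std_free assms(1), of n g] free_ext_eq[OF std_free assms(1), of n g i] assms(2)
  by (auto simp: std_ext_def)

lemma std_arr_eqI:
  assumes "M \<in> obj Mods" "f \<in> arr Mods (std n) M" "g \<in> arr Mods (std n) M"
    and "\<And>i. i < n \<Longrightarrow> f (gen n i) = g (gen n i)"
  shows "f = g"
  using free_on_arr_eqI[OF std_free assms(1-3)] assms(4) by simp

definition inl :: "nat \<Rightarrow> nat \<Rightarrow> 'u \<Rightarrow> 'u" where
  "inl n m = std_ext n (std (n + m)) (gen (n + m))"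

definition inr :: "nat \<Rightarrow> nat \<Rightarrow> 'u \<Rightarrow> 'u" where
  "inr n m = std_ext m (std (n + m)) (\<lambda>i. gen (n + m) (n + i))"

definition copair :: "nat \<Rightarrow> nat \<Rightarrow> ('a, 'u) module \<Rightarrow> ('u \<Rightarrow> 'u) \<Rightarrow> ('u \<Rightarrow> 'u) \<Rightarrow> 'u \<Rightarrow> 'u" where
  "copair n m M v w = std_ext (n + m) M (\<lambda>i. if i < n then v (gen n i) else w (gen m (i - n)))"

lemma inl_arr: "inl n m \<in> arr Mods (std n) (std (n + m))"
  unfolding inl_def by (intro std_ext_arr std_obj gen_mem) simp

lemma inl_gen: "i < n \<Longrightarrow> inl n m (gen n i) = gen (n + m) i"
  unfolding inl_def by (intro std_ext_gen std_obj gen_mem) simp_all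

lemma inr_arr: "inr n m \<in> arr Mods (std m) (std (n + m))"
  unfolding inr_def by (intro std_ext_arr std_obj gen_mem) simp

lemma inr_gen: "i < m \<Longrightarrow> inr n m (gen m i) = gen (n + m) (n + i)"
  unfolding inr_def by (intro std_ext_gen std_obj gen_mem) simp_all

text \<open>
  The standard free module of rank \<open>n + m\<close> is a coproduct of those of rank \<open>n\<close> and \<open>m\<close>.
\<close>

lemma copair_unique:
  assumes M: "M \<in> obj Mods" and f: "f \<in> arr Mods (std (n + m)) M" and g: "g \<in> arr Mods (std (n + m)) M"
    and eq: "compose (carrier (std n)) f (inl n m) = compose (carrier (std n)) g (inl n m)"
      "compose (carrier (std m)) f (inr n m) = compose (carrier (std m)) g (inr n m)"
  shows "f = g"
proof (rule std_arr_eqI[OF M f g])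
  fix i assume i: "i < n + m"
  show "f (gen (n + m) i) = g (gen (n + m) i)"
  proof (cases "i < n")
    case True
    then show ?thesis using fun_cong[OF eq(1), of "gen n i"] by (simp add: compose_eq gen_mem inl_gen)
  next
    case False
    then obtain j where "i = n + j" "j < m" using i by (metis add_less_cancel_left le_add_diff_inverse not_less)
    then show ?thesis using fun_cong[OF eq(2), of "gen m j"] by (simp add: compose_eq gen_mem inr_gen)
  qed
qed

lemma copair:
  assumes M: "M \<in> obj Mods" and v: "v \<in> arr Mods (std n) M" and w: "w \<in> arr Mods (std m) M"
  shows copair_arr: "copair n m M v w \<in> arr Mods (std (n + m)) M"
    and copair_inl: "compose (carrier (std n)) (copair n m M v w) (inl n m) = v"
    and copair_inr: "compose (carrier (std m)) (copair n m M v w) (inr n m) = w"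
proof -
  have mem: "(if i < n then v (gen n i) else w (gen m (i - n))) \<in> carrier M" if "i < n + m" for i
    using that arr_mem[OF v gen_mem[of i n]] arr_mem[OF w gen_mem[of "i - n" m]] by simp
  show arr: "copair n m M v w \<in> arr Mods (std (n + m)) M"
    unfolding copair_def using M mem by (rule std_ext_arr)
  have gen: "copair n m M v w (gen (n + m) i) = (if i < n then v (gen n i) else w (gen m (i - n)))"
    if "i < n + m" for i
    unfolding copair_def using M mem that by (rule std_ext_gen)
  show "compose (carrier (std n)) (copair n m M v w) (inl n m) = v"
    by (rule std_arr_eqI[OF M comp_arr[OF std_obj inl_arr arr] v])
      (simp add: compose_eq gen_mem inl_gen gen)
  show "compose (carrier (std m)) (copair n m M v w) (inr n m) = w"
    by (rule std_arr_eqI[OF M comp_arr[OF std_obj inr_arr arr] w])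
      (simp add: compose_eq gen_mem inr_gen gen)
qed

lemma ess_small_arr_std:
  assumes M: "M \<in> obj Mods" shows "ess_small (arr Mods (std n) M)"
proof -
  have "arr Mods (std n) M \<subseteq> (\<lambda>l. std_ext n M (\<lambda>i. l ! i)) ` lists (carrier M)"
  proof
    fix f assume f: "f \<in> arr Mods (std n) M"
    let ?l = "map (\<lambda>i. f (gen n i)) [0..<n]"
    have mem: "?l ! i \<in> carrier M" if "i < n" for i using that arr_mem[OF f gen_mem] by simp
    have "f = std_ext n M (\<lambda>i. ?l ! i)"
      by (rule std_arr_eqI[OF M f std_ext_arr[OF M mem]]) (simp_all add: std_ext_gen[OF M mem])
    moreover have "?l \<in> lists (carrier M)" using arr_mem[OF f gen_mem] by auto
    ultimately show "f \<in> (\<lambda>l. std_ext n M (\<lambda>i. l ! i)) ` lists (carrier M)" by blast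
  qed
  moreover have "ess_small (lists (carrier M))"
    using M by (intro ess_small_lists) (simp add: ess_small_iff_small mem_obj_MOD)
  ultimately show ?thesis using ess_small_image ess_small_subset by blast
qed

end


section \<open>The left Kan extension\<close>

locale functor_on_free = module_universe small R
  for small :: "'u set \<Rightarrow> bool" and R :: "'a ring" +
  fixes F :: "(('a, 'u) module, 'u \<Rightarrow> 'u, ('a, 'u) module, 'u \<Rightarrow> 'u) func"
  assumes F: "is_functor Fmods Mods F"
begin

abbreviation FS :: "nat \<Rightarrow> ('a, 'u) module" where "FS n \<equiv> fobj F (std n)"

abbreviation FA :: "nat \<Rightarrow> nat \<Rightarrow> ('u \<Rightarrow> 'u) \<Rightarrow> 'u \<Rightarrow> 'u" where "FA n m \<phi> \<equiv> farr F (std n) (std m) \<phi>"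

lemma F_obj: "A \<in> obj Fmods \<Longrightarrow> fobj F A \<in> obj Mods"
  using functor_obj[OF F] .

lemma F_arr: "\<lbrakk>A \<in> obj Fmods; B \<in> obj Fmods; f \<in> arr Mods A B\<rbrakk> \<Longrightarrow> farr F A B f \<in> arr Mods (fobj F A) (fobj F B)"
  using functor_arr[OF F] by (simp add: arr_FMOD)

lemma F_cmp: "\<lbrakk>A \<in> obj Fmods; B \<in> obj Fmods; C \<in> obj Fmods; f \<in> arr Mods A B; g \<in> arr Mods B C;
    x \<in> carrier (fobj F A)\<rbrakk> \<Longrightarrow> farr F A C (compose (carrier A) g f) x = farr F B C g (farr F A B f x)"
  using functor_cmp[OF F, of A B C f g x] by (simp add: arr_FMOD cmp_FMOD cmp_MOD)

lemma F_idt: "\<lbrakk>A \<in> obj Fmods; x \<in> carrier (fobj F A)\<rbrakk> \<Longrightarrow> farr F A A (restrict (\<lambda>x. x) (carrier A)) x = x"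
  using functor_idt[OF F, of A x] by (simp add: idt_FMOD idt_MOD)

lemma FA_hom: "\<phi> \<in> arr Mods (std n) (std m) \<Longrightarrow> FA n m \<phi> \<in> module_hom R (FS n) (FS m)"
  using arr_hom[OF F_arr[OF std_Fmods std_Fmods]] .

lemma FA_mem: "\<phi> \<in> arr Mods (std n) (std m) \<Longrightarrow> x \<in> carrier (FS n) \<Longrightarrow> FA n m \<phi> x \<in> carrier (FS m)"
  using module_homD[OF FA_hom] .

lemmas FA_cmp = F_cmp[OF std_Fmods std_Fmods std_Fmods]

definition over :: "('a, 'u) module \<Rightarrow> (nat \<times> ('u \<Rightarrow> 'u)) set" where
  "over M = (SIGMA n:UNIV. arr Mods (std n) M)"

definition fib :: "nat \<times> ('u \<Rightarrow> 'u) \<Rightarrow> ('a, 'u) module" where "fib p = FS (fst p)"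

text \<open>
  The values of \<open>F\<close> on the morphisms between two objects over the same module.
\<close>

definition moves :: "nat \<times> ('u \<Rightarrow> 'u) \<Rightarrow> nat \<times> ('u \<Rightarrow> 'u) \<Rightarrow> ('u \<Rightarrow> 'u) set" where
  "moves p q = FA (fst p) (fst q) `
    {\<phi> \<in> arr Mods (std (fst p)) (std (fst q)). compose (carrier (std (fst p))) (snd q) \<phi> = snd p}"

lemma mem_over: "p \<in> over M \<longleftrightarrow> snd p \<in> arr Mods (std (fst p)) M"
  by (cases p) (auto simp: over_def)

text \<open>
  Every cospan of objects over \<open>M\<close> factors through the coproduct, and \<open>F\<close> maps the comparison
  homomorphism to an additive map. Hence the sum computed in any cospan is glued to the sum
  computed in the coproduct.
\<close>

lemma glued_through_coproduct:
  assumes M: "M \<in> obj Mods" and z: "z \<in> arr Mods (std k) M"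
    and \<phi>: "\<phi> \<in> arr Mods (std n) (std k)" and \<psi>: "\<psi> \<in> arr Mods (std m) (std k)"
    and x: "x \<in> carrier (FS n)" and y: "y \<in> carrier (FS m)"
  defines "v \<equiv> compose (carrier (std n)) z \<phi>" and "w \<equiv> compose (carrier (std m)) z \<psi>"
  shows "glued (over M) fib moves
    ((n + m, copair n m M v w), FA n (n + m) (inl n m) x \<oplus>\<^bsub>FS (n + m)\<^esub> FA m (n + m) (inr n m) y)
    ((k, z), FA n k \<phi> x \<oplus>\<^bsub>FS k\<^esub> FA m k \<psi> y)"
proof -
  let ?\<theta> = "copair n m (std k) \<phi> \<psi>"
  have v: "v \<in> arr Mods (std n) M" and w: "w \<in> arr Mods (std m) M"
    unfolding v_def w_def using comp_arr[OF std_obj _ z] \<phi> \<psi> by auto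
  note \<theta> = copair_arr[OF std_obj \<phi> \<psi>]
  have "compose (carrier (std (n + m))) z ?\<theta> = copair n m M v w"
  proof (rule copair_unique[OF M comp_arr[OF std_obj \<theta> z] copair_arr[OF M v w]])
    show "compose (carrier (std n)) (compose (carrier (std (n + m))) z ?\<theta>) (inl n m)
        = compose (carrier (std n)) (copair n m M v w) (inl n m)"
      by (simp only: comp_assoc[OF inl_arr, symmetric] copair_inl[OF M v w] copair_inl[OF std_obj \<phi> \<psi>])
        (simp only: v_def)
    show "compose (carrier (std m)) (compose (carrier (std (n + m))) z ?\<theta>) (inr n m)
        = compose (carrier (std m)) (copair n m M v w) (inr n m)"
      by (simp only: comp_assoc[OF inr_arr, symmetric] copair_inr[OF M v w] copair_inr[OF std_obj \<phi> \<psi>])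
        (simp only: w_def)
  qed
  then have tr: "FA (n + m) k ?\<theta> \<in> moves (n + m, copair n m M v w) (k, z)"
    using \<theta> by (auto simp: moves_def)
  have mem: "FA n (n + m) (inl n m) x \<in> carrier (FS (n + m))" "FA m (n + m) (inr n m) y \<in> carrier (FS (n + m))"
    using FA_mem inl_arr inr_arr x y by auto
  interpret FS: module R "FS (n + m)" using F_obj[OF std_Fmods] by (rule obj_module)
  have "FA (n + m) k ?\<theta> (FA n (n + m) (inl n m) x \<oplus>\<^bsub>FS (n + m)\<^esub> FA m (n + m) (inr n m) y)
      = FA n k \<phi> x \<oplus>\<^bsub>FS k\<^esub> FA m k \<psi> y"
    using module_hom_add[OF FA_hom[OF \<theta>] mem] FA_cmp[OF inl_arr \<theta> x] FA_cmp[OF inr_arr \<theta> y]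
    by (simp add: copair_inl[OF std_obj \<phi> \<psi>] copair_inr[OF std_obj \<phi> \<psi>])
  moreover have "glued (over M) fib moves
      ((n + m, copair n m M v w), FA n (n + m) (inl n m) x \<oplus>\<^bsub>FS (n + m)\<^esub> FA m (n + m) (inr n m) y)
      ((k, z), FA (n + m) k ?\<theta> (FA n (n + m) (inl n m) x \<oplus>\<^bsub>FS (n + m)\<^esub> FA m (n + m) (inr n m) y))"
    using tr mem copair_arr[OF M v w] z by (intro glued_tr) (auto simp: mem_over fib_def)
  ultimately show ?thesis by simp
qed

lemma sifted_over:
  assumes M: "M \<in> obj Mods"
  shows "sifted_diagram small R (over M) fib moves"
proof (intro sifted_diagram.intro sifted_diagram_axioms.intro)
  show "module_universe small R" by (rule module_universe_axioms)
next
  fix p assume p: "p \<in> over M"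
  show "module R (fib p)" unfolding fib_def using F_obj[OF std_Fmods] by (rule obj_module)
  have id: "restrict (\<lambda>x. x) (carrier (std (fst p))) \<in> arr Mods (std (fst p)) (std (fst p))"
    using category.idt_arr[OF category_MOD std_obj] by (simp add: idt_MOD)
  have "compose (carrier (std (fst p))) (snd p) (restrict (\<lambda>x. x) (carrier (std (fst p)))) = snd p"
    using category.cmp_idt_right[OF category_MOD std_obj M, of "snd p" "fst p"] p
    by (simp add: idt_MOD cmp_MOD mem_over)
  then show "\<exists>t\<in>moves p p. \<forall>x\<in>carrier (fib p). t x = x"
    using id F_idt[OF std_Fmods] by (auto simp: moves_def fib_def)
next
  have "(0, std_ext 0 M (\<lambda>_. undefined)) \<in> over M" using std_ext_arr[OF M, of 0] by (simp add: mem_over)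
  then show "over M \<noteq> {}" by blast
next
  fix p q t assume "t \<in> moves p q"
  then show "t \<in> module_hom R (fib p) (fib q)" using FA_hom by (auto simp: moves_def fib_def)
next
  fix p q r s t assume "s \<in> moves p q" "t \<in> moves q r"
  then obtain \<phi> \<psi> where \<phi>: "\<phi> \<in> arr Mods (std (fst p)) (std (fst q))" "\<psi> \<in> arr Mods (std (fst q)) (std (fst r))"
    and eq: "compose (carrier (std (fst p))) (snd q) \<phi> = snd p" "compose (carrier (std (fst q))) (snd r) \<psi> = snd q"
    and st: "s = FA (fst p) (fst q) \<phi>" "t = FA (fst q) (fst r) \<psi>" by (auto simp: moves_def)
  let ?\<chi> = "compose (carrier (std (fst p))) \<psi> \<phi>"
  have "?\<chi> \<in> arr Mods (std (fst p)) (std (fst r))" using std_obj \<phi> by (rule comp_arr)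
  moreover have "compose (carrier (std (fst p))) (snd r) ?\<chi> = snd p"
    using comp_assoc[OF \<phi>(1), of "snd r" \<psi>] eq by simp
  ultimately show "\<exists>w\<in>moves p r. \<forall>x\<in>carrier (fib p). w x = t (s x)"
    using FA_cmp[OF \<phi>] by (auto simp: moves_def fib_def st)
next
  fix p q assume p: "p \<in> over M" and q: "q \<in> over M"
  let ?k = "(fst p + fst q, copair (fst p) (fst q) M (snd p) (snd q))"
  note v = p[unfolded mem_over] and w = q[unfolded mem_over]
  have "?k \<in> over M" using copair_arr[OF M v w] by (simp add: mem_over)
  moreover have "moves p ?k \<noteq> {}" using inl_arr copair_inl[OF M v w] by (auto simp: moves_def)
  moreover have "moves q ?k \<noteq> {}" using inr_arr copair_inr[OF M v w] by (auto simp: moves_def)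
  ultimately show "\<exists>k\<in>over M. moves p k \<noteq> {} \<and> moves q k \<noteq> {}" by blast
next
  fix p q k k' s t s' t' x y
  assume p: "p \<in> over M" and q: "q \<in> over M" and k: "k \<in> over M" and k': "k' \<in> over M"
    and s: "s \<in> moves p k" "t \<in> moves q k" "s' \<in> moves p k'" "t' \<in> moves q k'"
    and x: "x \<in> carrier (fib p)" and y: "y \<in> carrier (fib q)"
  let ?n = "fst p" and ?m = "fst q"
  let ?e = "((?n + ?m, copair ?n ?m M (snd p) (snd q)),
    FA ?n (?n + ?m) (inl ?n ?m) x \<oplus>\<^bsub>FS (?n + ?m)\<^esub> FA ?m (?n + ?m) (inr ?n ?m) y)"
  have *: "glued (over M) fib moves ?e (k, s x \<oplus>\<^bsub>fib k\<^esub> t y)"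
    if k: "k \<in> over M" and s: "s \<in> moves p k" and t: "t \<in> moves q k" for k s t
  proof -
    obtain \<phi> where \<phi>: "\<phi> \<in> arr Mods (std ?n) (std (fst k))" "compose (carrier (std ?n)) (snd k) \<phi> = snd p"
      "s = FA ?n (fst k) \<phi>" using s by (auto simp: moves_def)
    obtain \<psi> where \<psi>: "\<psi> \<in> arr Mods (std ?m) (std (fst k))" "compose (carrier (std ?m)) (snd k) \<psi> = snd q"
      "t = FA ?m (fst k) \<psi>" using t by (auto simp: moves_def)
    show ?thesis
      using glued_through_coproduct[OF M k[unfolded mem_over] \<phi>(1) \<psi>(1), of x y] x y
      by (simp add: \<phi>(2,3) \<psi>(2,3) fib_def)
  qed
  show "glued (over M) fib moves (k, s x \<oplus>\<^bsub>fib k\<^esub> t y) (k', s' x \<oplus>\<^bsub>fib k'\<^esub> t' y)"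
    using *[OF k s(1,2)] *[OF k' s(3,4)] by (meson equivclp_sym equivclp_trans)
next
  have "ess_small (over M)" unfolding over_def
    by (intro ess_small_Sigma ess_small_nat ess_small_arr_std M)
  then show "ess_small (SIGMA p:over M. carrier (fib p))"
    using F_obj[OF std_Fmods] by (intro ess_small_Sigma) (auto simp: ess_small_iff_small fib_def mem_obj_MOD)
qed

definition kan_pair :: "('a, 'u) module \<Rightarrow> ('a, 'u) module \<times> (nat \<times> ('u \<Rightarrow> 'u) \<Rightarrow> 'u \<Rightarrow> 'u)" where
  "kan_pair M = (SOME p. glues_to (over M) fib moves (fst p) (snd p))"

definition kan_obj :: "('a, 'u) module \<Rightarrow> ('a, 'u) module" where "kan_obj M = fst (kan_pair M)"

definition kan_in :: "('a, 'u) module \<Rightarrow> nat \<Rightarrow> ('u \<Rightarrow> 'u) \<Rightarrow> 'u \<Rightarrow> 'u" where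
  "kan_in M n v = snd (kan_pair M) (n, v)"

definition kan_ext :: "('a, 'u) module \<Rightarrow> ('a, 'u) module \<Rightarrow> (nat \<Rightarrow> ('u \<Rightarrow> 'u) \<Rightarrow> 'u \<Rightarrow> 'u) \<Rightarrow> 'u \<Rightarrow> 'u" where
  "kan_ext M C g = glue_induced (over M) fib (kan_obj M) (\<lambda>p. kan_in M (fst p) (snd p)) C (\<lambda>p. g (fst p) (snd p))"

lemma kan_glues:
  assumes M: "M \<in> obj Mods"
  shows "glues_to (over M) fib moves (kan_obj M) (\<lambda>p. kan_in M (fst p) (snd p))"
proof -
  obtain C \<kappa> where "glues_to (over M) fib moves C \<kappa>"
    using sifted_diagram.colimit_exists[OF sifted_over[OF M]] by blast
  then have "glues_to (over M) fib moves (fst (C, \<kappa>)) (snd (C, \<kappa>))" by simp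
  then have "glues_to (over M) fib moves (fst (kan_pair M)) (snd (kan_pair M))"
    unfolding kan_pair_def by (rule someI)
  then show ?thesis by (simp add: kan_obj_def kan_in_def)
qed

lemma kan_obj: "M \<in> obj Mods \<Longrightarrow> kan_obj M \<in> obj Mods"
  using glues_to_obj[OF kan_glues] .

lemma kan_in_hom: "M \<in> obj Mods \<Longrightarrow> v \<in> arr Mods (std n) M \<Longrightarrow> kan_in M n v \<in> module_hom R (FS n) (kan_obj M)"
  using glues_to_hom[OF kan_glues, of M "(n, v)"] by (simp add: mem_over fib_def)

lemma kan_in_mem: "\<lbrakk>M \<in> obj Mods; v \<in> arr Mods (std n) M; x \<in> carrier (FS n)\<rbrakk> \<Longrightarrow> kan_in M n v x \<in> carrier (kan_obj M)"
  using module_homD[OF kan_in_hom] .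

lemma kan_cases:
  assumes "M \<in> obj Mods" "z \<in> carrier (kan_obj M)"
  obtains n v x where "v \<in> arr Mods (std n) M" "x \<in> carrier (FS n)" "z = kan_in M n v x"
proof -
  obtain p x where "p \<in> over M" "x \<in> carrier (fib p)" "z = kan_in M (fst p) (snd p) x"
    using kan_glues[OF assms(1)] assms(2) by (rule glues_to_cases)
  then show ?thesis by (intro that[of "snd p" "fst p" x]) (simp_all add: mem_over fib_def)
qed

lemma kan_in_eqD:
  assumes "M \<in> obj Mods" "v \<in> arr Mods (std n) M" "w \<in> arr Mods (std m) M" "x \<in> carrier (FS n)" "y \<in> carrier (FS m)"
    and "kan_in M n v x = kan_in M m w y"
  shows "glued (over M) fib moves ((n, v), x) ((m, w), y)"
  using glues_to_eq_iff[OF kan_glues[OF assms(1)], of "(n, v)" "(m, w)" x y] assms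
  by (simp add: mem_over fib_def)

lemma kan_in_push:
  assumes "M \<in> obj Mods" "w \<in> arr Mods (std m) M" "\<phi> \<in> arr Mods (std n) (std m)" "x \<in> carrier (FS n)"
  shows "kan_in M n (compose (carrier (std n)) w \<phi>) x = kan_in M m w (FA n m \<phi> x)"
proof -
  let ?p = "(n, compose (carrier (std n)) w \<phi>)" and ?q = "(m, w)"
  have p: "?p \<in> over M" "?q \<in> over M" using assms comp_arr[OF std_obj] by (auto simp: mem_over)
  have "FA n m \<phi> \<in> moves ?p ?q" using assms by (auto simp: moves_def)
  then have "glued (over M) fib moves (?p, x) (?q, FA n m \<phi> x)"
    using p assms(4) by (intro glued_tr) (auto simp: fib_def)
  then show ?thesis
    using glues_to_eq_iff[OF kan_glues[OF assms(1)] p, of x "FA n m \<phi> x"] assms FA_mem by (simp add: fib_def)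
qed

lemma kan_arr_eqI:
  assumes "M \<in> obj Mods" "f \<in> arr Mods (kan_obj M) C" "g \<in> arr Mods (kan_obj M) C"
    and "\<And>n v x. \<lbrakk>v \<in> arr Mods (std n) M; x \<in> carrier (FS n)\<rbrakk> \<Longrightarrow> f (kan_in M n v x) = g (kan_in M n v x)"
  shows "f = g"
  by (rule glues_to_arr_eqI[OF kan_glues[OF assms(1)] assms(2,3)]) (simp add: assms(4) mem_over fib_def)

lemma kan_ext:
  assumes M: "M \<in> obj Mods" and C: "C \<in> obj Mods"
    and g: "\<And>n v. v \<in> arr Mods (std n) M \<Longrightarrow> g n v \<in> module_hom R (FS n) C"
    and push: "\<And>n m w \<phi> x. \<lbrakk>w \<in> arr Mods (std m) M; \<phi> \<in> arr Mods (std n) (std m); x \<in> carrier (FS n)\<rbrakk>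
      \<Longrightarrow> g n (compose (carrier (std n)) w \<phi>) x = g m w (FA n m \<phi> x)"
  shows kan_ext_arr: "kan_ext M C g \<in> arr Mods (kan_obj M) C"
    and kan_ext_eq: "\<lbrakk>v \<in> arr Mods (std n) M; x \<in> carrier (FS n)\<rbrakk> \<Longrightarrow> kan_ext M C g (kan_in M n v x) = g n v x"
proof -
  interpret S: sifted_diagram small R "over M" fib moves using M by (rule sifted_over)
  have g': "g (fst p) (snd p) \<in> module_hom R (fib p) C" if "p \<in> over M" for p
    using g that by (simp add: mem_over fib_def)
  have push': "g (fst q) (snd q) (t x) = g (fst p) (snd p) x"
    if q: "q \<in> over M" and t: "t \<in> moves p q" and x: "x \<in> carrier (fib p)" for p q t x
  proof -
    obtain \<phi> where "\<phi> \<in> arr Mods (std (fst p)) (std (fst q))" "compose (carrier (std (fst p))) (snd q) \<phi> = snd p"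
      "t = FA (fst p) (fst q) \<phi>" using t by (auto simp: moves_def)
    then show ?thesis using push[of "snd q" "fst q" \<phi> "fst p" x] q x by (simp add: mem_over fib_def)
  qed
  show "kan_ext M C g \<in> arr Mods (kan_obj M) C"
    unfolding kan_ext_def by (rule S.glue_induced_arr[OF kan_glues[OF M] C]) (simp_all add: g' push')
  show "kan_ext M C g (kan_in M n v x) = g n v x" if "v \<in> arr Mods (std n) M" "x \<in> carrier (FS n)"
    using S.glue_induced_eq[OF kan_glues[OF M] C, of "\<lambda>p. g (fst p) (snd p)" "(n, v)" x] g' push' that
    unfolding kan_ext_def by (simp add: mem_over fib_def)
qed

definition kan_map :: "('a, 'u) module \<Rightarrow> ('a, 'u) module \<Rightarrow> ('u \<Rightarrow> 'u) \<Rightarrow> 'u \<Rightarrow> 'u" where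
  "kan_map A B f = kan_ext A (kan_obj B) (\<lambda>n v. kan_in B n (compose (carrier (std n)) f v))"

lemma kan_map:
  assumes A: "A \<in> obj Mods" and B: "B \<in> obj Mods" and f: "f \<in> arr Mods A B"
  shows kan_map_arr: "kan_map A B f \<in> arr Mods (kan_obj A) (kan_obj B)"
    and kan_map_in: "\<lbrakk>v \<in> arr Mods (std n) A; x \<in> carrier (FS n)\<rbrakk>
      \<Longrightarrow> kan_map A B f (kan_in A n v x) = kan_in B n (compose (carrier (std n)) f v) x"
proof -
  have hom: "kan_in B n (compose (carrier (std n)) f v) \<in> module_hom R (FS n) (kan_obj B)"
    if "v \<in> arr Mods (std n) A" for n v
    using kan_in_hom[OF B comp_arr[OF std_obj that f]] .
  have push: "kan_in B n (compose (carrier (std n)) f (compose (carrier (std n)) w \<phi>)) x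
      = kan_in B m (compose (carrier (std m)) f w) (FA n m \<phi> x)"
    if "w \<in> arr Mods (std m) A" "\<phi> \<in> arr Mods (std n) (std m)" "x \<in> carrier (FS n)" for n m w \<phi> x
    using kan_in_push[OF B comp_arr[OF std_obj that(1) f] that(2,3)] comp_assoc[OF that(2), of f w] by simp
  show "kan_map A B f \<in> arr Mods (kan_obj A) (kan_obj B)"
    unfolding kan_map_def by (rule kan_ext_arr[OF A kan_obj[OF B]]) (simp_all add: hom push)
  show "kan_map A B f (kan_in A n v x) = kan_in B n (compose (carrier (std n)) f v) x"
    if "v \<in> arr Mods (std n) A" "x \<in> carrier (FS n)"
    unfolding kan_map_def by (rule kan_ext_eq[OF A kan_obj[OF B]]) (simp_all add: hom push that)
qed

definition kan :: "(('a, 'u) module, 'u \<Rightarrow> 'u, ('a, 'u) module, 'u \<Rightarrow> 'u) func" where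
  "kan = \<lparr>fobj = kan_obj, farr = kan_map\<rparr>"

lemma kan_simps: "fobj kan = kan_obj" "farr kan = kan_map"
  by (simp_all add: kan_def)

lemma kan_map_comp:
  assumes "A \<in> obj Mods" "B \<in> obj Mods" "C \<in> obj Mods" "f \<in> arr Mods A B" "g \<in> arr Mods B C"
  shows "kan_map A C (compose (carrier A) g f) = compose (carrier (kan_obj A)) (kan_map B C g) (kan_map A B f)"
proof (rule kan_arr_eqI[OF assms(1)])
  note gf = comp_arr[OF assms(1,4,5)]
  show "kan_map A C (compose (carrier A) g f) \<in> arr Mods (kan_obj A) (kan_obj C)"
    using assms(1,3) gf by (rule kan_map_arr)
  show "compose (carrier (kan_obj A)) (kan_map B C g) (kan_map A B f) \<in> arr Mods (kan_obj A) (kan_obj C)"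
    using assms by (intro comp_arr[of _ _ "kan_obj B"] kan_obj kan_map_arr)
  show "kan_map A C (compose (carrier A) g f) (kan_in A n v x)
      = compose (carrier (kan_obj A)) (kan_map B C g) (kan_map A B f) (kan_in A n v x)"
    if "v \<in> arr Mods (std n) A" "x \<in> carrier (FS n)" for n v x
    using assms that gf comp_assoc[OF that(1), of g f]
    by (simp add: compose_eq kan_in_mem kan_map_in comp_arr[OF std_obj])
qed

lemma kan_functor: "is_functor Mods Mods kan"
  unfolding is_functor_def kan_simps cmp_MOD idt_MOD
proof (intro conjI ballI)
  show "kan_obj A \<in> obj Mods" if "A \<in> obj Mods" for A using that by (rule kan_obj)
  show "kan_map A B f \<in> arr Mods (kan_obj A) (kan_obj B)"
    if "A \<in> obj Mods" "B \<in> obj Mods" "f \<in> arr Mods A B" for A B f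
    using that by (rule kan_map_arr)
  show "kan_map A C (compose (carrier A) g f) = compose (carrier (kan_obj A)) (kan_map B C g) (kan_map A B f)"
    if "A \<in> obj Mods" "B \<in> obj Mods" "C \<in> obj Mods" "f \<in> arr Mods A B" "g \<in> arr Mods B C" for A B C f g
    using that by (rule kan_map_comp)
  fix A assume A: "A \<in> obj Mods"
  have id: "restrict (\<lambda>x. x) (carrier B) \<in> arr Mods B B" if "B \<in> obj Mods" for B
    using category.idt_arr[OF category_MOD that] by (simp add: idt_MOD)
  show "kan_map A A (restrict (\<lambda>x. x) (carrier A)) = restrict (\<lambda>x. x) (carrier (kan_obj A))"
  proof (rule kan_arr_eqI[OF A kan_map_arr[OF A A id[OF A]] id[OF kan_obj[OF A]]])
    fix n v x assume v: "v \<in> arr Mods (std n) A" and x: "x \<in> carrier (FS n)"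
    have "compose (carrier (std n)) (restrict (\<lambda>x. x) (carrier A)) v = v"
      using category.cmp_idt_left[OF category_MOD std_obj A v] by (simp add: idt_MOD cmp_MOD)
    then show "kan_map A A (restrict (\<lambda>x. x) (carrier A)) (kan_in A n v x)
        = restrict (\<lambda>x. x) (carrier (kan_obj A)) (kan_in A n v x)"
      using kan_map_in[OF A A id[OF A] v x] kan_in_mem[OF A v x] by simp
  qed
qed

text \<open>
  The identification of the Kan extension with \<open>F\<close> on finite free modules.
\<close>

definition kan_restr :: "('a, 'u) module \<Rightarrow> 'u \<Rightarrow> 'u" where
  "kan_restr L = kan_ext L (fobj F L) (\<lambda>n v. farr F (std n) L v)"

lemma kan_restr:
  assumes L: "L \<in> obj Fmods"
  shows kan_restr_arr: "kan_restr L \<in> arr Mods (kan_obj L) (fobj F L)"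
    and kan_restr_in: "\<lbrakk>v \<in> arr Mods (std n) L; x \<in> carrier (FS n)\<rbrakk>
      \<Longrightarrow> kan_restr L (kan_in L n v x) = farr F (std n) L v x"
proof -
  have L': "L \<in> obj Mods" using L by (simp add: obj_FMOD)
  have hom: "farr F (std n) L v \<in> module_hom R (FS n) (fobj F L)" if "v \<in> arr Mods (std n) L" for n v
    using arr_hom[OF F_arr[OF std_Fmods L that]] .
  show "kan_restr L \<in> arr Mods (kan_obj L) (fobj F L)"
    unfolding kan_restr_def
    by (rule kan_ext_arr[OF L' F_obj[OF L]]) (simp_all add: hom F_cmp[OF std_Fmods std_Fmods L])
  show "kan_restr L (kan_in L n v x) = farr F (std n) L v x"
    if "v \<in> arr Mods (std n) L" "x \<in> carrier (FS n)"
    unfolding kan_restr_def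
    by (rule kan_ext_eq[OF L' F_obj[OF L]]) (simp_all add: hom F_cmp[OF std_Fmods std_Fmods L] that)
qed

lemma Fmods_retract_of_std:
  assumes L: "L \<in> obj Fmods"
  obtains n a b where "a \<in> arr Mods (std n) L" "b \<in> arr Mods L (std n)"
    "compose (carrier L) a b = restrict (\<lambda>x. x) (carrier L)"
proof -
  have L': "L \<in> obj Mods" using L by (simp add: obj_FMOD)
  obtain n e where e: "free_on {..<n::nat} L e" using L by (rule Fmod_free_on)
  have em: "e i \<in> carrier L" if "i < n" for i using free_on_mem[OF e] that by simp
  let ?a = "std_ext n L e" and ?b = "free_ext {..<n} L e (std n) (gen n)"
  have a: "?a \<in> arr Mods (std n) L" "\<And>i. i < n \<Longrightarrow> ?a (gen n i) = e i"
    using std_ext_arr[OF L' em] std_ext_gen[OF L' em] by auto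
  have b: "?b \<in> arr Mods L (std n)" "\<And>i. i < n \<Longrightarrow> ?b (e i) = gen n i"
    using free_ext_arr[OF e std_obj] free_ext_eq[OF e std_obj] gen_mem by auto
  have id: "restrict (\<lambda>x. x) (carrier B) \<in> arr Mods B B" if "B \<in> obj Mods" for B
    using category.idt_arr[OF category_MOD that] by (simp add: idt_MOD)
  have "compose (carrier L) ?a ?b = restrict (\<lambda>x. x) (carrier L)"
    by (rule free_on_arr_eqI[OF e L' comp_arr[OF L' b(1) a(1)] id[OF L']])
      (simp add: compose_eq em a(2) b(2))
  with a(1) b(1) show ?thesis by (rule that)
qed

text \<open>
  If \<open>a \<circ> b = 1\<close> with \<open>a : R^n \<rightarrow> L\<close>, then \<open>(v, x)\<close> is glued to \<open>(a, F(b \<circ> v)(x))\<close>, so an element is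
  determined by, and can be recovered from, its value in \<open>F(L)\<close>.
\<close>

lemma kan_restr_bij:
  assumes L: "L \<in> obj Fmods"
  shows "bij_betw (kan_restr L) (carrier (kan_obj L)) (carrier (fobj F L))"
proof -
  have L': "L \<in> obj Mods" using L by (simp add: obj_FMOD)
  obtain n a b where a: "a \<in> arr Mods (std n) L" and b: "b \<in> arr Mods L (std n)"
    and ab: "compose (carrier L) a b = restrict (\<lambda>x. x) (carrier L)"
    using L by (rule Fmods_retract_of_std)
  let ?g = "\<lambda>y. kan_in L n a (farr F L (std n) b y)"
  have Fb: "farr F L (std n) b y \<in> carrier (FS n)" if "y \<in> carrier (fobj F L)" for y
    using arr_mem[OF F_arr[OF L std_Fmods b] that] .
  show ?thesis
  proof (rule bij_betwI[where g = ?g])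
    show "kan_restr L \<in> carrier (kan_obj L) \<rightarrow> carrier (fobj F L)" using arr_mem[OF kan_restr_arr[OF L]] by auto
    show "?g \<in> carrier (fobj F L) \<rightarrow> carrier (kan_obj L)" using kan_in_mem[OF L' a] Fb by auto
    show "kan_restr L (?g y) = y" if y: "y \<in> carrier (fobj F L)" for y
      using kan_restr_in[OF L a Fb[OF y]] F_cmp[OF L std_Fmods L b a y] F_idt[OF L y] ab by simp
    show "?g (kan_restr L z) = z" if z: "z \<in> carrier (kan_obj L)" for z
    proof -
      obtain m v x where v: "v \<in> arr Mods (std m) L" and x: "x \<in> carrier (FS m)" and zx: "z = kan_in L m v x"
        using L' z by (rule kan_cases)
      let ?bv = "compose (carrier (std m)) b v"
      have bv: "?bv \<in> arr Mods (std m) (std n)" using std_obj v b by (rule comp_arr)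
      have "compose (carrier (std m)) a ?bv = compose (carrier (std m)) (restrict (\<lambda>x. x) (carrier L)) v"
        using comp_assoc[OF v, of a b] ab by simp
      also have "\<dots> = v" using category.cmp_idt_left[OF category_MOD std_obj L' v] by (simp add: idt_MOD cmp_MOD)
      finally have "z = kan_in L n a (FA m n ?bv x)" using zx kan_in_push[OF L' a bv x] by simp
      then show ?thesis
        using kan_restr_in[OF L v x] zx F_cmp[OF std_Fmods L std_Fmods v b x] by simp
    qed
  qed
qed

lemma kan_extension: "is_extension small R F kan kan_restr"
  unfolding is_extension_def nat_iso_def nat_trans_def kan_simps cmp_MOD arr_FMOD
proof (intro conjI ballI)
  show "is_functor Mods Mods kan" by (rule kan_functor)
  show "kan_restr L \<in> arr Mods (kan_obj L) (fobj F L)" if "L \<in> obj Fmods" for L using that by (rule kan_restr_arr)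
  show "is_iso Mods (kan_obj L) (fobj F L) (kan_restr L)" if L: "L \<in> obj Fmods" for L
    using kan_restr_arr[OF L] kan_restr_bij[OF L] L
    by (subst is_iso_MOD_iff) (auto intro: kan_obj F_obj simp: obj_FMOD)
  fix L M f assume L: "L \<in> obj Fmods" and M: "M \<in> obj Fmods" and f: "f \<in> arr Mods L M"
  have L': "L \<in> obj Mods" and M': "M \<in> obj Mods" using L M by (simp_all add: obj_FMOD)
  show "compose (carrier (kan_obj L)) (kan_restr M) (kan_map L M f)
      = compose (carrier (kan_obj L)) (farr F L M f) (kan_restr L)"
  proof (rule kan_arr_eqI[OF L'])
    show "compose (carrier (kan_obj L)) (kan_restr M) (kan_map L M f) \<in> arr Mods (kan_obj L) (fobj F M)"
      using kan_obj[OF L'] kan_map_arr[OF L' M' f] kan_restr_arr[OF M] by (rule comp_arr)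
    show "compose (carrier (kan_obj L)) (farr F L M f) (kan_restr L) \<in> arr Mods (kan_obj L) (fobj F M)"
      using kan_obj[OF L'] kan_restr_arr[OF L] F_arr[OF L M f] by (rule comp_arr)
    fix n v x assume v: "v \<in> arr Mods (std n) L" and x: "x \<in> carrier (FS n)"
    show "compose (carrier (kan_obj L)) (kan_restr M) (kan_map L M f) (kan_in L n v x)
        = compose (carrier (kan_obj L)) (farr F L M f) (kan_restr L) (kan_in L n v x)"
      using kan_in_mem[OF L' v x] kan_map_in[OF L' M' f v x] kan_restr_in[OF L v x]
        kan_restr_in[OF M comp_arr[OF std_obj v f] x] F_cmp[OF std_Fmods L M v f x]
      by (simp add: compose_eq)
  qed
qed

end

section \<open>Right exactness of the Kan extension\<close>

context module_universe
begin

text \<open>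
  Projectivity of the standard free modules.
\<close>

lemma std_lift:
  assumes B: "B \<in> obj Mods" and C: "C \<in> obj Mods" and \<beta>: "\<beta> \<in> arr Mods B C"
    and surj: "\<beta> ` carrier B = carrier C" and w: "w \<in> arr Mods (std n) C"
  obtains v where "v \<in> arr Mods (std n) B" "compose (carrier (std n)) \<beta> v = w"
proof -
  define g where "g i = inv_into (carrier B) \<beta> (w (gen n i))" for i
  have wC: "w (gen n i) \<in> \<beta> ` carrier B" if "i < n" for i using arr_mem[OF w gen_mem[OF that]] surj by simp
  have g: "g i \<in> carrier B" if "i < n" for i unfolding g_def using wC[OF that] by (rule inv_into_into)
  have \<beta>g: "\<beta> (g i) = w (gen n i)" if "i < n" for i unfolding g_def using wC[OF that] by (rule f_inv_into_f)
  note v = std_ext_arr[OF B g]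
  have "compose (carrier (std n)) \<beta> (std_ext n B g) = w"
    by (rule std_arr_eqI[OF C comp_arr[OF std_obj v \<beta>] w])
      (simp_all add: compose_eq gen_mem std_ext_gen[OF B g] \<beta>g)
  with v show ?thesis by (rule that)
qed

lemma sum_map_arr:
  assumes P: "P \<in> obj Mods" and B: "B \<in> obj Mods"
    and \<alpha>: "\<alpha> \<in> arr Mods A B" and p: "p \<in> arr Mods P A" and q: "q \<in> arr Mods P B"
  shows "restrict (\<lambda>x. \<alpha> (p x) \<oplus>\<^bsub>B\<^esub> q x) (carrier P) \<in> arr Mods P B"
proof (rule restrict_arr[OF obj_module[OF P] module_homI])
  interpret B: module R B using B by (rule obj_module)
  interpret P: module R P using P by (rule obj_module)
  have \<alpha>p: "\<alpha> (p x) \<in> carrier B" if "x \<in> carrier P" for x using arr_mem[OF \<alpha> arr_mem[OF p that]] .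
  show "\<alpha> (p x) \<oplus>\<^bsub>B\<^esub> q x \<in> carrier B" if "x \<in> carrier P" for x
    using \<alpha>p[OF that] arr_mem[OF q that] by simp
  show "\<alpha> (p (x \<oplus>\<^bsub>P\<^esub> y)) \<oplus>\<^bsub>B\<^esub> q (x \<oplus>\<^bsub>P\<^esub> y) = \<alpha> (p x) \<oplus>\<^bsub>B\<^esub> q x \<oplus>\<^bsub>B\<^esub> (\<alpha> (p y) \<oplus>\<^bsub>B\<^esub> q y)"
    if x: "x \<in> carrier P" and y: "y \<in> carrier P" for x y
    using module_hom_add[OF arr_hom[OF p] x y] module_hom_add[OF arr_hom[OF q] x y]
      module_hom_add[OF arr_hom[OF \<alpha>] arr_mem[OF p x] arr_mem[OF p y]]
      \<alpha>p[OF x] \<alpha>p[OF y] arr_mem[OF q x] arr_mem[OF q y]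
    by (simp add: B.a_ac)
  show "\<alpha> (p (a \<odot>\<^bsub>P\<^esub> x)) \<oplus>\<^bsub>B\<^esub> q (a \<odot>\<^bsub>P\<^esub> x) = a \<odot>\<^bsub>B\<^esub> (\<alpha> (p x) \<oplus>\<^bsub>B\<^esub> q x)"
    if a: "a \<in> carrier R" and x: "x \<in> carrier P" for a x
    using module_hom_smult[OF arr_hom[OF p] a x] module_hom_smult[OF arr_hom[OF q] a x]
      module_hom_smult[OF arr_hom[OF \<alpha>] a arr_mem[OF p x]] \<alpha>p[OF x] arr_mem[OF q x] a
    by (simp add: B.smult_r_distr)
qed

end

context functor_on_free
begin

lemma kan_map_surj:
  assumes B: "B \<in> obj Mods" and C: "C \<in> obj Mods" and \<beta>: "\<beta> \<in> arr Mods B C"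
    and surj: "\<beta> ` carrier B = carrier C"
  shows "kan_map B C \<beta> ` carrier (kan_obj B) = carrier (kan_obj C)"
proof
  show "kan_map B C \<beta> ` carrier (kan_obj B) \<subseteq> carrier (kan_obj C)"
    using arr_mem[OF kan_map_arr[OF B C \<beta>]] by blast
  show "carrier (kan_obj C) \<subseteq> kan_map B C \<beta> ` carrier (kan_obj B)"
  proof
    fix z assume z: "z \<in> carrier (kan_obj C)"
    obtain n w x where w: "w \<in> arr Mods (std n) C" and x: "x \<in> carrier (FS n)" and zx: "z = kan_in C n w x"
      using C z by (rule kan_cases)
    obtain v where v: "v \<in> arr Mods (std n) B" "compose (carrier (std n)) \<beta> v = w"
      using B C \<beta> surj w by (rule std_lift)
    have "z = kan_map B C \<beta> (kan_in B n v x)" using kan_map_in[OF B C \<beta> v(1) x] v(2) zx by simp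
    then show "z \<in> kan_map B C \<beta> ` carrier (kan_obj B)" using kan_in_mem[OF B v(1) x] by blast
  qed
qed

text \<open>
  \<open>D\<close> stands for the image of the difference map. Along a chain of moves over \<open>C\<close>, each move is
  lifted to \<open>B\<close>; wherever the lifts chosen for two neighbouring moves do not match, they are lifts
  of the same map and change the element by a member of \<open>D\<close> only.
\<close>

lemma glued_lifts_differ:
  assumes B: "B \<in> obj Mods" and C: "C \<in> obj Mods" and \<beta>: "\<beta> \<in> arr Mods B C"
    and surj: "\<beta> ` carrier B = carrier C"
    and add': "\<forall>y\<in>D. \<forall>z\<in>D. y \<oplus>\<^bsub>kan_obj B\<^esub> z \<in> D"
    and lifts': "\<forall>n. \<forall>v\<in>arr Mods (std n) B. \<forall>v'\<in>arr Mods (std n) B. \<forall>x\<in>carrier (FS n).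
      compose (carrier (std n)) \<beta> v = compose (carrier (std n)) \<beta> v' \<longrightarrow>
      kan_in B n v x \<ominus>\<^bsub>kan_obj B\<^esub> kan_in B n v' x \<in> D"
    and glued: "glued (over C) fib moves p q"
    and p: "fst p \<in> over C" "snd p \<in> carrier (fib (fst p))"
    and v: "v \<in> arr Mods (std (fst (fst p))) B" "compose (carrier (std (fst (fst p)))) \<beta> v = snd (fst p)"
  shows "fst q \<in> over C \<and> snd q \<in> carrier (fib (fst q)) \<and>
    (\<forall>v' \<in> arr Mods (std (fst (fst q))) B. compose (carrier (std (fst (fst q)))) \<beta> v' = snd (fst q) \<longrightarrow>
      kan_in B (fst (fst p)) v (snd p) \<ominus>\<^bsub>kan_obj B\<^esub> kan_in B (fst (fst q)) v' (snd q) \<in> D)"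
  using glued
proof (induction rule: equivclp_induct)
  case base
  show ?case using p v lifts' by (auto simp: fib_def)
next
  case (step y z)
  interpret K: module R "kan_obj B" using kan_obj[OF B] by (rule obj_module)
  let ?n = "fst (fst p)" and ?m = "fst (fst y)" and ?k = "fst (fst z)"
  have x: "snd p \<in> carrier (FS ?n)" using p by (simp add: fib_def)
  have y: "snd (fst y) \<in> arr Mods (std ?m) C" "snd y \<in> carrier (FS ?m)"
    and IH: "\<And>v'. \<lbrakk>v' \<in> arr Mods (std ?m) B; compose (carrier (std ?m)) \<beta> v' = snd (fst y)\<rbrakk> \<Longrightarrow>
      kan_in B ?n v (snd p) \<ominus>\<^bsub>kan_obj B\<^esub> kan_in B ?m v' (snd y) \<in> D"
    using step.IH by (auto simp: mem_over fib_def)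
  from step.hyps(2) show ?case
  proof
    assume "glue_step (over C) fib moves y z"
    then obtain \<phi> where \<phi>: "\<phi> \<in> arr Mods (std ?m) (std ?k)" "compose (carrier (std ?m)) (snd (fst z)) \<phi> = snd (fst y)"
      and z: "fst z \<in> over C" and zy: "snd z = FA ?m ?k \<phi> (snd y)"
      unfolding glue_step_def moves_def by blast
    have z': "snd z \<in> carrier (FS ?k)" unfolding zy using FA_mem[OF \<phi>(1) y(2)] .
    have "kan_in B ?n v (snd p) \<ominus>\<^bsub>kan_obj B\<^esub> kan_in B ?k v' (snd z) \<in> D"
      if v': "v' \<in> arr Mods (std ?k) B" "compose (carrier (std ?k)) \<beta> v' = snd (fst z)" for v'
    proof -
      have "compose (carrier (std ?m)) \<beta> (compose (carrier (std ?m)) v' \<phi>) = snd (fst y)"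
        using comp_assoc[OF \<phi>(1), of \<beta> v'] v'(2) \<phi>(2) by simp
      from IH[OF comp_arr[OF std_obj \<phi>(1) v'(1)] this] show ?thesis
        using kan_in_push[OF B v'(1) \<phi>(1) y(2)] zy by simp
    qed
    then show ?thesis using z z' by (simp add: fib_def)
  next
    assume "glue_step (over C) fib moves z y"
    then obtain \<phi> where \<phi>: "\<phi> \<in> arr Mods (std ?k) (std ?m)" "compose (carrier (std ?k)) (snd (fst y)) \<phi> = snd (fst z)"
      and z: "fst z \<in> over C" "snd z \<in> carrier (FS ?k)" and yz: "snd y = FA ?k ?m \<phi> (snd z)"
      unfolding glue_step_def moves_def fib_def by blast
    have "kan_in B ?n v (snd p) \<ominus>\<^bsub>kan_obj B\<^esub> kan_in B ?k v' (snd z) \<in> D"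
      if v': "v' \<in> arr Mods (std ?k) B" "compose (carrier (std ?k)) \<beta> v' = snd (fst z)" for v'
    proof -
      \<comment> \<open>Here the move goes from \<open>z\<close> to \<open>y\<close>: a lift at \<open>y\<close> induces a second lift at \<open>z\<close>.\<close>
      obtain u where u: "u \<in> arr Mods (std ?m) B" "compose (carrier (std ?m)) \<beta> u = snd (fst y)"
        using B C \<beta> surj y(1) by (rule std_lift)
      let ?u = "compose (carrier (std ?k)) u \<phi>"
      have u': "?u \<in> arr Mods (std ?k) B" using std_obj \<phi>(1) u(1) by (rule comp_arr)
      have "compose (carrier (std ?k)) \<beta> ?u = compose (carrier (std ?k)) \<beta> v'"
        using comp_assoc[OF \<phi>(1), of \<beta> u] u(2) \<phi>(2) v'(2) by simp
      from lifts'[rule_format, OF u' v'(1) z(2) this]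
      have "kan_in B ?m u (snd y) \<ominus>\<^bsub>kan_obj B\<^esub> kan_in B ?k v' (snd z) \<in> D"
        using kan_in_push[OF B u(1) \<phi>(1) z(2)] yz by simp
      from add'[rule_format, OF IH[OF u] this]
      have "(kan_in B ?n v (snd p) \<ominus>\<^bsub>kan_obj B\<^esub> kan_in B ?m u (snd y)) \<oplus>\<^bsub>kan_obj B\<^esub>
        (kan_in B ?m u (snd y) \<ominus>\<^bsub>kan_obj B\<^esub> kan_in B ?k v' (snd z)) \<in> D" .
      moreover have "kan_in B ?n v (snd p) \<in> carrier (kan_obj B)" "kan_in B ?m u (snd y) \<in> carrier (kan_obj B)"
        "kan_in B ?k v' (snd z) \<in> carrier (kan_obj B)"
        using kan_in_mem[OF B v(1) x] kan_in_mem[OF B u(1) y(2)] kan_in_mem[OF B v'(1) z(2)] .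
      ultimately show ?thesis
        by (simp add: a_minus_def K.a_assoc K.r_neg1)
    qed
    then show ?thesis using z by (simp add: fib_def)
  qed
qed

text \<open>
  Two lifts \<open>v\<close> and \<open>v'\<close> of one map define a map \<open>r\<close> into \<open>P\<close> with \<open>s \<circ> r = v\<close> and \<open>q \<circ> r = v'\<close>,
  because \<open>v - v'\<close> takes values in the kernel of \<open>\<beta>\<close>, the image of \<open>\<alpha>\<close>. An element \<open>(v, x)\<close> in the
  kernel of the induced map has \<open>(\<beta> \<circ> v, x)\<close> glued to \<open>(\<beta> \<circ> v, 0)\<close>, and \<open>glued_lifts_differ\<close>
  applies with \<open>v\<close> as lift at both ends.
\<close>

lemma kan_right_exact: "right_exact small R kan"
  unfolding right_exact_def Let_def kan_simps
proof (intro ballI allI impI)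
  fix A B C \<alpha> \<beta> P p q
  assume A: "A \<in> obj Mods" and B: "B \<in> obj Mods" and C: "C \<in> obj Mods" and P: "P \<in> obj Mods"
    and \<alpha>: "\<alpha> \<in> arr Mods A B" and \<beta>: "\<beta> \<in> arr Mods B C"
    and "right_exact_seq A B C \<alpha> \<beta> \<and> is_direct_sum R A B P p q"
  then have ker: "\<alpha> ` carrier A = a_kernel B C \<beta>" and surj: "\<beta> ` carrier B = carrier C"
    and p: "p \<in> arr Mods P A" and q: "q \<in> arr Mods P B"
    and bij: "bij_betw (\<lambda>x. (p x, q x)) (carrier P) (carrier A \<times> carrier B)"
    by (auto simp: right_exact_seq_def is_direct_sum_def mem_arr_MOD)
  interpret B: module R B using B by (rule obj_module)
  interpret P: module R P using P by (rule obj_module)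
  interpret C: module R C using C by (rule obj_module)
  interpret KB: module R "kan_obj B" using kan_obj[OF B] by (rule obj_module)
  interpret KP: module R "kan_obj P" using kan_obj[OF P] by (rule obj_module)
  interpret KC: module R "kan_obj C" using kan_obj[OF C] by (rule obj_module)
  define s where "s = restrict (\<lambda>x. \<alpha> (p x) \<oplus>\<^bsub>B\<^esub> q x) (carrier P)"
  have \<alpha>p: "\<alpha> (p x) \<in> carrier B" if "x \<in> carrier P" for x using arr_mem[OF \<alpha> arr_mem[OF p that]] .
  have \<beta>\<alpha>: "\<beta> (\<alpha> a) = \<zero>\<^bsub>C\<^esub>" if "a \<in> carrier A" for a
  proof -
    have "\<alpha> a \<in> a_kernel B C \<beta>" using that ker by blast
    then show ?thesis by (simp add: a_kernel_def')
  qed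
  have s: "s \<in> arr Mods P B" unfolding s_def using P B \<alpha> p q by (rule sum_map_arr)
  have \<beta>s: "compose (carrier P) \<beta> s = compose (carrier P) \<beta> q"
  proof (rule arr_eqI[OF comp_arr[OF P s \<beta>] comp_arr[OF P q \<beta>]])
    fix x assume x: "x \<in> carrier P"
    show "compose (carrier P) \<beta> s x = compose (carrier P) \<beta> q x"
      using x module_hom_add[OF arr_hom[OF \<beta>] \<alpha>p[OF x] arr_mem[OF q x]] \<beta>\<alpha>[OF arr_mem[OF p x]]
        arr_mem[OF \<beta> arr_mem[OF q x]] by (simp add: compose_eq s_def)
  qed
  define d where "d = restrict (\<lambda>y. kan_map P B s y \<ominus>\<^bsub>kan_obj B\<^esub> kan_map P B q y) (carrier (kan_obj P))"
  note ms = kan_map_arr[OF P B s] and mq = kan_map_arr[OF P B q] and m\<beta> = kan_map_arr[OF B C \<beta>]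
  let ?D = "d ` carrier (kan_obj P)"
  have d: "d y = kan_map P B s y \<ominus>\<^bsub>kan_obj B\<^esub> kan_map P B q y" if "y \<in> carrier (kan_obj P)" for y
    using that by (simp add: d_def)
  have add: "\<forall>y\<in>?D. \<forall>z\<in>?D. y \<oplus>\<^bsub>kan_obj B\<^esub> z \<in> ?D"
  proof (intro ballI)
    fix y z assume yz: "y \<in> ?D" "z \<in> ?D"
    obtain a b where a: "a \<in> carrier (kan_obj P)" "y = d a" and b: "b \<in> carrier (kan_obj P)" "z = d b"
      using yz by blast
    have "y \<oplus>\<^bsub>kan_obj B\<^esub> z = d (a \<oplus>\<^bsub>kan_obj P\<^esub> b)"
      using a b module_hom_add[OF arr_hom[OF ms] a(1) b(1)] module_hom_add[OF arr_hom[OF mq] a(1) b(1)]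
        arr_mem[OF ms a(1)] arr_mem[OF ms b(1)] arr_mem[OF mq a(1)] arr_mem[OF mq b(1)]
      by (simp add: d a_minus_def KB.minus_add KB.a_ac)
    then show "y \<oplus>\<^bsub>kan_obj B\<^esub> z \<in> ?D" using a b by auto
  qed
  have lifts: "\<forall>n. \<forall>v\<in>arr Mods (std n) B. \<forall>v'\<in>arr Mods (std n) B. \<forall>x\<in>carrier (FS n).
      compose (carrier (std n)) \<beta> v = compose (carrier (std n)) \<beta> v' \<longrightarrow>
      kan_in B n v x \<ominus>\<^bsub>kan_obj B\<^esub> kan_in B n v' x \<in> ?D"
  proof (intro allI ballI impI)
    fix n v v' x assume v: "v \<in> arr Mods (std n) B" and v': "v' \<in> arr Mods (std n) B"
      and x: "x \<in> carrier (FS n)" and eq: "compose (carrier (std n)) \<beta> v = compose (carrier (std n)) \<beta> v'"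
    have "\<exists>r \<in> carrier P. s r = v (gen n i) \<and> q r = v' (gen n i)" if i: "i < n" for i
    proof -
      let ?b = "v (gen n i)" and ?b' = "v' (gen n i)"
      have b: "?b \<in> carrier B" "?b' \<in> carrier B"
        using arr_mem[OF v gen_mem[OF i]] arr_mem[OF v' gen_mem[OF i]] .
      have "\<beta> ?b = \<beta> ?b'" using fun_cong[OF eq, of "gen n i"] by (simp add: compose_eq gen_mem[OF i])
      then have "?b \<ominus>\<^bsub>B\<^esub> ?b' \<in> a_kernel B C \<beta>"
        using b module_hom_minus[OF obj_module[OF B] obj_module[OF C] arr_hom[OF \<beta>] b] arr_mem[OF \<beta>]
        by (simp add: a_kernel_def' a_minus_def C.r_neg)
      then obtain a where a: "a \<in> carrier A" "\<alpha> a = ?b \<ominus>\<^bsub>B\<^esub> ?b'" using ker by (metis imageE)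
      have "(a, ?b') \<in> (\<lambda>x. (p x, q x)) ` carrier P" using bij a b by (simp add: bij_betw_def)
      then obtain r where r: "r \<in> carrier P" "p r = a" "q r = ?b'" by auto
      then have "s r = ?b" using a b by (simp add: s_def a_minus_def B.a_assoc B.l_neg)
      with r show ?thesis by blast
    qed
    then obtain r where r: "\<And>i. i < n \<Longrightarrow> r i \<in> carrier P \<and> s (r i) = v (gen n i) \<and> q (r i) = v' (gen n i)"
      by metis
    let ?r = "std_ext n P r"
    have r1: "r i \<in> carrier P" if "i < n" for i using r[OF that] by simp
    note ra = std_ext_arr[OF P r1] and rg = std_ext_gen[OF P r1]
    have sr: "compose (carrier (std n)) s ?r = v"
      by (rule std_arr_eqI[OF B comp_arr[OF std_obj ra s] v]) (simp_all add: compose_eq gen_mem rg r)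
    have qr: "compose (carrier (std n)) q ?r = v'"
      by (rule std_arr_eqI[OF B comp_arr[OF std_obj ra q] v']) (simp_all add: compose_eq gen_mem rg r)
    have z: "kan_in P n ?r x \<in> carrier (kan_obj P)" using kan_in_mem[OF P ra x] by simp
    have "kan_in B n v x \<ominus>\<^bsub>kan_obj B\<^esub> kan_in B n v' x = d (kan_in P n ?r x)"
      using kan_map_in[OF P B s ra x] kan_map_in[OF P B q ra x] sr qr d[OF z] by simp
    then show "kan_in B n v x \<ominus>\<^bsub>kan_obj B\<^esub> kan_in B n v' x \<in> ?D" using z by blast
  qed
  have "?D = a_kernel (kan_obj B) (kan_obj C) (kan_map B C \<beta>)"
  proof
    show "?D \<subseteq> a_kernel (kan_obj B) (kan_obj C) (kan_map B C \<beta>)"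
    proof
      fix y assume "y \<in> ?D"
      then obtain z where z: "z \<in> carrier (kan_obj P)" "y = d z" by blast
      have sz: "kan_map P B s z \<in> carrier (kan_obj B)" "kan_map P B q z \<in> carrier (kan_obj B)"
        using arr_mem[OF ms z(1)] arr_mem[OF mq z(1)] .
      have "kan_map B C \<beta> (kan_map P B s z) = kan_map B C \<beta> (kan_map P B q z)"
        using fun_cong[OF kan_map_comp[OF P B C s \<beta>], of z] fun_cong[OF kan_map_comp[OF P B C q \<beta>], of z] \<beta>s z(1)
        by (simp add: compose_eq)
      then have "kan_map B C \<beta> y = \<zero>\<^bsub>kan_obj C\<^esub>"
        using module_hom_minus[OF obj_module[OF kan_obj[OF B]] obj_module[OF kan_obj[OF C]] arr_hom[OF m\<beta>] sz]
          arr_mem[OF m\<beta> sz(2)] by (simp add: z d a_minus_def KC.r_neg)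
      moreover have "y \<in> carrier (kan_obj B)" using z sz d by simp
      ultimately show "y \<in> a_kernel (kan_obj B) (kan_obj C) (kan_map B C \<beta>)" by (simp add: a_kernel_def')
    qed
    show "a_kernel (kan_obj B) (kan_obj C) (kan_map B C \<beta>) \<subseteq> ?D"
    proof
      fix y assume "y \<in> a_kernel (kan_obj B) (kan_obj C) (kan_map B C \<beta>)"
      then have y: "y \<in> carrier (kan_obj B)" and y0: "kan_map B C \<beta> y = \<zero>\<^bsub>kan_obj C\<^esub>" by (simp_all add: a_kernel_def')
      obtain n v x where v: "v \<in> arr Mods (std n) B" and x: "x \<in> carrier (FS n)" and yx: "y = kan_in B n v x"
        using B y by (rule kan_cases)
      let ?w = "compose (carrier (std n)) \<beta> v"
      interpret FS: module R "FS n" using F_obj[OF std_Fmods] by (rule obj_module)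
      have w: "?w \<in> arr Mods (std n) C" using std_obj v \<beta> by (rule comp_arr)
      have zero: "kan_in X n u \<zero>\<^bsub>FS n\<^esub> = \<zero>\<^bsub>kan_obj X\<^esub>" if "X \<in> obj Mods" "u \<in> arr Mods (std n) X" for X u
        using module_hom_zero[OF obj_module[OF F_obj[OF std_Fmods]] obj_module[OF kan_obj[OF that(1)]]
            kan_in_hom[OF that]] .
      have "kan_in C n ?w x = kan_in C n ?w \<zero>\<^bsub>FS n\<^esub>"
        using y0 yx kan_map_in[OF B C \<beta> v x] zero[OF C w] by simp
      note gl = kan_in_eqD[OF C w w x FS.zero_closed this]
      have p: "fst ((n, ?w), x) \<in> over C" "snd ((n, ?w), x) \<in> carrier (fib (fst ((n, ?w), x)))"
        "v \<in> arr Mods (std (fst (fst ((n, ?w), x)))) B"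
        "compose (carrier (std (fst (fst ((n, ?w), x))))) \<beta> v = snd (fst ((n, ?w), x))"
        using v w x by (simp_all add: mem_over fib_def)
      have "\<forall>v' \<in> arr Mods (std n) B. compose (carrier (std n)) \<beta> v' = ?w \<longrightarrow>
          kan_in B n v x \<ominus>\<^bsub>kan_obj B\<^esub> kan_in B n v' \<zero>\<^bsub>FS n\<^esub> \<in> ?D"
        using glued_lifts_differ[OF B C \<beta> surj add lifts gl p, THEN conjunct2, THEN conjunct2]
        by (simp only: fst_conv snd_conv)
      then have "kan_in B n v x \<ominus>\<^bsub>kan_obj B\<^esub> kan_in B n v \<zero>\<^bsub>FS n\<^esub> \<in> ?D" using v by blast
      then show "y \<in> ?D" using yx y zero[OF B v] by (simp add: KB.minus_zero_right)
    qed
  qed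
  then show "right_exact_seq (kan_obj P) (kan_obj B) (kan_obj C)
      (restrict (\<lambda>y. kan_map P B (restrict (\<lambda>x. \<alpha> (p x) \<oplus>\<^bsub>B\<^esub> q x) (carrier P)) y
         \<ominus>\<^bsub>kan_obj B\<^esub> kan_map P B q y) (carrier (kan_obj P))) (kan_map B C \<beta>)"
    using kan_map_surj[OF B C \<beta> surj] by (simp add: right_exact_seq_def d_def s_def)
qed

end


section \<open>The Kan extension and filtered colimits\<close>

context filtered_diagram
begin

text \<open>
  The images of the finitely many generators come from a common stage.
\<close>

lemma std_factors_through_stage:
  assumes L: "is_colimit J Mods D L l" and v: "v \<in> arr Mods (std n) L"
  obtains i u where "i \<in> obj J" "u \<in> arr Mods (std n) (fobj D i)" "compose (carrier (std n)) (l i) u = v"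
proof -
  note coc = colimit_cocone[OF L]
  note Lobj = cocone_obj[OF coc] and l = cocone_arr[OF coc] and l_tr = cocone_apply[OF coc]
  have "\<exists>i\<in>obj J. \<exists>a. \<forall>k<m. a k \<in> carrier (fobj D i) \<and> l i (a k) = v (gen n k)" if "m \<le> n" for m
    using that
  proof (induction m)
    case 0
    then show ?case using filtered_J by (auto simp: filtered_def)
  next
    case (Suc m)
    then obtain i a where i: "i \<in> obj J" and a: "\<And>k. k < m \<Longrightarrow> a k \<in> carrier (fobj D i) \<and> l i (a k) = v (gen n k)"
      by auto
    have "v (gen n m) \<in> carrier L" using arr_mem[OF v gen_mem[of m n]] Suc.prems by simp
    then obtain j b where j: "j \<in> obj J" and b: "b \<in> carrier (fobj D j)" "v (gen n m) = l j b"
      using colimit_cases[OF L] by blast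
    obtain r f g where r: "r \<in> obj J" and f: "f \<in> arr J i r" and g: "g \<in> arr J j r"
      using i j by (rule cospan_J)
    let ?a = "\<lambda>k. if k < m then farr D i r f (a k) else farr D j r g b"
    have a': "?a k \<in> carrier (fobj D r) \<and> l r (?a k) = v (gen n k)" if "k < Suc m" for k
    proof (cases "k < m")
      case True
      then show ?thesis using a[OF True] functor_mem[OF D i r f] l_tr[OF i r f] by simp
    next
      case False
      then have "k = m" using that by simp
      then show ?thesis using b functor_mem[OF D j r g] l_tr[OF j r g] by simp
    qed
    show ?case using r by (intro bexI[of _ r] exI[of _ ?a] allI impI a')
  qed
  from this[OF order_refl] obtain i a where i: "i \<in> obj J"
    and a: "\<And>k. k < n \<Longrightarrow> a k \<in> carrier (fobj D i) \<and> l i (a k) = v (gen n k)" by blast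
  have Di: "fobj D i \<in> obj Mods" using functor_obj[OF D i] .
  have a1: "a k \<in> carrier (fobj D i)" if "k < n" for k using a[OF that] by simp
  note u = std_ext_arr[OF Di a1]
  have "compose (carrier (std n)) (l i) (std_ext n (fobj D i) a) = v"
    by (rule std_arr_eqI[OF Lobj comp_arr[OF std_obj u l[OF i]] v])
      (simp_all add: compose_eq gen_mem std_ext_gen[OF Di a1] a)
  with i u show ?thesis by (rule that)
qed

text \<open>
  The generators are treated one after the other, passing to a later stage each time.
\<close>

lemma std_eventually_equal:
  assumes L: "is_colimit J Mods D L l" and i: "i \<in> obj J" and j: "j \<in> obj J"
    and u: "u \<in> arr Mods (std n) (fobj D i)" and w: "w \<in> arr Mods (std n) (fobj D j)"
    and eq: "compose (carrier (std n)) (l i) u = compose (carrier (std n)) (l j) w"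
  obtains k f g where "k \<in> obj J" "f \<in> arr J i k" "g \<in> arr J j k"
    "compose (carrier (std n)) (farr D i k f) u = compose (carrier (std n)) (farr D j k g) w"
proof -
  note l_tr = cocone_apply[OF colimit_cocone[OF L]]
  note cmp = category.cmp_arr[OF category_J] and Dc = functor_cmp[OF D] and mem = functor_mem[OF D]
  have um: "u (gen n r) \<in> carrier (fobj D i)" and wm: "w (gen n r) \<in> carrier (fobj D j)" if "r < n" for r
    using arr_mem[OF u gen_mem[OF that]] arr_mem[OF w gen_mem[OF that]] .
  have "\<exists>k\<in>obj J. \<exists>f\<in>arr J i k. \<exists>g\<in>arr J j k. \<forall>r<m. farr D i k f (u (gen n r)) = farr D j k g (w (gen n r))"
    if "m \<le> n" for m
    using that
  proof (induction m)
    case 0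
    obtain k f g where "k \<in> obj J" "f \<in> arr J i k" "g \<in> arr J j k" using i j by (rule cospan_J)
    then show ?case by auto
  next
    case (Suc m)
    then obtain k f g where k: "k \<in> obj J" and f: "f \<in> arr J i k" and g: "g \<in> arr J j k"
      and fg: "\<And>r. r < m \<Longrightarrow> farr D i k f (u (gen n r)) = farr D j k g (w (gen n r))" by auto
    have m: "m < n" using Suc.prems by simp
    let ?x = "farr D i k f (u (gen n m))" and ?y = "farr D j k g (w (gen n m))"
    have x: "?x \<in> carrier (fobj D k)" and y: "?y \<in> carrier (fobj D k)"
      using mem[OF i k f um[OF m]] mem[OF j k g wm[OF m]] .
    have "l i (u (gen n m)) = l j (w (gen n m))"
      using fun_cong[OF eq, of "gen n m"] by (simp add: compose_eq gen_mem[OF m])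
    then have "l k ?x = l k ?y" using l_tr[OF i k f um[OF m]] l_tr[OF j k g wm[OF m]] by simp
    then obtain k' a b where k': "k' \<in> obj J" and a: "a \<in> arr J k k'" and b: "b \<in> arr J k k'"
      and ab: "farr D k k' a ?x = farr D k k' b ?y" using colimit_eqD[OF L k k x y] by blast
    obtain t c where t: "t \<in> obj J" and c: "c \<in> arr J k' t"
      and cab: "\<And>x. x \<in> carrier (fobj D k) \<Longrightarrow> farr D k' t c (farr D k k' a x) = farr D k' t c (farr D k k' b x)"
      using k k' a b by (rule coequalize_J) blast
    let ?f = "cmp J i k' t c (cmp J i k k' a f)" and ?g = "cmp J j k' t c (cmp J j k k' b g)"
    note af = cmp[OF i k k' f a] and bg = cmp[OF j k k' g b]
    have "?f \<in> arr J i t" "?g \<in> arr J j t" using cmp[OF i k' t af c] cmp[OF j k' t bg c] .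
    moreover have "farr D i t ?f (u (gen n r)) = farr D j t ?g (w (gen n r))" if "r < Suc m" for r
    proof -
      have r: "r < n" using that m by simp
      note ex = Dc[OF i k' t af c um[OF r]] Dc[OF i k k' f a um[OF r]]
        Dc[OF j k' t bg c wm[OF r]] Dc[OF j k k' g b wm[OF r]]
      show ?thesis
      proof (cases "r < m")
        case True
        then show ?thesis using ex fg[OF True] cab[OF mem[OF j k g wm[OF r]]] by simp
      next
        case False
        then have "r = m" using that by simp
        then show ?thesis using ex ab by simp
      qed
    qed
    ultimately show ?case using t by blast
  qed
  from this[OF order_refl] obtain k f g where k: "k \<in> obj J" and f: "f \<in> arr J i k" and g: "g \<in> arr J j k"
    and fg: "\<And>r. r < n \<Longrightarrow> farr D i k f (u (gen n r)) = farr D j k g (w (gen n r))" by blast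
  have "compose (carrier (std n)) (farr D i k f) u = compose (carrier (std n)) (farr D j k g) w"
    by (rule std_arr_eqI[OF functor_obj[OF D k] comp_arr[OF std_obj u functor_arr[OF D i k f]]
          comp_arr[OF std_obj w functor_arr[OF D j k g]]])
      (simp add: compose_eq gen_mem fg)
  with k f g show ?thesis by (rule that)
qed

end

text \<open>
  A cocone \<open>l'\<close> on the values at the stages induces a map on \<open>(v, x)\<close> by factoring \<open>v\<close> through some
  stage \<open>i\<close> as \<open>l i \<circ> u\<close> and applying \<open>l' i\<close> to \<open>(u, x)\<close>.
\<close>

lemma (in functor_on_free) kan_preserves_filtered_colimits:
  "preserves_filtered_colimits small Mods Mods kan"
  unfolding preserves_filtered_colimits_def
proof (intro allI impI)
  fix J :: "('u, 'u) category" and D L l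
  assume "small_category small J \<and> filtered J \<and> is_functor J Mods D \<and> is_colimit J Mods D L l"
  then have J: "small_category small J" "filtered J" and D: "is_functor J Mods D" and L: "is_colimit J Mods D L l"
    by blast+
  interpret FD: filtered_diagram small R J D
    by (intro filtered_diagram.intro filtered_diagram_axioms.intro module_universe_axioms J D)
  note coc = colimit_cocone[OF L]
  note Lobj = cocone_obj[OF coc] and l = cocone_arr[OF coc] and l_tr = cocone_comp[OF coc]
  note Dobj = functor_obj[OF D] and Darr = functor_arr[OF D]
  let ?KD = "func_comp kan D" and ?kl = "\<lambda>i. kan_map (fobj D i) L (l i)"
  have KD: "fobj ?KD i = kan_obj (fobj D i)" "farr ?KD i j f = kan_map (fobj D i) (fobj D j) (farr D i j f)" for i j f
    by (simp_all add: func_comp_def kan_simps)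
  have kl: "?kl i \<in> arr Mods (kan_obj (fobj D i)) (kan_obj L)" if "i \<in> obj J" for i
    using Dobj[OF that] Lobj l[OF that] by (rule kan_map_arr)
  have cocone: "is_cocone J Mods ?KD (kan_obj L) ?kl"
    unfolding is_cocone_def KD cmp_MOD
    using kan_obj[OF Lobj] kl kan_map_comp[OF Dobj Dobj Lobj Darr l, symmetric] l_tr by simp
  have "\<exists>!h. h \<in> arr Mods (kan_obj L) L' \<and> (\<forall>i\<in>obj J. compose (carrier (kan_obj (fobj D i))) h (?kl i) = l' i)"
    if coc': "is_cocone J Mods ?KD L' l'" for L' l'
  proof -
    note L' = cocone_obj[OF coc'] and l' = cocone_arr[OF coc', unfolded KD] and l'_tr = cocone_comp[OF coc', unfolded KD]
    have push: "l' j (kan_in (fobj D j) n (compose (carrier (std n)) (farr D i j f) u) x) = l' i (kan_in (fobj D i) n u x)"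
      if ij: "i \<in> obj J" "j \<in> obj J" "f \<in> arr J i j" and u: "u \<in> arr Mods (std n) (fobj D i)" and x: "x \<in> carrier (FS n)"
      for i j f n u x
      using fun_cong[OF l'_tr[OF ij], of "kan_in (fobj D i) n u x"] kan_in_mem[OF Dobj[OF ij(1)] u x]
        kan_map_in[OF Dobj[OF ij(1)] Dobj[OF ij(2)] Darr[OF ij] u x]
      by (simp add: compose_eq)
    have indep: "l' i (kan_in (fobj D i) n u x) = l' j (kan_in (fobj D j) n w x)"
      if i: "i \<in> obj J" and j: "j \<in> obj J" and u: "u \<in> arr Mods (std n) (fobj D i)"
        and w: "w \<in> arr Mods (std n) (fobj D j)"
        and eq: "compose (carrier (std n)) (l i) u = compose (carrier (std n)) (l j) w" and x: "x \<in> carrier (FS n)"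
      for i j n u w x
    proof -
      obtain k f g where k: "k \<in> obj J" "f \<in> arr J i k" "g \<in> arr J j k"
        "compose (carrier (std n)) (farr D i k f) u = compose (carrier (std n)) (farr D j k g) w"
        using L i j u w eq by (rule FD.std_eventually_equal)
      show ?thesis using push[OF i k(1,2) u x] push[OF j k(1,3) w x] k(4) by simp
    qed
    \<comment> \<open>A stage and a factorization through it, for each map into the colimit.\<close>
    define st where "st n v = (SOME p. fst p \<in> obj J \<and> snd p \<in> arr Mods (std n) (fobj D (fst p)) \<and>
      compose (carrier (std n)) (l (fst p)) (snd p) = v)" for n v
    have st: "fst (st n v) \<in> obj J" "snd (st n v) \<in> arr Mods (std n) (fobj D (fst (st n v)))"
        "compose (carrier (std n)) (l (fst (st n v))) (snd (st n v)) = v"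
      if v: "v \<in> arr Mods (std n) L" for n v
    proof -
      obtain i u where "i \<in> obj J" "u \<in> arr Mods (std n) (fobj D i)" "compose (carrier (std n)) (l i) u = v"
        using L v by (rule FD.std_factors_through_stage)
      then have "\<exists>p. fst p \<in> obj J \<and> snd p \<in> arr Mods (std n) (fobj D (fst p)) \<and>
          compose (carrier (std n)) (l (fst p)) (snd p) = v" by auto
      from someI_ex[OF this] show "fst (st n v) \<in> obj J" "snd (st n v) \<in> arr Mods (std n) (fobj D (fst (st n v)))"
        "compose (carrier (std n)) (l (fst (st n v))) (snd (st n v)) = v" unfolding st_def by blast+
    qed
    define g where "g n v x = l' (fst (st n v)) (kan_in (fobj D (fst (st n v))) n (snd (st n v)) x)" for n v x
    have g_eq: "g n (compose (carrier (std n)) (l i) u) x = l' i (kan_in (fobj D i) n u x)"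
      if i: "i \<in> obj J" and u: "u \<in> arr Mods (std n) (fobj D i)" and x: "x \<in> carrier (FS n)" for i n u x
    proof -
      have v: "compose (carrier (std n)) (l i) u \<in> arr Mods (std n) L" using std_obj u l[OF i] by (rule comp_arr)
      show ?thesis unfolding g_def using st(1)[OF v] i st(2)[OF v] u st(3)[OF v] x by (rule indep)
    qed
    have g_hom: "g n v \<in> module_hom R (FS n) L'" if v: "v \<in> arr Mods (std n) L" for n v
      unfolding g_def
      using module_hom_compose[OF kan_in_hom[OF Dobj[OF st(1)[OF v]] st(2)[OF v]] arr_hom[OF l'[OF st(1)[OF v]]]] .
    have g_push: "g n (compose (carrier (std n)) w \<phi>) x = g m w (FA n m \<phi> x)"
      if w: "w \<in> arr Mods (std m) L" and \<phi>: "\<phi> \<in> arr Mods (std n) (std m)" and x: "x \<in> carrier (FS n)" for n m w \<phi> x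
    proof -
      obtain i u where i: "i \<in> obj J" and u: "u \<in> arr Mods (std m) (fobj D i)"
        and w': "w = compose (carrier (std m)) (l i) u"
        using L w by (rule FD.std_factors_through_stage) blast
      have "compose (carrier (std n)) w \<phi> = compose (carrier (std n)) (l i) (compose (carrier (std n)) u \<phi>)"
        unfolding w' by (rule comp_assoc[OF \<phi>, symmetric])
      then show ?thesis
        using g_eq[OF i comp_arr[OF std_obj \<phi> u] x] g_eq[OF i u FA_mem[OF \<phi> x]] kan_in_push[OF Dobj[OF i] u \<phi> x] w'
        by simp
    qed
    let ?h = "kan_ext L L' g"
    have h: "?h \<in> arr Mods (kan_obj L) L'"
      by (rule kan_ext_arr[OF Lobj L']) (simp_all add: g_hom g_push)
    have h_in: "?h (kan_in L n v x) = g n v x" if "v \<in> arr Mods (std n) L" "x \<in> carrier (FS n)" for n v x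
      by (rule kan_ext_eq[OF Lobj L']) (simp_all add: g_hom g_push that)
    have hl: "compose (carrier (kan_obj (fobj D i))) ?h (?kl i) = l' i" if i: "i \<in> obj J" for i
    proof (rule kan_arr_eqI[OF Dobj[OF i] comp_arr[OF kan_obj[OF Dobj[OF i]] kl[OF i] h] l'[OF i]])
      fix n v x assume v: "v \<in> arr Mods (std n) (fobj D i)" and x: "x \<in> carrier (FS n)"
      show "compose (carrier (kan_obj (fobj D i))) ?h (?kl i) (kan_in (fobj D i) n v x) = l' i (kan_in (fobj D i) n v x)"
        using kan_in_mem[OF Dobj[OF i] v x] kan_map_in[OF Dobj[OF i] Lobj l[OF i] v x]
          h_in[OF comp_arr[OF std_obj v l[OF i]] x] g_eq[OF i v x] by (simp add: compose_eq)
    qed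
    have uniq: "h' = ?h"
      if h': "h' \<in> arr Mods (kan_obj L) L'"
        and h'l: "\<forall>i\<in>obj J. compose (carrier (kan_obj (fobj D i))) h' (?kl i) = l' i" for h'
    proof (rule kan_arr_eqI[OF Lobj h' h])
      fix n v x assume v: "v \<in> arr Mods (std n) L" and x: "x \<in> carrier (FS n)"
      obtain i u where i: "i \<in> obj J" and u: "u \<in> arr Mods (std n) (fobj D i)"
        and v': "v = compose (carrier (std n)) (l i) u"
        using L v by (rule FD.std_factors_through_stage) blast
      have "h' (kan_in L n v x) = l' i (kan_in (fobj D i) n u x)"
        using fun_cong[OF h'l[rule_format, OF i], of "kan_in (fobj D i) n u x"] kan_in_mem[OF Dobj[OF i] u x]
          kan_map_in[OF Dobj[OF i] Lobj l[OF i] u x] v' by (simp add: compose_eq)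
      then show "h' (kan_in L n v x) = ?h (kan_in L n v x)" using h_in[OF v x] g_eq[OF i u x] v' by simp
    qed
    show ?thesis
    proof (rule ex1I[of _ ?h])
      show "?h \<in> arr Mods (kan_obj L) L' \<and> (\<forall>i\<in>obj J. compose (carrier (kan_obj (fobj D i))) ?h (?kl i) = l' i)"
        using h hl by blast
    qed (elim conjE, rule uniq)
  qed
  with cocone show "is_colimit J Mods (func_comp kan D) (fobj kan L) (\<lambda>i. farr kan (fobj D i) L (l i))"
    unfolding is_colimit_def cmp_MOD KD kan_simps by blast
qed

section \<open>Natural transformations that are isomorphisms on finite free modules\<close>

context module_universe
begin

definition free_map :: "'x set \<Rightarrow> 'x set \<Rightarrow> 'u \<Rightarrow> 'u" where
  "free_map S T = free_ext S (free_obj S) (free_gen S) (free_obj T) (free_gen T)"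

lemma free_map:
  assumes S: "ess_small S" and T: "ess_small T" and ST: "S \<subseteq> T"
  shows free_map_arr: "free_map S T \<in> arr Mods (free_obj S) (free_obj T)"
    and free_map_gen: "x \<in> S \<Longrightarrow> free_map S T (free_gen S x) = free_gen T x"
  using free_ext_arr[OF free_on_free_obj[OF S] free_on_obj[OF free_on_free_obj[OF T]]]
    free_ext_eq[OF free_on_free_obj[OF S] free_on_obj[OF free_on_free_obj[OF T]]]
    free_on_mem[OF free_on_free_obj[OF T]] ST
  unfolding free_map_def by blast+

lemma small_singleton: "small {u}"
proof -
  obtain W where W: "small W" "infinite W" using small_infinite by blast
  have "small ((\<lambda>_. u) ` W)" using W(1) by (rule small_image)
  moreover have "W \<noteq> {}" using W(2) by auto
  then have "(\<lambda>_. u) ` W = {u}" by auto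
  ultimately show ?thesis by simp
qed

text \<open>
  The index category is the directed set of finite subsets of \<open>X\<close>, encoded as elements of the type
  that carries the universe.
\<close>

lemma free_module_filtered_colimit:
  fixes X :: "'u set"
  assumes X: "small X"
  obtains J :: "('u, 'u) category" and D and l and dec :: "'u \<Rightarrow> 'u set" where
    "small_category small J" "filtered J" "is_functor J Mods D" "is_colimit J Mods D (free_obj X) l"
    "\<And>i. i \<in> obj J \<Longrightarrow> finite (dec i) \<and> dec i \<subseteq> X \<and> fobj D i = free_obj (dec i) \<and> l i = free_map (dec i) X"
proof -
  let ?Fin = "{S. finite S \<and> S \<subseteq> X}"
  have Xs: "ess_small X" using X by (simp add: ess_small_iff_small)
  obtain enc :: "'u set \<Rightarrow> 'u" where enc: "inj_on enc ?Fin" "small (enc ` ?Fin)"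
    using ess_small_finite_subsets[OF Xs] by (rule ess_small_encode)
  define dec where "dec = inv_into ?Fin enc"
  have dec_enc: "dec (enc S) = S" if "finite S" "S \<subseteq> X" for S using enc(1) that by (simp add: dec_def)
  define u0 :: 'u where "u0 = undefined"
  \<comment> \<open>The element \<open>u0\<close> serves as the only arrow between comparable subsets.\<close>
  define J :: "('u, 'u) category" where
    "J = \<lparr>obj = enc ` ?Fin, arr = (\<lambda>i j. if dec i \<subseteq> dec j then {u0} else {}),
          idt = (\<lambda>_. u0), cmp = (\<lambda>_ _ _ _ _. u0)\<rparr>"
  have dec: "finite (dec i)" "dec i \<subseteq> X" if "i \<in> obj J" for i
  proof -
    obtain S where "i = enc S" "finite S" "S \<subseteq> X" using \<open>i \<in> obj J\<close> unfolding J_def by auto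
    then show "finite (dec i)" "dec i \<subseteq> X" by (simp_all add: dec_enc)
  qed
  have decs: "ess_small (dec i)" if "i \<in> obj J" for i
    using ess_small_subset[OF Xs dec(2)[OF that]] .
  have arrJ: "f \<in> arr J i j \<longleftrightarrow> f = u0 \<and> dec i \<subseteq> dec j" for f i j by (simp add: J_def)
  have enc_obj: "enc S \<in> obj J" if "finite S" "S \<subseteq> X" for S using that by (simp add: J_def)
  have "category J" by unfold_locales (auto simp: J_def split: if_splits)
  then have J1: "small_category small J"
    using enc(2) small_singleton[of u0] small_subset[OF small_singleton[of u0], of "{}"]
    by (simp add: small_category_def J_def)
  have J2: "filtered J"
    unfolding filtered_def
  proof (intro conjI ballI)
    show "obj J \<noteq> {}" using enc_obj[of "{}"] by auto
    fix i j assume i: "i \<in> obj J" and j: "j \<in> obj J"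
    let ?k = "enc (dec i \<union> dec j)"
    have "?k \<in> obj J" using dec i j by (intro enc_obj) auto
    moreover have "dec ?k = dec i \<union> dec j" using dec i j by (intro dec_enc) auto
    then have "u0 \<in> arr J i ?k" "u0 \<in> arr J j ?k" by (simp_all add: arrJ)
    ultimately show "\<exists>k\<in>obj J. arr J i k \<noteq> {} \<and> arr J j k \<noteq> {}" by blast
    fix f g
    show "\<exists>k\<in>obj J. \<exists>h\<in>arr J j k. cmp J i j k h f = cmp J i j k h g"
      using j by (intro bexI[of _ j] bexI[of _ u0]) (simp_all add: J_def)
  qed
  define D :: "('u, 'u, ('a, 'u) module, 'u \<Rightarrow> 'u) func" where
    "D = \<lparr>fobj = (\<lambda>i. free_obj (dec i)), farr = (\<lambda>i j _. free_map (dec i) (dec j))\<rparr>"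
  define l where "l i = free_map (dec i) X" for i
  note fobj = free_on_obj[OF free_on_free_obj] and gen = free_on_mem[OF free_on_free_obj]
  note eqI = free_on_arr_eqI[OF free_on_free_obj]
  have comp: "compose (carrier (free_obj S)) (free_map T U) (free_map S T) = free_map S U"
    if S: "ess_small S" and T: "ess_small T" and U: "ess_small U" and "S \<subseteq> T" "T \<subseteq> U" for S T U :: "'u set"
  proof (rule eqI[OF S fobj[OF U]])
    show "compose (carrier (free_obj S)) (free_map T U) (free_map S T) \<in> arr Mods (free_obj S) (free_obj U)"
      using that by (intro comp_arr[OF fobj[OF S] free_map_arr free_map_arr])
    show "free_map S U \<in> arr Mods (free_obj S) (free_obj U)" using that by (intro free_map_arr) auto
    fix x assume x: "x \<in> S"
    then show "compose (carrier (free_obj S)) (free_map T U) (free_map S T) (free_gen S x) = free_map S U (free_gen S x)"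
      using that gen[OF S x] free_map_gen[OF S T _ x] free_map_gen[OF T U, of x] free_map_gen[OF S U _ x]
      by (auto simp: compose_eq)
  qed
  have D: "is_functor J Mods D"
    unfolding is_functor_def cmp_MOD
  proof (intro conjI ballI)
    show "fobj D i \<in> obj Mods" if "i \<in> obj J" for i using fobj[OF decs[OF that]] by (simp add: D_def)
    show "farr D i j f \<in> arr Mods (fobj D i) (fobj D j)"
      if "i \<in> obj J" "j \<in> obj J" "f \<in> arr J i j" for i j f
      using that free_map_arr[OF decs decs] by (simp add: D_def arrJ)
    show "farr D i i (idt J i) = idt Mods (fobj D i)" if i: "i \<in> obj J" for i
    proof -
      have "free_map (dec i) (dec i) = idt Mods (free_obj (dec i))"
        using category.idt_arr[OF category_MOD fobj[OF decs[OF i]]]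
        by (intro eqI[OF decs[OF i] fobj[OF decs[OF i]] free_map_arr[OF decs[OF i] decs[OF i]]])
          (simp_all add: free_map_gen[OF decs[OF i] decs[OF i]] idt_MOD gen[OF decs[OF i]])
      then show ?thesis by (simp add: D_def)
    qed
    show "farr D i k (cmp J i j k g f) = compose (carrier (fobj D i)) (farr D j k g) (farr D i j f)"
      if "i \<in> obj J" "j \<in> obj J" "k \<in> obj J" "f \<in> arr J i j" "g \<in> arr J j k" for i j k f g
      using that comp[OF decs decs decs] by (simp add: D_def arrJ)
  qed
  have l_arr: "l i \<in> arr Mods (fobj D i) (free_obj X)" if i: "i \<in> obj J" for i
    using free_map_arr[OF decs[OF i] Xs dec(2)[OF i]] by (simp add: l_def D_def)
  have cocone: "is_cocone J Mods D (free_obj X) l"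
    unfolding is_cocone_def cmp_MOD
  proof (intro conjI ballI)
    show "free_obj X \<in> obj Mods" using fobj[OF Xs] .
    show "l i \<in> arr Mods (fobj D i) (free_obj X)" if "i \<in> obj J" for i using that by (rule l_arr)
    show "compose (carrier (fobj D i)) (l j) (farr D i j f) = l i"
      if "i \<in> obj J" "j \<in> obj J" "f \<in> arr J i j" for i j f
      using that comp[OF decs decs Xs _ dec(2)] by (simp add: D_def arrJ l_def)
  qed
  have "\<exists>!h. h \<in> arr Mods (free_obj X) L' \<and> (\<forall>i\<in>obj J. compose (carrier (fobj D i)) h (l i) = l' i)"
    if coc: "is_cocone J Mods D L' l'" for L' l'
  proof -
    note L' = cocone_obj[OF coc] and l' = cocone_arr[OF coc] and l'_tr = cocone_comp[OF coc]
    define g where "g x = l' (enc {x}) (free_gen {x} x)" for x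
    have sing: "enc {x} \<in> obj J" "dec (enc {x}) = {x}" if "x \<in> X" for x
      using that enc_obj[of "{x}"] dec_enc[of "{x}"] by simp_all
    have l'_gen: "l' i (free_gen (dec i) x) = g x" if i: "i \<in> obj J" and x: "x \<in> dec i" for i x
    proof -
      have xX: "x \<in> X" using dec(2)[OF i] x by blast
      note s = sing[OF xX]
      have ess: "ess_small {x}" using decs[OF s(1)] s(2) by simp
      have "compose (carrier (fobj D (enc {x}))) (l' i) (farr D (enc {x}) i u0) = l' (enc {x})"
        using s x by (intro l'_tr i) (simp_all add: arrJ)
      from fun_cong[OF this, of "free_gen {x} x"] show ?thesis
        using gen[OF ess, of x] free_map_gen[OF ess decs[OF i], of x] x
        by (simp add: D_def s g_def compose_eq)
    qed
    have g: "g x \<in> carrier L'" if "x \<in> X" for x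
      using arr_mem[OF l'[OF sing(1)[OF that]]] gen[OF decs[OF sing(1)[OF that]], of x] sing(2)[OF that]
      by (simp add: g_def D_def)
    let ?h = "free_ext X (free_obj X) (free_gen X) L' g"
    have h: "?h \<in> arr Mods (free_obj X) L'" and hx: "\<And>x. x \<in> X \<Longrightarrow> ?h (free_gen X x) = g x"
      using free_ext_arr[OF free_on_free_obj[OF Xs] L' g] free_ext_eq[OF free_on_free_obj[OF Xs] L' g] by auto
    have hl: "compose (carrier (fobj D i)) k (l i) = l' i"
      if i: "i \<in> obj J" and k: "k \<in> arr Mods (free_obj X) L'" and kx: "\<And>x. x \<in> X \<Longrightarrow> k (free_gen X x) = g x" for i k
    proof (rule eqI[OF decs[OF i] L'])
      have Di: "fobj D i = free_obj (dec i)" by (simp add: D_def)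
      show "compose (carrier (fobj D i)) k (l i) \<in> arr Mods (free_obj (dec i)) L'"
        using comp_arr[OF fobj[OF decs[OF i]] _ k] l_arr[OF i] by (simp add: Di)
      show "l' i \<in> arr Mods (free_obj (dec i)) L'" using l'[OF i] by (simp add: Di)
      fix x assume x: "x \<in> dec i"
      then show "compose (carrier (fobj D i)) k (l i) (free_gen (dec i) x) = l' i (free_gen (dec i) x)"
        using gen[OF decs[OF i] x] dec(2)[OF i] free_map_gen[OF decs[OF i] Xs dec(2)[OF i] x] kx l'_gen[OF i x]
        by (auto simp: Di compose_eq l_def)
    qed
    show ?thesis
    proof (rule ex1I[of _ ?h])
      show "?h \<in> arr Mods (free_obj X) L' \<and> (\<forall>i\<in>obj J. compose (carrier (fobj D i)) ?h (l i) = l' i)"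
        using h hl[OF _ h hx] by blast
      fix k assume k: "k \<in> arr Mods (free_obj X) L' \<and> (\<forall>i\<in>obj J. compose (carrier (fobj D i)) k (l i) = l' i)"
      show "k = ?h"
      proof (rule eqI[OF Xs L' _ h])
        show "k \<in> arr Mods (free_obj X) L'" using k by blast
        fix x assume x: "x \<in> X"
        note s = sing[OF x]
        have ess: "ess_small {x}" using decs[OF s(1)] s(2) by simp
        have "compose (carrier (fobj D (enc {x}))) k (l (enc {x})) = l' (enc {x})" using k s(1) by blast
        from fun_cong[OF this, of "free_gen {x} x"]
        have "k (free_gen X x) = g x"
          using gen[OF ess, of x] free_map_gen[OF ess Xs, of x] x by (simp add: D_def s l_def g_def compose_eq)
        then show "k (free_gen X x) = ?h (free_gen X x)" using hx[OF x] by simp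
      qed
    qed
  qed
  with cocone have "is_colimit J Mods D (free_obj X) l" unfolding is_colimit_def cmp_MOD by blast
  with J1 J2 D show ?thesis
    using dec by (intro that[of J D l dec]) (simp_all add: D_def l_def)
qed

lemma functor_comp:
  assumes "is_functor J Mods D" "is_functor Mods Mods G"
  shows "is_functor J Mods (func_comp G D)"
  using assms unfolding is_functor_def func_comp_def by simp

lemma nat_trans_apply:
  assumes "nat_trans Mods Mods G G' \<eta>" "A \<in> obj Mods" "B \<in> obj Mods" "f \<in> arr Mods A B" "x \<in> carrier (fobj G A)"
  shows "\<eta> B (farr G A B f x) = farr G' A B f (\<eta> A x)"
proof -
  have "compose (carrier (fobj G A)) (\<eta> B) (farr G A B f) = compose (carrier (fobj G A)) (farr G' A B f) (\<eta> A)"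
    using assms(1-4) unfolding nat_trans_def cmp_MOD by blast
  from fun_cong[OF this, of x] assms(5) show ?thesis by (simp add: compose_eq)
qed

text \<open>
  Both \<open>A\<close> and \<open>B\<close> are free, on the kernel of \<open>\<beta>\<close> and on the carrier of \<open>M\<close>.
\<close>

lemma presentation_exists:
  assumes M: "M \<in> obj Mods"
  obtains A B :: "('a, 'u) module" and \<alpha> \<beta> P p q where "B = free_obj (carrier M)" "A \<in> obj Mods" "B \<in> obj Mods" "P \<in> obj Mods"
    "\<alpha> \<in> arr Mods A B" "\<beta> \<in> arr Mods B M" "right_exact_seq A B M \<alpha> \<beta>" "is_direct_sum R A B P p q"
proof -
  let ?X = "carrier M"
  have Xs: "ess_small ?X" using M by (simp add: ess_small_iff_small mem_obj_MOD)
  note FB = free_on_free_obj[OF Xs]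
  let ?B = "free_obj ?X"
  note B = free_on_obj[OF FB]
  define \<beta> where "\<beta> = free_ext ?X ?B (free_gen ?X) M (\<lambda>x. x)"
  have \<beta>: "\<beta> \<in> arr Mods ?B M" and \<beta>x: "\<And>x. x \<in> ?X \<Longrightarrow> \<beta> (free_gen ?X x) = x"
    unfolding \<beta>_def using free_ext_arr[OF FB M] free_ext_eq[OF FB M] by auto
  have surj: "\<beta> ` carrier ?B = carrier M"
  proof
    show "\<beta> ` carrier ?B \<subseteq> carrier M" using arr_mem[OF \<beta>] by blast
    show "carrier M \<subseteq> \<beta> ` carrier ?B"
    proof
      fix x assume x: "x \<in> carrier M"
      then show "x \<in> \<beta> ` carrier ?B" using \<beta>x[OF x] free_on_mem[OF FB x] by (metis imageI)
    qed
  qed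
  let ?K = "a_kernel ?B M \<beta>"
  have K: "?K \<subseteq> carrier ?B" by (auto simp: a_kernel_def')
  have "small ?K" by (rule small_subset[OF _ K]) (use B in \<open>simp add: mem_obj_MOD\<close>)
  then have Ks: "ess_small ?K" by (simp add: ess_small_iff_small)
  note FA = free_on_free_obj[OF Ks]
  let ?A = "free_obj ?K"
  note A = free_on_obj[OF FA]
  define \<alpha> where "\<alpha> = free_ext ?K ?A (free_gen ?K) ?B (\<lambda>x. x)"
  have \<alpha>: "\<alpha> \<in> arr Mods ?A ?B" and \<alpha>x: "\<And>x. x \<in> ?K \<Longrightarrow> \<alpha> (free_gen ?K x) = x"
    unfolding \<alpha>_def using free_ext_arr[OF FA B, of "\<lambda>x. x"] free_ext_eq[OF FA B, of "\<lambda>x. x"] K by blast+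
  interpret M: module R M using M by (rule obj_module)
  let ?z = "restrict (\<lambda>_. \<zero>\<^bsub>M\<^esub>) (carrier ?A)"
  have z: "?z \<in> arr Mods ?A M"
    by (intro restrict_arr obj_module A module_homI) auto
  have comp_zero: "compose (carrier ?A) \<beta> \<alpha> = ?z"
  proof (rule free_on_arr_eqI[OF FA M comp_arr[OF A \<alpha> \<beta>] z])
    fix x assume x: "x \<in> ?K"
    then show "compose (carrier ?A) \<beta> \<alpha> (free_gen ?K x) = ?z (free_gen ?K x)"
      using free_on_mem[OF FA x] \<alpha>x[OF x] by (simp add: compose_eq a_kernel_def')
  qed
  have \<beta>\<alpha>: "\<beta> (\<alpha> y) = \<zero>\<^bsub>M\<^esub>" if "y \<in> carrier ?A" for y
    using that fun_cong[OF comp_zero, of y] by (simp add: compose_eq)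
  have "\<alpha> ` carrier ?A = ?K"
  proof
    show "\<alpha> ` carrier ?A \<subseteq> ?K" using \<beta>\<alpha> arr_mem[OF \<alpha>] by (auto simp: a_kernel_def')
    show "?K \<subseteq> \<alpha> ` carrier ?A"
    proof
      fix x assume x: "x \<in> ?K"
      then show "x \<in> \<alpha> ` carrier ?A" using \<alpha>x[OF x] free_on_mem[OF FA x] by (metis imageI)
    qed
  qed
  then have ex: "right_exact_seq ?A ?B M \<alpha> \<beta>" using surj by (simp add: right_exact_seq_def)
  obtain P p q where P: "P \<in> obj Mods" "is_direct_sum R ?A ?B P p q" using A B by (rule direct_sum_exists)
  show ?thesis using A B P(1) \<alpha> \<beta> ex P(2) by (rule that[OF refl])
qed

end

locale comparison = module_universe small R
  for small :: "'u set \<Rightarrow> bool" and R :: "'a ring" +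
  fixes G G' :: "(('a, 'u) module, 'u \<Rightarrow> 'u, ('a, 'u) module, 'u \<Rightarrow> 'u) func"
    and \<eta> :: "('a, 'u) module \<Rightarrow> 'u \<Rightarrow> 'u"
  assumes G: "is_functor Mods Mods G" and G': "is_functor Mods Mods G'"
    and exact: "right_exact small R G" and exact': "right_exact small R G'"
    and colim: "preserves_filtered_colimits small Mods Mods G"
    and colim': "preserves_filtered_colimits small Mods Mods G'"
    and \<eta>: "nat_trans Mods Mods G G' \<eta>"
    and bij_Fmods: "L \<in> obj Fmods \<Longrightarrow> bij_betw (\<eta> L) (carrier (fobj G L)) (carrier (fobj G' L))"
begin

lemma \<eta>_arr: "A \<in> obj Mods \<Longrightarrow> \<eta> A \<in> arr Mods (fobj G A) (fobj G' A)"
  using \<eta> by (simp add: nat_trans_def)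

lemmas \<eta>_nat = nat_trans_apply[OF \<eta>]

text \<open>
  Surjectivity holds since every element comes from a finite stage. For injectivity, the inclusion
  of a finite stage \<open>free_obj S\<close> has a retraction, the projection that kills the generators outside
  \<open>S\<close>, so \<open>G'\<close> maps it to an injection.
\<close>

lemma bij_free:
  assumes X: "small X"
  shows "bij_betw (\<eta> (free_obj X)) (carrier (fobj G (free_obj X))) (carrier (fobj G' (free_obj X)))"
proof -
  let ?B = "free_obj X"
  have Xs: "ess_small X" using X by (simp add: ess_small_iff_small)
  note FB = free_on_free_obj[OF Xs]
  note B = free_on_obj[OF FB]
  obtain J :: "('u, 'u) category" and D l and dec :: "'u \<Rightarrow> 'u set" where J: "small_category small J" "filtered J"
    and D: "is_functor J Mods D" and L: "is_colimit J Mods D ?B l"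
    and fin: "\<And>i. i \<in> obj J \<Longrightarrow> finite (dec i) \<and> dec i \<subseteq> X \<and> fobj D i = free_obj (dec i) \<and> l i = free_map (dec i) X"
    using X by (rule free_module_filtered_colimit) blast
  have stage: "\<exists>i\<in>obj J. \<exists>x\<in>carrier (fobj H (fobj D i)). y = farr H (fobj D i) ?B (l i) x"
    if H: "is_functor Mods Mods H" and pres: "preserves_filtered_colimits small Mods Mods H"
      and y: "y \<in> carrier (fobj H ?B)" for H :: "(('a, 'u) module, 'u \<Rightarrow> 'u, ('a, 'u) module, 'u \<Rightarrow> 'u) func" and y
  proof -
    interpret FD: filtered_diagram small R J "func_comp H D"
      by (intro filtered_diagram.intro filtered_diagram_axioms.intro module_universe_axioms J functor_comp D H)
    have "is_colimit J Mods (func_comp H D) (fobj H ?B) (\<lambda>i. farr H (fobj D i) ?B (l i))"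
      using pres J D L unfolding preserves_filtered_colimits_def by blast
    from FD.colimit_cases[OF this y] show ?thesis by (simp add: func_comp_def)
  qed
  have decs: "ess_small (dec i)" if "i \<in> obj J" for i using fin[OF that] ess_small_subset[OF Xs] by blast
  have DF: "fobj D i \<in> obj Fmods" if "i \<in> obj J" for i
    using fin[OF that] free_on_Fmod[OF free_on_free_obj[OF decs[OF that]]] by simp
  have Dobj: "fobj D i \<in> obj Mods" if "i \<in> obj J" for i using functor_obj[OF D that] .
  have l: "l i \<in> arr Mods (fobj D i) ?B" if "i \<in> obj J" for i
    using fin[OF that] free_map_arr[OF decs[OF that] Xs] by simp
  have "\<eta> ?B ` carrier (fobj G ?B) = carrier (fobj G' ?B)"
  proof
    show "\<eta> ?B ` carrier (fobj G ?B) \<subseteq> carrier (fobj G' ?B)" using arr_mem[OF \<eta>_arr[OF B]] by blast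
    show "carrier (fobj G' ?B) \<subseteq> \<eta> ?B ` carrier (fobj G ?B)"
    proof
      fix y assume "y \<in> carrier (fobj G' ?B)"
      then obtain i x where i: "i \<in> obj J" and x: "x \<in> carrier (fobj G' (fobj D i))"
        and y: "y = farr G' (fobj D i) ?B (l i) x" using stage[OF G' colim'] by blast
      obtain w where w: "w \<in> carrier (fobj G (fobj D i))" "x = \<eta> (fobj D i) w"
        using bij_Fmods[OF DF[OF i]] x by (auto simp: bij_betw_def)
      have "y = \<eta> ?B (farr G (fobj D i) ?B (l i) w)" using \<eta>_nat[OF Dobj[OF i] B l[OF i] w(1)] y w(2) by simp
      then show "y \<in> \<eta> ?B ` carrier (fobj G ?B)" using functor_mem[OF G Dobj[OF i] B l[OF i] w(1)] by blast
    qed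
  qed
  moreover have "inj_on (\<eta> ?B) (carrier (fobj G ?B))"
    unfolding module_hom_inj_on_iff[OF obj_module[OF functor_obj[OF G B]] obj_module[OF functor_obj[OF G' B]] arr_hom[OF \<eta>_arr[OF B]]]
  proof (intro ballI impI)
    fix y assume y: "y \<in> carrier (fobj G ?B)" and y0: "\<eta> ?B y = \<zero>\<^bsub>fobj G' ?B\<^esub>"
    obtain i x where i: "i \<in> obj J" and x: "x \<in> carrier (fobj G (fobj D i))"
      and yx: "y = farr G (fobj D i) ?B (l i) x" using stage[OF G colim y] by blast
    let ?S = "dec i"
    note FS = free_on_free_obj[OF decs[OF i]]
    have Di: "fobj D i = free_obj ?S" and li: "l i = free_map ?S X" and SX: "?S \<subseteq> X" using fin[OF i] by auto
    interpret Di: module R "free_obj ?S" using free_on_obj[OF FS] by (rule obj_module)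
    \<comment> \<open>The retraction of the stage \<open>S\<close>.\<close>
    define r where "r = free_ext X ?B (free_gen X) (free_obj ?S) (\<lambda>x. if x \<in> ?S then free_gen ?S x else \<zero>\<^bsub>free_obj ?S\<^esub>)"
    have rm: "(if x \<in> ?S then free_gen ?S x else \<zero>\<^bsub>free_obj ?S\<^esub>) \<in> carrier (free_obj ?S)" for x
      using free_on_mem[OF FS] by simp
    have r: "r \<in> arr Mods ?B (free_obj ?S)" and rx: "\<And>x. x \<in> ?S \<Longrightarrow> r (free_gen X x) = free_gen ?S x"
      unfolding r_def using free_ext_arr[OF FB free_on_obj[OF FS] rm] free_ext_eq[OF FB free_on_obj[OF FS] rm] SX by auto
    have lS: "free_map ?S X \<in> arr Mods (free_obj ?S) ?B" using decs[OF i] Xs SX by (rule free_map_arr)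
    have id: "idt Mods (free_obj ?S) \<in> arr Mods (free_obj ?S) (free_obj ?S)"
      using category.idt_arr[OF category_MOD free_on_obj[OF FS]] .
    have rl: "cmp Mods (free_obj ?S) ?B (free_obj ?S) r (free_map ?S X) = idt Mods (free_obj ?S)"
      unfolding cmp_MOD
    proof (rule free_on_arr_eqI[OF FS free_on_obj[OF FS] comp_arr[OF free_on_obj[OF FS] lS r] id])
      fix x assume x: "x \<in> ?S"
      then show "compose (carrier (free_obj ?S)) r (free_map ?S X) (free_gen ?S x) = idt Mods (free_obj ?S) (free_gen ?S x)"
        using free_on_mem[OF FS x] free_map_gen[OF decs[OF i] Xs SX x] rx[OF x] by (simp add: compose_eq idt_MOD)
    qed
    have x': "x \<in> carrier (fobj G (free_obj ?S))" using x Di by simp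
    let ?x = "\<eta> (free_obj ?S) x"
    note SO = free_on_obj[OF FS]
    have \<eta>x: "?x \<in> carrier (fobj G' (free_obj ?S))" using arr_mem[OF \<eta>_arr[OF SO] x'] .
    have "farr G' (free_obj ?S) ?B (free_map ?S X) ?x = \<zero>\<^bsub>fobj G' ?B\<^esub>"
      using \<eta>_nat[OF SO B lS x'] y0 yx Di li by simp
    then have "farr G' ?B (free_obj ?S) r (farr G' (free_obj ?S) ?B (free_map ?S X) ?x) = \<zero>\<^bsub>fobj G' (free_obj ?S)\<^esub>"
      using module_hom_zero[OF obj_module[OF functor_obj[OF G' B]] obj_module[OF functor_obj[OF G' SO]]
          functor_hom[OF G' B SO r]] by simp
    then have "?x = \<zero>\<^bsub>fobj G' (free_obj ?S)\<^esub>"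
      using functor_cmp[OF G' SO B SO lS r \<eta>x] functor_idt[OF G' SO \<eta>x] rl by simp
    moreover have "inj_on (\<eta> (free_obj ?S)) (carrier (fobj G (free_obj ?S)))"
      using bij_Fmods[OF DF[OF i]] Di by (simp add: bij_betw_def)
    ultimately have "x = \<zero>\<^bsub>fobj G (free_obj ?S)\<^esub>"
      using module_hom_inj_on_iff[OF obj_module[OF functor_obj[OF G SO]] obj_module[OF functor_obj[OF G' SO]]
          arr_hom[OF \<eta>_arr[OF SO]]] x' by blast
    then show "y = \<zero>\<^bsub>fobj G ?B\<^esub>"
      using yx Di li module_hom_zero[OF obj_module[OF functor_obj[OF G SO]] obj_module[OF functor_obj[OF G B]]
          functor_hom[OF G SO B lS]] by simp
  qed
  ultimately show ?thesis by (simp add: bij_betw_def)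
qed

lemma right_exactD:
  assumes H: "right_exact small R H"
    and "A \<in> obj Mods" "B \<in> obj Mods" "M \<in> obj Mods" "P \<in> obj Mods" "\<alpha> \<in> arr Mods A B" "\<beta> \<in> arr Mods B M"
    and "right_exact_seq A B M \<alpha> \<beta>" "is_direct_sum R A B P p q"
  shows "farr H B M \<beta> ` carrier (fobj H B) = carrier (fobj H M)"
    and "(\<lambda>y. farr H P B (restrict (\<lambda>x. \<alpha> (p x) \<oplus>\<^bsub>B\<^esub> q x) (carrier P)) y \<ominus>\<^bsub>fobj H B\<^esub> farr H P B q y) ` carrier (fobj H P)
      = a_kernel (fobj H B) (fobj H M) (farr H B M \<beta>)"
proof -
  have "right_exact_seq (fobj H P) (fobj H B) (fobj H M)
    (restrict (\<lambda>y. farr H P B (restrict (\<lambda>x. \<alpha> (p x) \<oplus>\<^bsub>B\<^esub> q x) (carrier P)) y \<ominus>\<^bsub>fobj H B\<^esub> farr H P B q y) (carrier (fobj H P)))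
    (farr H B M \<beta>)"
    using assms unfolding right_exact_def Let_def by blast
  then show "farr H B M \<beta> ` carrier (fobj H B) = carrier (fobj H M)"
    "(\<lambda>y. farr H P B (restrict (\<lambda>x. \<alpha> (p x) \<oplus>\<^bsub>B\<^esub> q x) (carrier P)) y \<ominus>\<^bsub>fobj H B\<^esub> farr H P B q y) ` carrier (fobj H P)
      = a_kernel (fobj H B) (fobj H M) (farr H B M \<beta>)"
    unfolding right_exact_seq_def by (simp_all add: image_restrict_eq)
qed

text \<open>
  Every module is a quotient of a free one, and right-exact functors preserve surjections.
\<close>

lemma surj_everywhere:
  assumes M: "M \<in> obj Mods"
  shows "\<eta> M ` carrier (fobj G M) = carrier (fobj G' M)"
proof
  show "\<eta> M ` carrier (fobj G M) \<subseteq> carrier (fobj G' M)" using arr_mem[OF \<eta>_arr[OF M]] by blast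
  show "carrier (fobj G' M) \<subseteq> \<eta> M ` carrier (fobj G M)"
  proof
    fix y assume y: "y \<in> carrier (fobj G' M)"
    obtain A B \<alpha> \<beta> P p q where B: "B = free_obj (carrier M)" and AB: "A \<in> obj Mods" "B \<in> obj Mods" "P \<in> obj Mods"
        "\<alpha> \<in> arr Mods A B" "\<beta> \<in> arr Mods B M" "right_exact_seq A B M \<alpha> \<beta>" "is_direct_sum R A B P p q"
      using M by (rule presentation_exists)
    have "small (carrier M)" using M by (simp add: mem_obj_MOD)
    note bij = bij_free[OF this, folded B]
    obtain b where b: "b \<in> carrier (fobj G' B)" "y = farr G' B M \<beta> b"
      using right_exactD(1)[OF exact' AB(1,2) M AB(3-7)] y by blast
    obtain w where w: "w \<in> carrier (fobj G B)" "b = \<eta> B w" using bij b by (auto simp: bij_betw_def)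
    have "y = \<eta> M (farr G B M \<beta> w)" using \<eta>_nat[OF AB(2) M AB(5) w(1)] b w by simp
    then show "y \<in> \<eta> M ` carrier (fobj G M)" using functor_mem[OF G AB(2) M AB(5) w(1)] by blast
  qed
qed

text \<open>
  A diagram chase in a presentation: surjectivity at the direct sum \<open>P\<close> and injectivity at the free
  module \<open>B\<close> give injectivity at \<open>M\<close>.
\<close>

lemma bij_everywhere:
  assumes M: "M \<in> obj Mods"
  shows "bij_betw (\<eta> M) (carrier (fobj G M)) (carrier (fobj G' M))"
proof -
  have "inj_on (\<eta> M) (carrier (fobj G M))"
    unfolding module_hom_inj_on_iff[OF obj_module[OF functor_obj[OF G M]] obj_module[OF functor_obj[OF G' M]] arr_hom[OF \<eta>_arr[OF M]]]
  proof (intro ballI impI)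
    fix z assume z: "z \<in> carrier (fobj G M)" and z0: "\<eta> M z = \<zero>\<^bsub>fobj G' M\<^esub>"
    obtain A B \<alpha> \<beta> P p q where B: "B = free_obj (carrier M)" and AB: "A \<in> obj Mods" "B \<in> obj Mods" "P \<in> obj Mods"
        "\<alpha> \<in> arr Mods A B" "\<beta> \<in> arr Mods B M" "right_exact_seq A B M \<alpha> \<beta>" "is_direct_sum R A B P p q"
      using M by (rule presentation_exists)
    have "small (carrier M)" using M by (simp add: mem_obj_MOD)
    note bij = bij_free[OF this, folded B]
    have p: "p \<in> arr Mods P A" and q: "q \<in> arr Mods P B" using AB(7) by (auto simp: is_direct_sum_def mem_arr_MOD)
    let ?s = "restrict (\<lambda>x. \<alpha> (p x) \<oplus>\<^bsub>B\<^esub> q x) (carrier P)"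
    have s: "?s \<in> arr Mods P B" using AB(3,2,4) p q by (rule sum_map_arr)
    note ker = right_exactD(2)[OF exact AB(1,2) M AB(3-7)] and ker' = right_exactD(2)[OF exact' AB(1,2) M AB(3-7)]
    obtain b where b: "b \<in> carrier (fobj G B)" "z = farr G B M \<beta> b"
      using right_exactD(1)[OF exact AB(1,2) M AB(3-7)] z by blast
    have "\<eta> B b \<in> a_kernel (fobj G' B) (fobj G' M) (farr G' B M \<beta>)"
      using \<eta>_nat[OF AB(2) M AB(5) b(1)] z0 b arr_mem[OF \<eta>_arr[OF AB(2)] b(1)] by (simp add: a_kernel_def')
    then obtain w' where w': "w' \<in> carrier (fobj G' P)"
      "\<eta> B b = farr G' P B ?s w' \<ominus>\<^bsub>fobj G' B\<^esub> farr G' P B q w'" using ker' by blast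
    obtain w where w: "w \<in> carrier (fobj G P)" "w' = \<eta> P w" using surj_everywhere[OF AB(3)] w'(1) by blast
    have sw: "farr G P B ?s w \<in> carrier (fobj G B)" "farr G P B q w \<in> carrier (fobj G B)"
      using functor_mem[OF G AB(3,2) s w(1)] functor_mem[OF G AB(3,2) q w(1)] .
    let ?d = "farr G P B ?s w \<ominus>\<^bsub>fobj G B\<^esub> farr G P B q w"
    interpret GB: module R "fobj G B" using functor_obj[OF G AB(2)] by (rule obj_module)
    have "\<eta> B b = \<eta> B ?d"
      using w'(2) w(2) \<eta>_nat[OF AB(3,2) s w(1)] \<eta>_nat[OF AB(3,2) q w(1)]
        module_hom_minus[OF obj_module[OF functor_obj[OF G AB(2)]] obj_module[OF functor_obj[OF G' AB(2)]]
          arr_hom[OF \<eta>_arr[OF AB(2)]] sw] by simp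
    then have "b = ?d" using bij b(1) sw by (auto simp: bij_betw_def inj_on_def)
    then have "b \<in> a_kernel (fobj G B) (fobj G M) (farr G B M \<beta>)" using ker w(1) by blast
    then show "z = \<zero>\<^bsub>fobj G M\<^esub>" using b(2) by (simp add: a_kernel_def')
  qed
  then show ?thesis using surj_everywhere[OF M] by (simp add: bij_betw_def)
qed

end


section \<open>Every extension is the Kan extension\<close>

locale extension = functor_on_free small R F
  for small :: "'u set \<Rightarrow> bool" and R :: "'a ring" and F +
  fixes G :: "(('a, 'u) module, 'u \<Rightarrow> 'u, ('a, 'u) module, 'u \<Rightarrow> 'u) func"
    and \<iota> :: "('a, 'u) module \<Rightarrow> 'u \<Rightarrow> 'u"
  assumes ext: "is_extension small R F G \<iota>"
    and G_exact: "right_exact small R G"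
    and G_colim: "preserves_filtered_colimits small Mods Mods G"
begin

lemma G_functor: "is_functor Mods Mods G" using ext by (simp add: is_extension_def)

lemma Fmods_Mods: "L \<in> obj Fmods \<Longrightarrow> L \<in> obj Mods" by (simp add: obj_FMOD)

lemma \<iota>: assumes L: "L \<in> obj Fmods"
  shows \<iota>_arr: "\<iota> L \<in> arr Mods (fobj G L) (fobj F L)"
    and \<iota>_bij: "bij_betw (\<iota> L) (carrier (fobj G L)) (carrier (fobj F L))"
proof -
  have "is_iso Mods (fobj G L) (fobj F L) (\<iota> L)" using ext L by (simp add: is_extension_def nat_iso_def)
  then show "\<iota> L \<in> arr Mods (fobj G L) (fobj F L)" "bij_betw (\<iota> L) (carrier (fobj G L)) (carrier (fobj F L))"
    using is_iso_MOD_iff[OF functor_obj[OF G_functor Fmods_Mods[OF L]] F_obj[OF L]] by blast+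
qed

lemma \<iota>_nat:
  assumes "A \<in> obj Fmods" "B \<in> obj Fmods" "f \<in> arr Mods A B" "x \<in> carrier (fobj G A)"
  shows "\<iota> B (farr G A B f x) = farr F A B f (\<iota> A x)"
proof -
  have "compose (carrier (fobj G A)) (\<iota> B) (farr G A B f) = compose (carrier (fobj G A)) (farr F A B f) (\<iota> A)"
    using ext assms(1-3) unfolding is_extension_def nat_iso_def nat_trans_def cmp_MOD arr_FMOD by blast
  from fun_cong[OF this, of x] assms(4) show ?thesis by (simp add: compose_eq)
qed

definition \<iota>_inv :: "nat \<Rightarrow> 'u \<Rightarrow> 'u" where
  "\<iota>_inv n = inv_into (carrier (fobj G (std n))) (\<iota> (std n))"

lemma \<iota>_inv_hom: "\<iota>_inv n \<in> module_hom R (FS n) (fobj G (std n))"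
  unfolding \<iota>_inv_def
  using obj_module[OF functor_obj[OF G_functor std_obj]] obj_module[OF F_obj[OF std_Fmods]]
    arr_hom[OF \<iota>_arr[OF std_Fmods]] \<iota>_bij[OF std_Fmods] by (rule module_hom_inv)

lemma \<iota>_\<iota>_inv: "x \<in> carrier (FS n) \<Longrightarrow> \<iota> (std n) (\<iota>_inv n x) = x"
  using \<iota>_bij[OF std_Fmods, of n] by (simp add: \<iota>_inv_def bij_betw_def f_inv_into_f)

lemma \<iota>_inv_\<iota>: "y \<in> carrier (fobj G (std n)) \<Longrightarrow> \<iota>_inv n (\<iota> (std n) y) = y"
  using \<iota>_bij[OF std_Fmods, of n] by (simp add: \<iota>_inv_def bij_betw_def)

lemma \<iota>_inv_nat:
  assumes \<phi>: "\<phi> \<in> arr Mods (std n) (std m)" and x: "x \<in> carrier (FS n)"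
  shows "farr G (std n) (std m) \<phi> (\<iota>_inv n x) = \<iota>_inv m (FA n m \<phi> x)"
proof -
  have y: "\<iota>_inv n x \<in> carrier (fobj G (std n))" using module_homD[OF \<iota>_inv_hom x] .
  have "\<iota> (std m) (farr G (std n) (std m) \<phi> (\<iota>_inv n x)) = FA n m \<phi> x"
    using \<iota>_nat[OF std_Fmods std_Fmods \<phi> y] \<iota>_\<iota>_inv[OF x] by simp
  then show ?thesis using \<iota>_inv_\<iota>[OF functor_mem[OF G_functor std_obj std_obj \<phi> y]] by simp
qed

text \<open>
  The natural transformation from the Kan extension given by its universal property.
\<close>

definition compare :: "('a, 'u) module \<Rightarrow> 'u \<Rightarrow> 'u" where
  "compare M = kan_ext M (fobj G M) (\<lambda>n v x. farr G (std n) M v (\<iota>_inv n x))"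

lemma compare:
  assumes M: "M \<in> obj Mods"
  shows compare_arr: "compare M \<in> arr Mods (kan_obj M) (fobj G M)"
    and compare_in: "\<lbrakk>v \<in> arr Mods (std n) M; x \<in> carrier (FS n)\<rbrakk>
      \<Longrightarrow> compare M (kan_in M n v x) = farr G (std n) M v (\<iota>_inv n x)"
proof -
  have hom: "(\<lambda>x. farr G (std n) M v (\<iota>_inv n x)) \<in> module_hom R (FS n) (fobj G M)"
    if "v \<in> arr Mods (std n) M" for n v
    using module_hom_compose[OF \<iota>_inv_hom functor_hom[OF G_functor std_obj M that]] .
  have push: "farr G (std n) M (compose (carrier (std n)) w \<phi>) (\<iota>_inv n x) = farr G (std m) M w (\<iota>_inv m (FA n m \<phi> x))"
    if "w \<in> arr Mods (std m) M" "\<phi> \<in> arr Mods (std n) (std m)" "x \<in> carrier (FS n)" for n m w \<phi> x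
    using functor_cmp[OF G_functor std_obj std_obj M that(2,1) module_homD[OF \<iota>_inv_hom that(3)]] \<iota>_inv_nat[OF that(2,3)]
    by (simp add: cmp_MOD)
  show "compare M \<in> arr Mods (kan_obj M) (fobj G M)"
    unfolding compare_def by (rule kan_ext_arr[OF M functor_obj[OF G_functor M]]) (simp_all add: hom push)
  show "compare M (kan_in M n v x) = farr G (std n) M v (\<iota>_inv n x)"
    if "v \<in> arr Mods (std n) M" "x \<in> carrier (FS n)"
    unfolding compare_def by (rule kan_ext_eq[OF M functor_obj[OF G_functor M]]) (simp_all add: hom push that)
qed

lemma compare_nat: "nat_trans Mods Mods kan G compare"
  unfolding nat_trans_def kan_simps cmp_MOD
proof (intro conjI ballI)
  show "compare M \<in> arr Mods (kan_obj M) (fobj G M)" if "M \<in> obj Mods" for M using that by (rule compare_arr)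
  fix A B f assume A: "A \<in> obj Mods" and B: "B \<in> obj Mods" and f: "f \<in> arr Mods A B"
  show "compose (carrier (kan_obj A)) (compare B) (kan_map A B f) = compose (carrier (kan_obj A)) (farr G A B f) (compare A)"
  proof (rule kan_arr_eqI[OF A])
    show "compose (carrier (kan_obj A)) (compare B) (kan_map A B f) \<in> arr Mods (kan_obj A) (fobj G B)"
      using kan_obj[OF A] kan_map_arr[OF A B f] compare_arr[OF B] by (rule comp_arr)
    show "compose (carrier (kan_obj A)) (farr G A B f) (compare A) \<in> arr Mods (kan_obj A) (fobj G B)"
      using kan_obj[OF A] compare_arr[OF A] functor_arr[OF G_functor A B f] by (rule comp_arr)
    fix n v x assume v: "v \<in> arr Mods (std n) A" and x: "x \<in> carrier (FS n)"
    show "compose (carrier (kan_obj A)) (compare B) (kan_map A B f) (kan_in A n v x)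
        = compose (carrier (kan_obj A)) (farr G A B f) (compare A) (kan_in A n v x)"
      using kan_in_mem[OF A v x] kan_map_in[OF A B f v x] compare_in[OF A v x] compare_in[OF B comp_arr[OF std_obj v f] x]
        functor_cmp[OF G_functor std_obj A B v f module_homD[OF \<iota>_inv_hom x]]
      by (simp add: compose_eq cmp_MOD)
  qed
qed

lemma \<iota>_compare:
  assumes L: "L \<in> obj Fmods" and z: "z \<in> carrier (kan_obj L)"
  shows "\<iota> L (compare L z) = kan_restr L z"
proof -
  have L': "L \<in> obj Mods" using L by (rule Fmods_Mods)
  obtain n v x where v: "v \<in> arr Mods (std n) L" and x: "x \<in> carrier (FS n)" and zx: "z = kan_in L n v x"
    using L' z by (rule kan_cases)
  show ?thesis
    using zx compare_in[OF L' v x] kan_restr_in[OF L v x] \<iota>_nat[OF std_Fmods L v module_homD[OF \<iota>_inv_hom x]] \<iota>_\<iota>_inv[OF x]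
    by simp
qed

lemma compare_bij_Fmods:
  assumes L: "L \<in> obj Fmods"
  shows "bij_betw (compare L) (carrier (kan_obj L)) (carrier (fobj G L))"
proof -
  have "bij_betw (inv_into (carrier (fobj G L)) (\<iota> L) \<circ> kan_restr L) (carrier (kan_obj L)) (carrier (fobj G L))"
    using kan_restr_bij[OF L] bij_betw_inv_into[OF \<iota>_bij[OF L]] by (rule bij_betw_trans)
  moreover have "(inv_into (carrier (fobj G L)) (\<iota> L) \<circ> kan_restr L) z = compare L z" if z: "z \<in> carrier (kan_obj L)" for z
    using \<iota>_compare[OF L z] \<iota>_bij[OF L] arr_mem[OF compare_arr[OF Fmods_Mods[OF L]] z]
    by (metis bij_betw_def comp_apply inv_into_f_f)
  ultimately show ?thesis using bij_betw_cong by blast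
qed

lemma compare_bij:
  assumes "M \<in> obj Mods"
  shows "bij_betw (compare M) (carrier (kan_obj M)) (carrier (fobj G M))"
proof -
  interpret C: comparison small R kan G compare
    by (intro comparison.intro comparison_axioms.intro module_universe_axioms kan_functor G_functor kan_right_exact G_exact
        kan_preserves_filtered_colimits G_colim compare_nat) (simp add: kan_simps compare_bij_Fmods)
  show ?thesis using C.bij_everywhere[OF assms] by (simp add: kan_simps)
qed

end

text \<open>
  The isomorphism runs backwards along the comparison map of \<open>G\<close> and forwards along that of \<open>G'\<close>.
\<close>

lemma extensions_unique:
  assumes "extension small R F G \<iota>" "extension small R F G' \<iota>'"
  shows "\<exists>\<theta>. nat_iso (MOD small R) (MOD small R) G G' \<theta> \<and>
    (\<forall>A \<in> obj (FMOD small R). cmp (MOD small R) (fobj G A) (fobj G' A) (fobj F A) (\<iota>' A) (\<theta> A) = \<iota> A)"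
proof -
  interpret E: extension small R F G \<iota> by fact
  interpret E': extension small R F G' \<iota>' by fact
  define pre where "pre M = inv_into (carrier (E.kan_obj M)) (E.compare M)" for M
  define \<theta> where "\<theta> M = restrict (\<lambda>y. E'.compare M (pre M y)) (carrier (fobj G M))" for M
  have pre_hom: "pre M \<in> module_hom R (fobj G M) (E.kan_obj M)" if M: "M \<in> obj E.Mods" for M
    unfolding pre_def using E.obj_module[OF E.kan_obj[OF M]] E.obj_module[OF functor_obj[OF E.G_functor M]]
      E.arr_hom[OF E.compare_arr[OF M]] E.compare_bij[OF M] by (rule module_hom_inv)
  have pre: "pre M y \<in> carrier (E.kan_obj M)" "E.compare M (pre M y) = y"
    if M: "M \<in> obj E.Mods" and y: "y \<in> carrier (fobj G M)" for M y
    using module_homD[OF pre_hom[OF M] y] E.compare_bij[OF M] y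
    by (auto simp: pre_def bij_betw_def f_inv_into_f)
  have \<theta>_arr: "\<theta> M \<in> arr E.Mods (fobj G M) (fobj G' M)" if M: "M \<in> obj E.Mods" for M
    unfolding \<theta>_def
    using E.obj_module[OF functor_obj[OF E.G_functor M]] module_hom_compose[OF pre_hom[OF M] E.arr_hom[OF E'.compare_arr[OF M]]]
    by (rule restrict_arr)
  have \<theta>_compare: "\<theta> M (E.compare M z) = E'.compare M z" if M: "M \<in> obj E.Mods" and z: "z \<in> carrier (E.kan_obj M)" for M z
    using z E.arr_mem[OF E.compare_arr[OF M] z] E.compare_bij[OF M] by (simp add: \<theta>_def pre_def bij_betw_def)
  have "bij_betw (\<theta> M) (carrier (fobj G M)) (carrier (fobj G' M))" if M: "M \<in> obj E.Mods" for M
  proof -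
    have "bij_betw (E'.compare M \<circ> pre M) (carrier (fobj G M)) (carrier (fobj G' M))"
      unfolding pre_def using bij_betw_inv_into[OF E.compare_bij[OF M]] E'.compare_bij[OF M] by (rule bij_betw_trans)
    moreover have "(E'.compare M \<circ> pre M) y = \<theta> M y" if "y \<in> carrier (fobj G M)" for y using that by (simp add: \<theta>_def)
    ultimately show ?thesis using bij_betw_cong by blast
  qed
  then have iso: "is_iso E.Mods (fobj G M) (fobj G' M) (\<theta> M)" if "M \<in> obj E.Mods" for M
    using that \<theta>_arr is_iso_MOD_iff[OF functor_obj[OF E.G_functor that] functor_obj[OF E'.G_functor that]] by blast
  have nat: "compose (carrier (fobj G A)) (\<theta> B) (farr G A B f) = compose (carrier (fobj G A)) (farr G' A B f) (\<theta> A)"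
    if A: "A \<in> obj E.Mods" and B: "B \<in> obj E.Mods" and f: "f \<in> arr E.Mods A B" for A B f
  proof (rule E.arr_eqI)
    show "compose (carrier (fobj G A)) (\<theta> B) (farr G A B f) \<in> arr E.Mods (fobj G A) (fobj G' B)"
      using functor_obj[OF E.G_functor A] functor_arr[OF E.G_functor A B f] \<theta>_arr[OF B] by (rule E.comp_arr)
    show "compose (carrier (fobj G A)) (farr G' A B f) (\<theta> A) \<in> arr E.Mods (fobj G A) (fobj G' B)"
      using functor_obj[OF E.G_functor A] \<theta>_arr[OF A] functor_arr[OF E'.G_functor A B f] by (rule E.comp_arr)
    fix y assume y: "y \<in> carrier (fobj G A)"
    let ?z = "pre A y"
    note z = pre[OF A y]
    have kz: "E.kan_map A B f ?z \<in> carrier (E.kan_obj B)" using E.arr_mem[OF E.kan_map_arr[OF A B f] z(1)] .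
    have n: "E.compare B (E.kan_map A B f ?z) = farr G A B f y"
      using E.nat_trans_apply[OF E.compare_nat A B f] z by (simp add: E.kan_simps)
    have n': "E'.compare B (E.kan_map A B f ?z) = farr G' A B f (E'.compare A ?z)"
      using E.nat_trans_apply[OF E'.compare_nat A B f] z(1) by (simp add: E.kan_simps)
    have "\<theta> B (farr G A B f y) = farr G' A B f (\<theta> A y)"
      using \<theta>_compare[OF B kz] \<theta>_compare[OF A z(1)] n n' z(2) by simp
    then show "compose (carrier (fobj G A)) (\<theta> B) (farr G A B f) y = compose (carrier (fobj G A)) (farr G' A B f) (\<theta> A) y"
      using y by (simp add: compose_eq)
  qed
  have compat: "compose (carrier (fobj G A)) (\<iota>' A) (\<theta> A) = \<iota> A" if A: "A \<in> obj E.Fmods" for A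
  proof (rule E.arr_eqI)
    note A' = E.Fmods_Mods[OF A]
    show "compose (carrier (fobj G A)) (\<iota>' A) (\<theta> A) \<in> arr E.Mods (fobj G A) (fobj F A)"
      using functor_obj[OF E.G_functor A'] \<theta>_arr[OF A'] E'.\<iota>_arr[OF A] by (rule E.comp_arr)
    show "\<iota> A \<in> arr E.Mods (fobj G A) (fobj F A)" using A by (rule E.\<iota>_arr)
    fix y assume y: "y \<in> carrier (fobj G A)"
    note z = pre[OF A' y]
    show "compose (carrier (fobj G A)) (\<iota>' A) (\<theta> A) y = \<iota> A y"
      using y \<theta>_compare[OF A' z(1)] E.\<iota>_compare[OF A z(1)] E'.\<iota>_compare[OF A z(1)] z(2) by (simp add: compose_eq)
  qed
  have "nat_iso E.Mods E.Mods G G' \<theta>"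
    unfolding nat_iso_def nat_trans_def cmp_MOD using \<theta>_arr nat iso by blast
  then show ?thesis using compat by (auto simp: cmp_MOD)
qed

theorem theorem1:
  fixes small :: "'u set \<Rightarrow> bool"
    and R :: "'a ring"
    and F :: "(('a, 'u) module, 'u \<Rightarrow> 'u, ('a, 'u) module, 'u \<Rightarrow> 'u) func"
  assumes "universe small"
    and "cring R"
    and "\<exists>e :: 'a \<Rightarrow> 'u. inj_on e (carrier R) \<and> small (e ` carrier R)"
    and "is_functor (FMOD small R) (MOD small R) F"
  shows "(\<exists>G \<iota>. is_extension small R F G \<iota> \<and> right_exact small R G \<and>
            preserves_filtered_colimits small (MOD small R) (MOD small R) G) \<and>
         (\<forall>G \<iota> G' \<iota>'.
            is_extension small R F G \<iota> \<and> right_exact small R G \<and>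
            preserves_filtered_colimits small (MOD small R) (MOD small R) G \<and>
            is_extension small R F G' \<iota>' \<and> right_exact small R G' \<and>
            preserves_filtered_colimits small (MOD small R) (MOD small R) G' \<longrightarrow>
            (\<exists>\<theta>. nat_iso (MOD small R) (MOD small R) G G' \<theta> \<and>
              (\<forall>A \<in> obj (FMOD small R).
                cmp (MOD small R) (fobj G A) (fobj G' A) (fobj F A) (\<iota>' A) (\<theta> A) = \<iota> A)))"
proof -
  have on_free: "functor_on_free small R F"
    using assms
    by (intro functor_on_free.intro functor_on_free_axioms.intro module_universe.intro module_universe_axioms.intro)
  interpret functor_on_free small R F by (rule on_free)
  show ?thesis
  proof (intro conjI allI impI)
    show "\<exists>G \<iota>. is_extension small R F G \<iota> \<and> right_exact small R G \<and>
        preserves_filtered_colimits small Mods Mods G"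
      using kan_extension kan_right_exact kan_preserves_filtered_colimits by blast
  next
    fix G G' \<iota> \<iota>'
    assume *: "is_extension small R F G \<iota> \<and> right_exact small R G \<and>
        preserves_filtered_colimits small Mods Mods G \<and>
        is_extension small R F G' \<iota>' \<and> right_exact small R G' \<and>
        preserves_filtered_colimits small Mods Mods G'"
    show "\<exists>\<theta>. nat_iso Mods Mods G G' \<theta> \<and>
        (\<forall>A \<in> obj Fmods. cmp Mods (fobj G A) (fobj G' A) (fobj F A) (\<iota>' A) (\<theta> A) = \<iota> A)"
      by (rule extensions_unique; intro extension.intro extension_axioms.intro on_free) (use * in blast)+
  qed
qed

end
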